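(* Suppose $K:\mathbb{R}\to\mathbb{R}$ satisfies Assumption (A). If $w,\widetilde{w}\in L_{1/2}(\mathbb{R})$ are solutions of $(-\Delta)^{1/2}w=Ke^{w}$ and $(-\Delta)^{1/2}\widetilde w=Ke^{\widetilde w}$ in $\mathbb{R}$ satisfying $\int_{\mathbb{R}}Ke^{w}\,dx<+\infty$ and $\int_{\mathbb{R}}Ke^{\widetilde w}\,dx<+\infty$, then $\widetilde{w}(0)=w(0)$ implies $\widetilde{w}\equiv w$.
   Context: All functions are real-valued. $\langle x\rangle=\sqrt{1+x^2}$. Assumption (A) on $K:\mathbb{R}\to\mathbb{R}$: (i) $K$ is strictly positive, even and monotone decreasing (i.e. non-increasing) in $|x|$; (ii) $K$ is continuously differentiable and there are constants $C>0$, $\delta>0$ with $\sqrt{K}(x)+|x\,\partial_x\sqrt{K}(x)|\le C\langle x\rangle^{-1/2-\delta}$ for all $x\in\mathbb{R}$. $L_{1/2}(\mathbb{R})=\{f\in L^1_{\mathrm{loc}}(\mathbb{R}):\int_{\mathbb{R}}\frac{|f(x)|}{1+x^2}\,dx<+\infty\}$. For $w\in L_{1/2}(\mathbb{R})$ with $Ke^w\in L^1(\mathbb{R})$, the equation $(-\Delta)^{1/2}w=Ke^w$ is understood in the sense of distributions: $\int_{\mathbb{R}}w\,(-\Delta)^{1/2}\varphi\,dx=\int_{\mathbb{R}}Ke^w\varphi\,dx$ for all test functions $\varphi\in C_c^\infty(\mathbb{R})$, where $(-\Delta)^{1/2}$ is the Fourier multiplier with symbol $|\xi|$. Such solutions have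 a $C^{1,1/2}_{\mathrm{loc}}$ representative, and pointwise values refer to this representative. *)

theory Defs
  imports "HOL-Analysis.Analysis"
begin

definition japanese_bracket :: "real \<Rightarrow> real"
  where "japanese_bracket x = sqrt (1 + x\<^sup>2)"

definition assumption_A :: "(real \<Rightarrow> real) \<Rightarrow> bool"
  where "assumption_A K \<longleftrightarrow>
    (\<forall>x. K x > 0) \<and> (\<forall>x. K (- x) = K x) \<and> (\<forall>x y. \<bar>x\<bar> \<le> \<bar>y\<bar> \<longrightarrow> K y \<le> K x) \<and>
    K C1_differentiable_on UNIV \<and>
    (\<exists>C>0. \<exists>\<delta>>0. \<forall>x. sqrt (K x) + \<bar>x * deriv (\<lambda>y. sqrt (K y)) x\<bar>
                       \<le> C * japanese_bracket x powr (- 1/2 - \<delta>))"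

(* Elements of this space, and the solutions below, are individual functions rather than classes
   modulo null sets; every condition imposed on them is invariant under changes on null sets. *)
definition L_half :: "(real \<Rightarrow> real) set"
  where "L_half = {f. (\<forall>S. compact S \<longrightarrow> f absolutely_integrable_on S) \<and>
                      integrable lebesgue (\<lambda>x. \<bar>f x\<bar> / (1 + x\<^sup>2))}"

definition test_function :: "(real \<Rightarrow> real) \<Rightarrow> bool"
  where "test_function \<phi> \<longleftrightarrow>
    (\<forall>n x. (deriv ^^ n) \<phi> differentiable (at x)) \<and> compact (closure {x. \<phi> x \<noteq> 0})"

(* With this normalisation of the transforms, minus the second derivative has symbol \<xi>^2. *)
definition fourier :: "(real \<Rightarrow> complex) \<Rightarrow> real \<Rightarrow> complex"
  where "fourier f \<xi> = (LINT x|lebesgue. exp (- \<i> * of_real (x * \<xi>)) * f x)"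

definition inverse_fourier :: "(real \<Rightarrow> complex) \<Rightarrow> real \<Rightarrow> complex"
  where "inverse_fourier g x = (LINT \<xi>|lebesgue. exp (\<i> * of_real (x * \<xi>)) * g \<xi>) / of_real (2 * pi)"

(* Only applied to real-valued test functions. There both integrals converge absolutely, and the
   inverse transform is real-valued because the symbol is even, so Re discards nothing. *)
definition half_laplacian :: "(real \<Rightarrow> real) \<Rightarrow> real \<Rightarrow> real"
  where "half_laplacian \<phi> x =
    Re (inverse_fourier (\<lambda>\<xi>. of_real \<bar>\<xi>\<bar> * fourier (\<lambda>y. of_real (\<phi> y)) \<xi>) x)"

(* To be used together with w \<in> L_half and integrability of K e^w. Both integrals then converge
   absolutely, since the half-Laplacian of a test function is O(1 / (1 + x^2)). *)
definition solves_liouville :: "(real \<Rightarrow> real) \<Rightarrow> (real \<Rightarrow> real) \<Rightarrow> bool"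
  where "solves_liouville K w \<longleftrightarrow>
    (\<forall>\<phi>. test_function \<phi> \<longrightarrow>
       (LINT x|lebesgue. w x * half_laplacian \<phi> x) = (LINT x|lebesgue. K x * exp (w x) * \<phi> x))"

definition C1_half_loc :: "(real \<Rightarrow> real) \<Rightarrow> bool"
  where "C1_half_loc f \<longleftrightarrow>
    (\<forall>x. f differentiable (at x)) \<and>
    (\<forall>S. compact S \<longrightarrow>
       (\<exists>C. \<forall>x\<in>S. \<forall>y\<in>S. \<bar>deriv f x - deriv f y\<bar> \<le> C * \<bar>x - y\<bar> powr (1/2)))"

(* Such a W is unique, since two continuous functions that agree almost everywhere are equal.
   Pointwise values of a solution w are the values of its representative W. *)
definition regular_representative :: "(real \<Rightarrow> real) \<Rightarrow> (real \<Rightarrow> real) \<Rightarrow> bool"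
  where "regular_representative W w \<longleftrightarrow> C1_half_loc W \<and> (AE x in lebesgue. W x = w x)"

end

theory Submission
  imports Defs "HOL-Real_Asymp.Real_Asymp" "HOL-Computational_Algebra.Polynomial"
begin

text \<open>For \<open>t > 0\<close> the half-Laplacian of \<open>t/(t\<^sup>2 + x\<^sup>2)\<close> is minus its \<open>t\<close>-derivative. Testing the equation with
  cut-off translates of this function and integrating over \<open>t\<close> gives, as \<open>t\<close> tends to \<open>0\<close> and to infinity,
  \<open>pi (W z - W y) = \<integral> K e\<^sup>W (ln |x - y| - ln |x - z|) dx\<close>. Moving planes applied to this integral equation
  show that \<open>W\<close> is even and strictly decreasing on the positive half-line.

  For two solutions put \<open>\<phi> = W' - W\<close> and \<open>h = K (e\<^bsup>W'\<^esup> - e\<^sup>W)\<close>, both even and vanishing at \<open>0\<close>, and evaluate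
  the integral of \<open>h \<phi>'\<close> over the positive half-line in two ways. Since \<open>pi \<phi>'\<close> is minus the principal value
  convolution of \<open>h\<close> with \<open>1/x\<close>, the antisymmetric kernel \<open>1/(x - t)\<close> cancels and the positive semidefinite
  kernel \<open>1/(x + t)\<close> gives a value \<open>\<le> 0\<close>. On the other hand \<open>h \<phi>' = K e\<^bsup>(W + W')/2\<^esup> (4 cosh (\<phi>/2) - 4)'\<close>
  with a strictly decreasing first factor, so integrating by parts gives a positive value unless \<open>\<phi> = 0\<close>.\<close>

text \<open>Moving planes needs an estimate that is uniform in the position of the plane: an L1
  bound for \<open>f * (green 0 x)^2\<close> independent of \<open>x\<close>. It rests on a
  scale-invariant bound for \<open>x * f x\<close>, but no upper bound for \<open>W\<close> is
  given. A doubling argument supplies \<open>W x \<le> c + \<delta> * ln |x|\<close>, the largest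
  growth that the decay of \<open>K\<close> can pay for. \<open>K\<close> may be constant on
  intervals, so strictness has to be won for \<open>W\<close>: a plane where the reflected solution
  touches would make \<open>K\<close> return to the value \<open>K 0\<close> along an unbounded
  sequence. In the uniqueness step \<open>\<phi>'\<close> is continuous but has no known decay, and
  \<open>1/(x - t)\<close> is not absolutely integrable. Hence no principal value is ever formed:
  the derivative sits on \<open>h\<close> times a tent of slope \<open>1/n\<close>, the logarithm is
  regularised at scale \<open>y\<close>, and only the regularised kernel is integrated by parts. The
  normalisation at 0 matters because 0 is the common centre of symmetry: \<open>\<phi>\<close> and
  \<open>h\<close> vanish at the end point of the half-line, and no boundary terms remain.\<close>

lemma integral_FTC_atLeast:
  fixes f F :: "real \<Rightarrow> 'a::euclidean_space"
  assumes int: "integrable lborel (\<lambda>x. indicator {a..} x *\<^sub>R f x)"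
    and F: "\<And>x. a \<le> x \<Longrightarrow> (F has_vector_derivative f x) (at x)"
    and cont: "continuous_on {a..} f" and lim: "(F \<longlongrightarrow> B) at_top"
  shows "(LINT x|lborel. indicator {a..} x *\<^sub>R f x) = B - F a"
proof -
  have "((\<lambda>y. LINT x|lborel. indicator {..y} x *\<^sub>R (indicator {a..} x *\<^sub>R f x)) \<longlongrightarrow>
      (LINT x|lborel. indicator {a..} x *\<^sub>R f x)) at_top"
    by (rule tendsto_integral_at_top[OF _ int]) auto
  moreover have "eventually (\<lambda>y. (LINT x|lborel. indicator {..y} x *\<^sub>R (indicator {a..} x *\<^sub>R f x)) = F y - F a) at_top"
    using eventually_ge_at_top[of a]
  proof eventually_elim
    case (elim y)
    have "(LINT x|lborel. indicator {..y} x *\<^sub>R (indicator {a..} x *\<^sub>R f x)) = (LINT x|lborel. indicator {a..y} x *\<^sub>R f x)"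
      by (intro Bochner_Integration.integral_cong) (auto simp: indicator_def)
    also have "\<dots> = F y - F a"
      using elim by (intro integral_FTC_atLeastAtMost continuous_on_subset[OF cont])
        (auto intro: has_vector_derivative_at_within[OF F])
    finally show ?case .
  qed
  ultimately have "((\<lambda>y. F y - F a) \<longlongrightarrow> (LINT x|lborel. indicator {a..} x *\<^sub>R f x)) at_top"
    by (rule Lim_transform_eventually)
  moreover have "((\<lambda>y. F y - F a) \<longlongrightarrow> B - F a) at_top"
    by (intro tendsto_intros lim)
  ultimately show ?thesis
    using tendsto_unique trivial_limit_at_top_linorder by blast
qed

lemma integral_split_at_zero:
  fixes f :: "real \<Rightarrow> 'a::euclidean_space"
  assumes "integrable lborel f"
  shows "(LINT x|lborel. f x) = (LINT x|lborel. indicator {0..} x *\<^sub>R (f x + f (- x)))"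
proof -
  have [measurable]: "f \<in> borel_measurable borel" using assms by auto
  have i1: "integrable lborel (\<lambda>x. indicator {0..} x *\<^sub>R f x)"
    using assms by (intro integrable_mult_indicator) auto
  have i2: "integrable lborel (\<lambda>x. indicator {..0} x *\<^sub>R f x)"
    using assms by (intro integrable_mult_indicator) auto
  have i3: "integrable lborel (\<lambda>x. indicator {0..} x *\<^sub>R f (- x))"
    using lborel_integrable_real_affine[OF i2, of "-1" 0] by (simp add: indicator_def)
  have "(LINT x|lborel. f x) = (LINT x|lborel. indicator {0..} x *\<^sub>R f x + indicator {..0} x *\<^sub>R f x)"
    by (rule integral_cong_AE) (use AE_lborel_singleton[of "0::real"] in \<open>auto elim!: eventually_mono simp: indicator_def\<close>)
  also have "\<dots> = (LINT x|lborel. indicator {0..} x *\<^sub>R f x) + (LINT x|lborel. indicator {..0} x *\<^sub>R f x)"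
    by (rule Bochner_Integration.integral_add[OF i1 i2])
  also have "(LINT x|lborel. indicator {..0} x *\<^sub>R f x) = (LINT x|lborel. indicator {0..} x *\<^sub>R f (- x))"
    by (subst lborel_integral_real_affine[of "-1" _ 0]) (auto simp: indicator_def intro!: Bochner_Integration.integral_cong)
  also have "(LINT x|lborel. indicator {0..} x *\<^sub>R f x) + (LINT x|lborel. indicator {0..} x *\<^sub>R f (- x)) =
     (LINT x|lborel. indicator {0..} x *\<^sub>R (f x + f (- x)))"
    by (simp add: Bochner_Integration.integral_add[OF i1 i3, symmetric] scaleR_add_right)
  finally show ?thesis .
qed

lemma integrable_FTC_atLeast_nonneg:
  fixes f F :: "real \<Rightarrow> real"
  assumes F: "\<And>x. a \<le> x \<Longrightarrow> (F has_real_derivative f x) (at x)"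
    and [measurable]: "f \<in> borel_measurable borel" and nn: "\<And>x. a \<le> x \<Longrightarrow> 0 \<le> f x"
    and lim: "(F \<longlongrightarrow> B) at_top"
  shows "integrable lborel (\<lambda>x. indicator {a..} x * f x)"
proof -
  have "(\<integral>\<^sup>+x. ennreal (f x) * indicator {a ..} x \<partial>lborel) = ennreal (B - F a)"
    by (rule nn_integral_FTC_atLeast[OF _ F nn lim]) auto
  moreover have "(\<integral>\<^sup>+x. ennreal (f x) * indicator {a ..} x \<partial>lborel) = (\<integral>\<^sup>+x. ennreal (norm (indicator {a..} x * f x)) \<partial>lborel)"
    by (intro nn_integral_cong) (auto simp: indicator_def nn)
  ultimately show ?thesis
    by (intro integrableI_bounded) auto
qed

lemma integrable_even_iff:
  fixes f :: "real \<Rightarrow> real"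
  assumes [measurable]: "f \<in> borel_measurable borel" and ev: "\<And>x. f (- x) = f x"
    and i: "integrable lborel (\<lambda>x. indicator {0..} x * f x)"
  shows "integrable lborel f"
proof -
  have "integrable lborel (\<lambda>x. indicator {..0} x * f x)"
    using lborel_integrable_real_affine[OF i, of "-1" 0] by (simp add: indicator_def ev)
  then have "integrable lborel (\<lambda>x. indicator {0..} x * f x + indicator {..0} x * f x)"
    by (intro Bochner_Integration.integrable_add i)
  then have "integrable lborel (\<lambda>x. norm (indicator {0..} x * f x + indicator {..0} x * f x))"
    by (rule integrable_norm)
  then show ?thesis
    by (rule Bochner_Integration.integrable_bound) (auto simp: indicator_def)
qed

lemma integral_inverse_square:
  shows integrable_inverse_square_plus: "c > 0 \<Longrightarrow> integrable lborel (\<lambda>x::real. 1 / (c\<^sup>2 + x\<^sup>2))"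
    and LINT_inverse_square_plus: "c > 0 \<Longrightarrow> (LINT x|lborel. 1 / (c\<^sup>2 + x\<^sup>2)) = pi / c"
proof -
  assume c: "c > 0"
  have nz: "c\<^sup>2 + x\<^sup>2 \<noteq> 0" for x :: real
    using c by (metis add_pos_nonneg less_irrefl zero_le_power2 zero_less_power)
  have D: "((\<lambda>x. arctan (x / c) / c) has_real_derivative 1 / (c\<^sup>2 + x\<^sup>2)) (at x)" for x
  proof -
    have "1 / (c\<^sup>2 + x\<^sup>2) = 1 / c / (1 + (x / c)\<^sup>2) / c"
      using c nz[of x] by (simp add: power_divide add_divide_distrib[symmetric] add_num_frac power2_eq_square)
    then show ?thesis
      using c by (auto intro!: derivative_eq_intros simp: inverse_eq_divide)
  qed
  have lim: "((\<lambda>x. arctan (x / c) / c) \<longlongrightarrow> pi / 2 / c) at_top"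
  proof (rule tendsto_divide)
    show "((\<lambda>x. arctan (x / c)) \<longlongrightarrow> pi / 2) at_top"
      by (rule filterlim_compose[OF tendsto_arctan_at_top])
        (use c in \<open>auto intro!: filterlim_at_top_mult_tendsto_pos tendsto_const filterlim_ident simp: divide_inverse mult.commute filterlim_tendsto_pos_mult_at_top\<close>)
  qed (use c in auto)
  have i: "integrable lborel (\<lambda>x. indicator {0..} x * (1 / (c\<^sup>2 + x\<^sup>2)))"
    by (rule integrable_FTC_atLeast_nonneg[OF D _ _ lim]) auto
  show I: "integrable lborel (\<lambda>x::real. 1 / (c\<^sup>2 + x\<^sup>2))"
    by (rule integrable_even_iff[OF _ _ i]) auto
  have "(LINT x|lborel. 1 / (c\<^sup>2 + x\<^sup>2)) = (LINT x|lborel. 2 * (indicator {0..} x *\<^sub>R (1 / (c\<^sup>2 + x\<^sup>2))))"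
    by (subst integral_split_at_zero[OF I]) (auto intro!: Bochner_Integration.integral_cong simp: indicator_def)
  also have "\<dots> = 2 * (LINT x|lborel. indicator {0..} x *\<^sub>R (1 / (c\<^sup>2 + x\<^sup>2)))"
    by (rule integral_mult_right_zero)
  also have "(LINT x|lborel. indicator {0..} x *\<^sub>R (1 / (c\<^sup>2 + x\<^sup>2))) = pi / 2 / c - arctan (0 / c) / c"
    using i nz D[THEN has_real_derivative_iff_has_vector_derivative[THEN iffD1]]
    by (intro integral_FTC_atLeast[OF _ _ _ lim]) (auto intro!: continuous_intros)
  finally show "(LINT x|lborel. 1 / (c\<^sup>2 + x\<^sup>2)) = pi / c" by simp
qed

lemma integrable_decay:
  fixes f :: "real \<Rightarrow> 'a::euclidean_space"
  assumes "f \<in> borel_measurable borel" "\<And>x. norm (f x) \<le> A / (1 + x\<^sup>2)"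
  shows "integrable lborel f"
proof (rule Bochner_Integration.integrable_bound)
  show "integrable lborel (\<lambda>x. A * (1 / (1\<^sup>2 + x\<^sup>2)))"
    using integrable_inverse_square_plus[of 1] by (intro integrable_mult_right) auto
  show "AE x in lborel. norm (f x) \<le> norm (A * (1 / (1\<^sup>2 + x\<^sup>2)))"
    by (auto intro!: AE_I2 order_trans[OF assms(2)] divide_right_mono)
qed (use assms in auto)

text \<open>With \<open>y = e * |x|\<close>, the terms of order 1 and 3 of the exponential series
  bound \<open>y * exp (- y)\<close> by 1 and \<open>y ^ 3 * exp (- y)\<close> by 6, the factorial
  of 3. This is the integrable majorant of the Abel-regularised symbol.\<close>

lemma exp_decay_bound:
  fixes e x :: real
  assumes "e > 0"
  shows "\<bar>x\<bar> * exp (- e * \<bar>x\<bar>) \<le> (1 / e + 6 / e ^ 3) / (1 + x\<^sup>2)"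
proof -
  define y where "y = e * \<bar>x\<bar>"
  have y: "y \<ge> 0" "\<bar>x\<bar> = y / e" using assms by (auto simp: y_def)
  have pow: "y ^ n / fact n \<le> exp y" for n
  proof -
    have "(\<Sum>k\<in>{n}. y ^ k /\<^sub>R fact k) \<le> exp y"
      unfolding exp_def by (rule sum_le_suminf[OF summable_exp_generic]) (use y in auto)
    then show ?thesis by (simp add: divide_inverse mult.commute)
  qed
  have "y \<le> exp y" "y ^ 3 \<le> 6 * exp y"
    using pow[of 1] pow[of 3] by (auto simp: fact_numeral)
  then have "y * exp (- y) \<le> 1" "y ^ 3 * exp (- y) \<le> 6"
    by (auto simp: exp_minus field_simps)
  moreover have "\<bar>x\<bar> * exp (- e * \<bar>x\<bar>) * (1 + x\<^sup>2) = y * exp (- y) / e + y ^ 3 * exp (- y) / e ^ 3"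
  proof -
    have "x\<^sup>2 = (y / e)\<^sup>2" using y(2) by (metis power2_abs)
    moreover have "- e * \<bar>x\<bar> = - y" by (simp add: y_def)
    ultimately show ?thesis using assms unfolding y(2)
      by (simp add: field_simps power2_eq_square power3_eq_cube)
  qed
  ultimately have "\<bar>x\<bar> * exp (- e * \<bar>x\<bar>) * (1 + x\<^sup>2) \<le> 1 / e + 6 / e ^ 3"
    using assms by (auto intro!: add_mono divide_right_mono)
  then show ?thesis
    by (subst pos_le_divide_eq) (auto simp: add_pos_nonneg)
qed

section \<open>The half-Laplacian as a singular integral\<close>

text \<open>Pairing \<open>s\<close> with \<open>- s\<close> removes the first-order term, so that
  division by \<open>s^2\<close> stays bounded near 0 and the singular integral needs no principal
  value.\<close>

definition second_diff :: "(real \<Rightarrow> real) \<Rightarrow> real \<Rightarrow> real \<Rightarrow> real"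
  where "second_diff \<phi> x s = 2 * \<phi> x - \<phi> (x + s) - \<phi> (x - s)"

text \<open>The two rates are those of \<open>1 / (t^2 + x^2)\<close> and of its second derivative,
  so the class contains these functions as well as all test functions. A single constant
  \<open>A\<close> allows bounds uniform over a family.\<close>

definition decay_C2 :: "real \<Rightarrow> (real \<Rightarrow> real) \<Rightarrow> bool"
  where "decay_C2 A \<phi> \<longleftrightarrow> (\<exists>\<phi>' \<phi>''. (\<forall>x. (\<phi> has_real_derivative \<phi>' x) (at x)) \<and>
    (\<forall>x. (\<phi>' has_real_derivative \<phi>'' x) (at x)) \<and>
    (\<forall>x. \<bar>\<phi> x\<bar> \<le> A / (1 + x\<^sup>2)) \<and> (\<forall>x. \<bar>\<phi>'' x\<bar> \<le> A / (1 + x\<^sup>2)\<^sup>2))"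

text \<open>The mean value theorem is applied twice, first to
  \<open>\<phi> (x + r) + \<phi> (x - r)\<close> as a function of \<open>r\<close>, then to
  \<open>\<phi>'\<close> between \<open>x - z\<close> and \<open>x + z\<close>. The factor 2 is not
  sharp, but only the order \<open>s^2\<close> matters.\<close>

lemma second_diff_le:
  assumes D1: "\<And>y. (\<phi> has_real_derivative \<phi>' y) (at y)"
    and D2: "\<And>y. (\<phi>' has_real_derivative \<phi>'' y) (at y)"
    and B: "\<And>y. \<bar>y - x\<bar> \<le> \<bar>s\<bar> \<Longrightarrow> \<bar>\<phi>'' y\<bar> \<le> B"
  shows "\<bar>second_diff \<phi> x s\<bar> \<le> 2 * B * s\<^sup>2"
proof (cases "s = 0")
  case False
  define r where "r = \<bar>s\<bar>"
  have r: "r > 0" and sd: "second_diff \<phi> x s = second_diff \<phi> x r"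
    using False by (auto simp: r_def second_diff_def abs_if)
  obtain z where z: "0 < z" "z < r"
    "\<phi> (x + r) + \<phi> (x - r) - (\<phi> (x + 0) + \<phi> (x - 0)) = (r - 0) * (\<phi>' (x + z) - \<phi>' (x - z))"
  proof -
    have "\<exists>z>0. z < r \<and> \<phi> (x + r) + \<phi> (x - r) - (\<phi> (x + 0) + \<phi> (x - 0)) = (r - 0) * (\<phi>' (x + z) - \<phi>' (x - z))"
      by (rule MVT2[OF r, of "\<lambda>r. \<phi> (x + r) + \<phi> (x - r)"])
        (auto intro!: derivative_eq_intros DERIV_chain2[OF D1])
    then show ?thesis using that by auto
  qed
  obtain t where t: "x - z < t" "t < x + z" "\<phi>' (x + z) - \<phi>' (x - z) = (x + z - (x - z)) * \<phi>'' t"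
    using MVT2[of "x - z" "x + z" \<phi>' \<phi>''] D2 z by auto
  have "\<phi> (x + r) + \<phi> (x - r) - 2 * \<phi> x = r * (2 * z * \<phi>'' t)"
    using z(3) unfolding t(3) by simp
  then have "second_diff \<phi> x r = - (r * (2 * z * \<phi>'' t))"
    unfolding second_diff_def by linarith
  then have "\<bar>second_diff \<phi> x r\<bar> = r * (2 * z * \<bar>\<phi>'' t\<bar>)"
    using z r by (simp add: abs_mult)
  also have "\<dots> \<le> r * (2 * r * B)"
    using z t B[of t] by (intro mult_left_mono mult_mono) (auto simp: r_def)
  also have "\<dots> = 2 * B * r\<^sup>2" by (simp add: power2_eq_square)
  finally show ?thesis by (simp add: sd r_def)
qed (simp add: second_diff_def)

text \<open>A majorant in \<open>s\<close> that depends on the function only through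
  \<open>A\<close>, hence usable for dominated convergence along a family. The first term is the
  Taylor estimate for \<open>|s| \<le> (1 + |x|) / 2\<close>; for larger \<open>|s|\<close> the
  second carries the values at \<open>x + s\<close> and \<open>x - s\<close>, the third the value at
  \<open>x\<close>.\<close>

definition second_diff_bound :: "real \<Rightarrow> real \<Rightarrow> real \<Rightarrow> real"
  where "second_diff_bound A x s = 128 * A / (1 + x\<^sup>2)\<^sup>2 * indicator {- ((1 + \<bar>x\<bar>) / 2)..(1 + \<bar>x\<bar>) / 2} s +
     4 * A / (1 + x\<^sup>2) * (1 / (1 + (x + s)\<^sup>2) + 1 / (1 + (x - s)\<^sup>2)) + 10 * A / (1 + x\<^sup>2) * (1 / (1 + s\<^sup>2))"

lemma second_diff_decay:
  assumes "decay_C2 A \<phi>"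
  shows "\<bar>second_diff \<phi> x s\<bar> / s\<^sup>2 \<le> second_diff_bound A x s"
proof -
  obtain \<phi>' \<phi>'' where D1: "\<And>x. (\<phi> has_real_derivative \<phi>' x) (at x)"
    and D2: "\<And>x. (\<phi>' has_real_derivative \<phi>'' x) (at x)"
    and b0: "\<And>x. \<bar>\<phi> x\<bar> \<le> A / (1 + x\<^sup>2)" and b2: "\<And>x. \<bar>\<phi>'' x\<bar> \<le> A / (1 + x\<^sup>2)\<^sup>2"
    using assms unfolding decay_C2_def by blast
  have A: "A \<ge> 0" using b0[of 0] by simp
  define \<rho> where "\<rho> = (1 + \<bar>x\<bar>) / 2"
  have \<rho>: "\<rho> \<ge> 1/2" "\<rho>\<^sup>2 * 4 \<ge> 1 + x\<^sup>2" by (auto simp: \<rho>_def power2_eq_square field_simps)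
  have pos: "1 + y\<^sup>2 > 0" for y :: real by (simp add: add_pos_nonneg)
  show ?thesis
  proof (cases "\<bar>s\<bar> \<le> \<rho>")
    case True
    have "\<bar>\<phi>'' y\<bar> \<le> 64 * A / (1 + x\<^sup>2)\<^sup>2" if "\<bar>y - x\<bar> \<le> \<bar>s\<bar>" for y
    proof -
      have "\<bar>y\<bar> \<ge> (\<bar>x\<bar> - 1) / 2" using that True by (auto simp: \<rho>_def)
      \<comment> \<open>For \<open>|x| \<ge> 1\<close> this reduces to
        \<open>x^2 - 4 * |x| + 9 \<ge> 0\<close>, which follows from
        \<open>(|x| - 2)^2 \<ge> 0\<close>. Hence \<open>\<phi>''\<close> is still of size
        \<open>1 / (1 + x^2)^2\<close> at every point within \<open>(1 + |x|) / 2\<close> of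
        \<open>x\<close>.\<close>
      then have "1 + y\<^sup>2 \<ge> (1 + x\<^sup>2) / 8"
      proof (cases "\<bar>x\<bar> \<ge> 1")
        case True
        then have "((\<bar>x\<bar> - 1) / 2)\<^sup>2 \<le> \<bar>y\<bar>\<^sup>2" using \<open>\<bar>y\<bar> \<ge> _\<close> by (intro power_mono) auto
        moreover have "0 \<le> (\<bar>x\<bar> - 2)\<^sup>2" by simp
        moreover have "((\<bar>x\<bar> - 1) / 2)\<^sup>2 = (x\<^sup>2 - 2 * \<bar>x\<bar> + 1) / 4" "(\<bar>x\<bar> - 2)\<^sup>2 = x\<^sup>2 - 4 * \<bar>x\<bar> + 4" "\<bar>y\<bar>\<^sup>2 = y\<^sup>2"
          by (simp_all add: power2_diff power_divide)
        ultimately have "(x\<^sup>2 - 2 * \<bar>x\<bar> + 1) / 4 \<le> y\<^sup>2" "0 \<le> x\<^sup>2 - 4 * \<bar>x\<bar> + 4" by metis+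
        then show ?thesis by argo
      next
        case False
        then have "x\<^sup>2 \<le> 1" by (simp add: abs_square_le_1)
        then show ?thesis using zero_le_power2[of y] by argo
      qed
      then have "((1 + x\<^sup>2) / 8)\<^sup>2 \<le> (1 + y\<^sup>2)\<^sup>2" using pos[of x] by (intro power_mono) auto
      then have "A / (1 + y\<^sup>2)\<^sup>2 \<le> A / ((1 + x\<^sup>2) / 8)\<^sup>2"
        using A pos[of x] pos[of y] by (intro divide_left_mono mult_pos_pos zero_less_power) auto
      also have "\<dots> = 64 * A / (1 + x\<^sup>2)\<^sup>2" by (simp add: power_divide)
      finally show ?thesis using b2[of y] by simp
    qed
    from second_diff_le[OF D1 D2 this]
    have "\<bar>second_diff \<phi> x s\<bar> \<le> 128 * A / (1 + x\<^sup>2)\<^sup>2 * s\<^sup>2" by simp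
    then have "\<bar>second_diff \<phi> x s\<bar> / s\<^sup>2 \<le> 128 * A / (1 + x\<^sup>2)\<^sup>2"
      using A by (cases "s = 0") (auto simp: divide_le_eq)
    also have "\<dots> \<le> second_diff_bound A x s"
    proof -
      have "indicat_real {- ((1 + \<bar>x\<bar>) / 2)..(1 + \<bar>x\<bar>) / 2} s = 1"
        unfolding \<rho>_def[symmetric] using True by (simp add: indicator_def) linarith
      moreover have "0 \<le> 4 * A / (1 + x\<^sup>2) * (1 / (1 + (x + s)\<^sup>2) + 1 / (1 + (x - s)\<^sup>2))" "0 \<le> 10 * A / (1 + x\<^sup>2) * (1 / (1 + s\<^sup>2))"
        by (rule mult_nonneg_nonneg; simp add: A)+
      ultimately show ?thesis unfolding second_diff_bound_def by simp
    qed
    finally show ?thesis .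
  next
    case False
    \<comment> \<open>Beyond the threshold \<open>s^2\<close> dominates both
      \<open>(1 + x^2) / 4\<close> and \<open>(1 + s^2) / 5\<close>. The first serves the shifted
      values, which bring their own decay in \<open>s\<close>; the second gives integrability in
      \<open>s\<close> to the term with the fixed value at \<open>x\<close>.\<close>
    have s2: "s\<^sup>2 \<ge> \<rho>\<^sup>2" using False \<rho>(1) by (auto simp: abs_le_square_iff[symmetric])
    then have s1: "s\<^sup>2 * 4 \<ge> 1 + x\<^sup>2" using \<rho> by linarith
    have s3: "5 * s\<^sup>2 \<ge> 1 + s\<^sup>2" using s1 zero_le_power2[of x] by linarith
    have sp: "s\<^sup>2 > 0" using s1 pos[of x] by linarith
    have i1: "1 / s\<^sup>2 \<le> 4 / (1 + x\<^sup>2)"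
      unfolding pos_le_divide_eq[OF pos] using s1 sp by (simp add: pos_divide_le_eq mult.commute)
    have i2: "1 / s\<^sup>2 \<le> 5 / (1 + s\<^sup>2)"
      unfolding pos_le_divide_eq[OF pos] times_divide_eq_left mult_1 pos_divide_le_eq[OF sp] by (rule s3)
    have "\<bar>second_diff \<phi> x s\<bar> \<le> 2 * \<bar>\<phi> x\<bar> + (\<bar>\<phi> (x + s)\<bar> + \<bar>\<phi> (x - s)\<bar>)"
      unfolding second_diff_def by linarith
    then have "\<bar>second_diff \<phi> x s\<bar> / s\<^sup>2 \<le> (2 * \<bar>\<phi> x\<bar> + (\<bar>\<phi> (x + s)\<bar> + \<bar>\<phi> (x - s)\<bar>)) / s\<^sup>2"
      by (intro divide_right_mono) auto
    also have "\<dots> = 2 * \<bar>\<phi> x\<bar> * (1 / s\<^sup>2) + (\<bar>\<phi> (x + s)\<bar> + \<bar>\<phi> (x - s)\<bar>) * (1 / s\<^sup>2)"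
      by (simp add: add_divide_distrib)
    also have "\<dots> \<le> 2 * (A / (1 + x\<^sup>2)) * (5 / (1 + s\<^sup>2)) + (A / (1 + (x + s)\<^sup>2) + A / (1 + (x - s)\<^sup>2)) * (4 / (1 + x\<^sup>2))"
    proof (rule add_mono)
      have n: "A / (1 + y\<^sup>2) \<ge> 0" for y using A pos[of y] by simp
      have "2 * \<bar>\<phi> x\<bar> \<le> 2 * (A / (1 + x\<^sup>2))" by (rule mult_left_mono[OF b0]) simp
      moreover have "0 \<le> 2 * (A / (1 + x\<^sup>2))" by (rule mult_nonneg_nonneg[OF _ n]) simp
      ultimately show "2 * \<bar>\<phi> x\<bar> * (1 / s\<^sup>2) \<le> 2 * (A / (1 + x\<^sup>2)) * (5 / (1 + s\<^sup>2))"
        by (rule mult_mono[OF _ i2]) simp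
      have "\<bar>\<phi> (x + s)\<bar> + \<bar>\<phi> (x - s)\<bar> \<le> A / (1 + (x + s)\<^sup>2) + A / (1 + (x - s)\<^sup>2)"
        by (rule add_mono[OF b0 b0])
      moreover have "0 \<le> A / (1 + (x + s)\<^sup>2) + A / (1 + (x - s)\<^sup>2)" by (rule add_nonneg_nonneg[OF n n])
      ultimately show "(\<bar>\<phi> (x + s)\<bar> + \<bar>\<phi> (x - s)\<bar>) * (1 / s\<^sup>2) \<le> (A / (1 + (x + s)\<^sup>2) + A / (1 + (x - s)\<^sup>2)) * (4 / (1 + x\<^sup>2))"
        by (rule mult_mono[OF _ i1]) simp
    qed
    also have "\<dots> = second_diff_bound A x s"
    proof -
      have "indicat_real {- ((1 + \<bar>x\<bar>) / 2)..(1 + \<bar>x\<bar>) / 2} s = 0"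
        unfolding \<rho>_def[symmetric] using False by (simp add: indicator_def) linarith
      then show ?thesis unfolding second_diff_bound_def divide_inverse by algebra
    qed
    finally show ?thesis .
  qed
qed

lemma second_diff_bound_integral:
  assumes A: "A \<ge> 0"
  shows second_diff_bound_integrable: "integrable lborel (second_diff_bound A x)"
    and second_diff_bound_integral_le: "(LINT s|lborel. second_diff_bound A x s) \<le> 320 * A / (1 + x\<^sup>2)"
proof -
  let ?p = "\<lambda>s::real. 1 / (1 + s\<^sup>2)"
  have p: "integrable lborel ?p" "(LINT s|lborel. ?p s) = pi"
    using integrable_inverse_square_plus[of 1] LINT_inverse_square_plus[of 1] by auto
  have p1: "integrable lborel (\<lambda>s. ?p (x + s))" "(LINT s|lborel. ?p (x + s)) = pi"
    using lborel_integrable_real_affine[OF p(1), of 1 x] lborel_integral_real_affine[of 1 ?p x] p(2) by auto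
  have p2: "integrable lborel (\<lambda>s. ?p (x - s))" "(LINT s|lborel. ?p (x - s)) = pi"
    using lborel_integrable_real_affine[OF p(1), of "-1" x] lborel_integral_real_affine[of "-1" ?p x] p(2) by auto
  \<comment> \<open>\<open>320 = 256 + 64\<close>: the near part has length
    \<open>1 + |x| \<le> 2 * (1 + x^2)\<close>, which turns 128 into 256, and the two far parts add
    up to \<open>18 * pi < 64\<close>.\<close>
  have bound: "128 * A / (1 + x\<^sup>2)\<^sup>2 * (1 + \<bar>x\<bar>) + 4 * A / (1 + x\<^sup>2) * (pi + pi) + 10 * A / (1 + x\<^sup>2) * pi
      \<le> 320 * A / (1 + x\<^sup>2)"
  proof -
    have P: "1 + x\<^sup>2 > 0" by (simp add: add_pos_nonneg)
    have "0 \<le> (\<bar>x\<bar> - 1)\<^sup>2" by simp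
    then have "2 * \<bar>x\<bar> \<le> x\<^sup>2 + 1" by (simp add: power2_diff)
    then have "1 + \<bar>x\<bar> \<le> 2 * (1 + x\<^sup>2)" using zero_le_power2[of x] by argo
    then have "128 * A / (1 + x\<^sup>2)\<^sup>2 * (1 + \<bar>x\<bar>) \<le> 128 * A / (1 + x\<^sup>2)\<^sup>2 * (2 * (1 + x\<^sup>2))"
      using A by (intro mult_left_mono) auto
    also have "\<dots> = 256 * (A / (1 + x\<^sup>2))" using P by (simp add: power2_eq_square[of "1 + x\<^sup>2"] del: distrib_left_numeral)
    finally have 1: "128 * A / (1 + x\<^sup>2)\<^sup>2 * (1 + \<bar>x\<bar>) \<le> 256 * (A / (1 + x\<^sup>2))" .
    have q: "A / (1 + x\<^sup>2) \<ge> 0" using A P by simp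
    have "A / (1 + x\<^sup>2) * pi \<le> A / (1 + x\<^sup>2) * (32/10)"
      using q pi_approx by (intro mult_left_mono) auto
    then have "18 * (A / (1 + x\<^sup>2) * pi) \<le> 64 * (A / (1 + x\<^sup>2))"
      using q by argo
    moreover have "4 * A / (1 + x\<^sup>2) * (pi + pi) + 10 * A / (1 + x\<^sup>2) * pi = 18 * (A / (1 + x\<^sup>2) * pi)"
      "320 * A / (1 + x\<^sup>2) = 320 * (A / (1 + x\<^sup>2))"
      by (simp_all add: divide_inverse algebra_simps)
    ultimately show ?thesis using 1 by argo
  qed
  have "has_bochner_integral lborel (second_diff_bound A x)
    (128 * A / (1 + x\<^sup>2)\<^sup>2 * (1 + \<bar>x\<bar>) + 4 * A / (1 + x\<^sup>2) * (pi + pi) + 10 * A / (1 + x\<^sup>2) * pi)"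
    unfolding second_diff_bound_def
  proof (intro has_bochner_integral_add has_bochner_integral_mult_right)
    show "has_bochner_integral lborel (indicat_real {- ((1 + \<bar>x\<bar>) / 2)..(1 + \<bar>x\<bar>) / 2}) (1 + \<bar>x\<bar>)"
    proof -
      have "(1 + \<bar>x\<bar>) / 2 - - ((1 + \<bar>x\<bar>) / 2) = 1 + \<bar>x\<bar>" "- ((1 + \<bar>x\<bar>) / 2) \<le> (1 + \<bar>x\<bar>) / 2"
        by argo+
      then show ?thesis
        using has_bochner_integral_real_indicator[of "{- ((1 + \<bar>x\<bar>) / 2)..(1 + \<bar>x\<bar>) / 2}" lborel]
        by (simp only: emeasure_lborel_Icc measure_lborel_Icc ennreal_less_top sets_lborel) simp
    qed
  qed (use p p1 p2 in \<open>simp_all add: has_bochner_integral_iff\<close>)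
  then show "integrable lborel (second_diff_bound A x)"
    and "(LINT s|lborel. second_diff_bound A x s) \<le> 320 * A / (1 + x\<^sup>2)"
    unfolding has_bochner_integral_iff using bound by auto
qed
text \<open>The usual singular integral has the constant \<open>1 / pi\<close> and the increments
  \<open>\<phi> x - \<phi> (x + s)\<close>; symmetrisation in \<open>s\<close> turns the constant
  into \<open>1 / (2 * pi)\<close>.\<close>

definition frac_lap :: "(real \<Rightarrow> real) \<Rightarrow> real \<Rightarrow> real"
  where "frac_lap \<phi> x = (LINT s|lborel. second_diff \<phi> x s / s\<^sup>2) / (2 * pi)"

lemma decay_C2_continuous: "decay_C2 A \<phi> \<Longrightarrow> continuous_on UNIV \<phi>"
  unfolding decay_C2_def by (auto intro!: continuous_at_imp_continuous_on dest: DERIV_isCont)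

lemma borel_measurable_second_diff [measurable]:
  assumes [measurable]: "\<phi> \<in> borel_measurable borel"
  shows "second_diff \<phi> x \<in> borel_measurable borel"
  unfolding second_diff_def by measurable

lemma frac_lap_decay:
  assumes "decay_C2 A \<phi>"
  shows integrable_second_diff: "integrable lborel (\<lambda>s. second_diff \<phi> x s / s\<^sup>2)"
    and frac_lap_bound: "\<bar>frac_lap \<phi> x\<bar> \<le> 320 * A / (1 + x\<^sup>2)"
proof -
  have [measurable]: "\<phi> \<in> borel_measurable borel"
    by (rule borel_measurable_continuous_onI[OF decay_C2_continuous[OF assms]])
  have A: "A \<ge> 0" using assms unfolding decay_C2_def by (metis abs_ge_zero add.right_neutral div_by_1 order_trans zero_power2)
  have le: "norm (second_diff \<phi> x s / s\<^sup>2) \<le> second_diff_bound A x s" for s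
    using second_diff_decay[OF assms, of x s] by simp
  show int: "integrable lborel (\<lambda>s. second_diff \<phi> x s / s\<^sup>2)"
  proof (rule Bochner_Integration.integrable_bound[OF second_diff_bound_integrable[OF A, of x]])
    show "AE s in lborel. norm (second_diff \<phi> x s / s\<^sup>2) \<le> norm (second_diff_bound A x s)"
      using order_trans[OF le abs_ge_self] by (intro AE_I2) (simp only: real_norm_def)
  qed measurable
  have "\<bar>LINT s|lborel. second_diff \<phi> x s / s\<^sup>2\<bar> \<le> (LINT s|lborel. second_diff_bound A x s)"
    using Bochner_Integration.integral_norm_bound_integral[OF int second_diff_bound_integrable[OF A], of x] le
    unfolding real_norm_def by blast
  also have "\<dots> \<le> 320 * A / (1 + x\<^sup>2)" by (rule second_diff_bound_integral_le[OF A])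
  finally have "\<bar>LINT s|lborel. second_diff \<phi> x s / s\<^sup>2\<bar> \<le> 320 * A / (1 + x\<^sup>2)" by simp
  moreover have "\<bar>frac_lap \<phi> x\<bar> \<le> \<bar>LINT s|lborel. second_diff \<phi> x s / s\<^sup>2\<bar> / 1"
    unfolding frac_lap_def abs_divide using pi_gt3 by (intro divide_left_mono) auto
  ultimately show "\<bar>frac_lap \<phi> x\<bar> \<le> 320 * A / (1 + x\<^sup>2)" by simp
qed

section \<open>Test functions and the decay of their Fourier transforms\<close>

lemma test_function_DERIV:
  assumes "test_function \<phi>"
  shows "(\<phi> has_real_derivative deriv \<phi> x) (at x)"
proof -
  have "(deriv ^^ 0) \<phi> differentiable (at x)" using assms unfolding test_function_def by blast
  then show ?thesis by (simp add: DERIV_deriv_iff_real_differentiable)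
qed

lemma test_function_deriv:
  assumes "test_function \<phi>"
  shows "test_function (deriv \<phi>)"
proof -
  let ?S = "closure {x. \<phi> x \<noteq> 0}"
  have "(deriv ^^ n) (deriv \<phi>) differentiable (at x)" for n x
  proof -
    have "(deriv ^^ n) (deriv \<phi>) = (deriv ^^ Suc n) \<phi>" by (simp add: funpow_swap1)
    then show ?thesis using assms unfolding test_function_def by metis
  qed
  moreover have "compact (closure {x. deriv \<phi> x \<noteq> 0})"
  proof -
    have "deriv \<phi> x = 0" if "x \<notin> ?S" for x
    proof (rule DERIV_imp_deriv)
      show "(\<phi> has_field_derivative 0) (at x)"
      proof (rule has_field_derivative_transform_within_open)
        show "((\<lambda>_. 0) has_field_derivative 0) (at x)" by simp
        show "open (- ?S)" by (rule open_Compl) simp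
        show "x \<in> - ?S" using that by simp
        show "0 = \<phi> y" if "y \<in> - ?S" for y
          using that closure_subset[of "{x. \<phi> x \<noteq> 0}"] by auto
      qed
    qed
    then have "{x. deriv \<phi> x \<noteq> 0} \<subseteq> ?S" by auto
    then have "closure {x. deriv \<phi> x \<noteq> 0} \<subseteq> ?S" by (rule closure_minimal) simp
    moreover have "compact ?S" using assms unfolding test_function_def by blast
    ultimately show ?thesis by (metis closed_closure compact_Int_closed inf.absorb2)
  qed
  ultimately show ?thesis unfolding test_function_def by blast
qed

lemma test_function_support:
  assumes "test_function \<phi>"
  obtains R where "R > 0" "\<And>x. \<bar>x\<bar> \<ge> R \<Longrightarrow> \<phi> x = 0"
proof -
  have "bounded (closure {x. \<phi> x \<noteq> 0})"
    using assms compact_imp_bounded unfolding test_function_def by blast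
  then obtain R where R: "R > 0" "\<And>x. x \<in> closure {x. \<phi> x \<noteq> 0} \<Longrightarrow> norm x < R"
    unfolding bounded_pos_less by blast
  have "\<phi> x = 0" if "\<bar>x\<bar> \<ge> R" for x
  proof (rule ccontr)
    assume "\<phi> x \<noteq> 0"
    then have "x \<in> closure {x. \<phi> x \<noteq> 0}" using closure_subset[of "{x. \<phi> x \<noteq> 0}"] by blast
    then show False using R(2)[of x] that by simp
  qed
  then show thesis using that R(1) by blast
qed

lemma test_function_continuous: "test_function \<phi> \<Longrightarrow> continuous_on UNIV \<phi>"
  using test_function_DERIV by (auto intro!: continuous_at_imp_continuous_on dest: DERIV_isCont)

lemma test_function_measurable: "test_function \<phi> \<Longrightarrow> \<phi> \<in> borel_measurable borel"
  by (intro borel_measurable_continuous_onI test_function_continuous)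

lemma one_plus_square_pos: "(0::real) < 1 + x\<^sup>2"
  by (simp add: add_pos_nonneg)

lemma test_function_bound:
  assumes "test_function \<phi>"
  obtains A where "A \<ge> 0" "\<And>x. \<bar>\<phi> x\<bar> \<le> A / (1 + x\<^sup>2)\<^sup>2"
proof -
  obtain R where R: "\<And>x. \<bar>x\<bar> \<ge> R \<Longrightarrow> \<phi> x = 0" using test_function_support[OF assms] by blast
  have "continuous_on UNIV (\<lambda>x. \<phi> x * (1 + x\<^sup>2)\<^sup>2)"
    by (intro continuous_intros test_function_continuous[OF assms])
  then have "compact ((\<lambda>x. \<phi> x * (1 + x\<^sup>2)\<^sup>2) ` {- R..R})"
    by (rule compact_continuous_image[OF continuous_on_subset[OF _ subset_UNIV] compact_Icc])
  from this[THEN compact_imp_bounded, unfolded bounded_iff]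
  obtain A where A: "\<forall>y \<in> (\<lambda>x. \<phi> x * (1 + x\<^sup>2)\<^sup>2) ` {- R..R}. norm y \<le> A"
    by (elim exE) (rule that)
  have "\<bar>\<phi> x\<bar> \<le> \<bar>A\<bar> / (1 + x\<^sup>2)\<^sup>2" for x
  proof (cases "\<bar>x\<bar> \<le> R")
    case True
    then have "x \<in> {- R..R}" by auto
    then have "norm (\<phi> x * (1 + x\<^sup>2)\<^sup>2) \<le> A" using A by blast
    then have "\<bar>\<phi> x * (1 + x\<^sup>2)\<^sup>2\<bar> \<le> \<bar>A\<bar>" by simp
    then have "\<bar>\<phi> x\<bar> * (1 + x\<^sup>2)\<^sup>2 \<le> \<bar>A\<bar>" by (simp add: abs_mult)
    then show ?thesis using one_plus_square_pos[of x] by (simp only: pos_le_divide_eq zero_less_power)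
  qed (use R in simp)
  then show thesis using that[of "\<bar>A\<bar>"] by simp
qed

lemma test_function_decay:
  assumes "test_function \<phi>"
  obtains A where "decay_C2 A \<phi>"
proof -
  obtain A where A: "A \<ge> 0" "\<And>x. \<bar>\<phi> x\<bar> \<le> A / (1 + x\<^sup>2)\<^sup>2" using test_function_bound[OF assms] by blast
  obtain B where B: "B \<ge> 0" "\<And>x. \<bar>deriv (deriv \<phi>) x\<bar> \<le> B / (1 + x\<^sup>2)\<^sup>2"
    using test_function_bound[OF test_function_deriv[OF test_function_deriv[OF assms]]] by blast
  have "\<bar>\<phi> x\<bar> \<le> (A + B) / (1 + x\<^sup>2)" for x
  proof -
    have "A / (1 + x\<^sup>2)\<^sup>2 \<le> A / (1 + x\<^sup>2)"
    proof (rule divide_left_mono[OF _ A(1)])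
      have "(1 + x\<^sup>2) * 1 \<le> (1 + x\<^sup>2) * (1 + x\<^sup>2)" by (intro mult_left_mono) (simp_all add: less_imp_le[OF one_plus_square_pos])
      then show "1 + x\<^sup>2 \<le> (1 + x\<^sup>2)\<^sup>2" by (simp add: power2_eq_square)
    qed (use one_plus_square_pos[of x] in \<open>simp add: less_imp_neq\<close>)
    also have "\<dots> \<le> (A + B) / (1 + x\<^sup>2)"
      using B(1) one_plus_square_pos[of x] by (intro divide_right_mono) simp_all
    finally show ?thesis using A(2)[of x] by linarith
  qed
  moreover have "\<bar>deriv (deriv \<phi>) x\<bar> \<le> (A + B) / (1 + x\<^sup>2)\<^sup>2" for x
  proof -
    have "B / (1 + x\<^sup>2)\<^sup>2 \<le> (A + B) / (1 + x\<^sup>2)\<^sup>2"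
      using A(1) by (intro divide_right_mono) simp_all
    then show ?thesis using B(2)[of x] by linarith
  qed
  ultimately have "decay_C2 (A + B) \<phi>"
    unfolding decay_C2_def
    using test_function_DERIV[OF assms] test_function_DERIV[OF test_function_deriv[OF assms]] by blast
  then show thesis by (rule that)
qed

lemma test_function_integrable:
  assumes "test_function \<phi>"
  shows "integrable lborel \<phi>"
proof -
  obtain A where "decay_C2 A \<phi>" using test_function_decay[OF assms] .
  then have "norm (\<phi> x) \<le> A / (1 + x\<^sup>2)" for x unfolding decay_C2_def real_norm_def by blast
  then show ?thesis by (rule integrable_decay[OF test_function_measurable[OF assms]])
qed

lemma integral_deriv_compact_support:
  fixes G :: "real \<Rightarrow> 'a::euclidean_space"
  assumes G: "\<And>x. (G has_vector_derivative g x) (at x)" and g: "continuous_on UNIV g"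
    and 0: "\<And>x. \<bar>x\<bar> \<ge> R \<Longrightarrow> G x = 0" "\<And>x. \<bar>x\<bar> \<ge> R \<Longrightarrow> g x = 0" and R: "R > 0"
  shows "(LINT x|lborel. g x) = 0"
proof -
  have "(LINT x|lborel. g x) = (LINT x|lborel. indicator {- R..R} x *\<^sub>R g x)"
  proof (rule Bochner_Integration.integral_cong[OF refl])
    fix x show "g x = indicator {- R..R} x *\<^sub>R g x"
    proof (cases "\<bar>x\<bar> \<ge> R")
      case False
      then have "x \<in> {- R..R}" by auto
      then show ?thesis by simp
    qed (use 0(2) in simp)
  qed
  also have "\<dots> = G R - G (- R)"
    using R by (intro integral_FTC_atLeastAtMost continuous_on_subset[OF g] has_vector_derivative_at_within[OF G]) simp_all
  also have "\<dots> = 0" using 0(1)[of R] 0(1)[of "- R"] by simp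
  finally show ?thesis .
qed

lemma fourier_eq_lborel:
  assumes [measurable]: "f \<in> borel_measurable borel"
  shows "fourier f \<xi> = (LINT x|lborel. exp (- \<i> * of_real (x * \<xi>)) * f x)"
  unfolding fourier_def by (rule integral_completion) measurable

lemma fourier_deriv:
  assumes "test_function \<phi>"
  shows "fourier (\<lambda>y. of_real (deriv \<phi> y)) \<xi> = \<i> * of_real \<xi> * fourier (\<lambda>y. of_real (\<phi> y)) \<xi>"
proof -
  note d = test_function_deriv[OF assms]
  note [measurable] = test_function_measurable[OF assms] test_function_measurable[OF d]
  obtain R where R: "R > 0" "\<And>x. \<bar>x\<bar> \<ge> R \<Longrightarrow> \<phi> x = 0" using test_function_support[OF assms] by blast
  obtain R' where R': "R' > 0" "\<And>x. \<bar>x\<bar> \<ge> R' \<Longrightarrow> deriv \<phi> x = 0" using test_function_support[OF d] by blast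
  let ?e = "\<lambda>x. exp (- \<i> * of_real (x * \<xi>)) :: complex"
  have int: "integrable lborel (\<lambda>x. ?e x * of_real (\<psi> x))" if "test_function \<psi>" for \<psi>
    by (rule Bochner_Integration.integrable_bound[OF test_function_integrable[OF that]])
      (use test_function_measurable[OF that] in \<open>simp_all add: norm_mult norm_exp_eq_Re\<close>)
  have "(LINT x|lborel. (- \<i> * of_real \<xi>) * (?e x * of_real (\<phi> x)) + ?e x * of_real (deriv \<phi> x)) = 0"
  proof (rule integral_deriv_compact_support[where G = "\<lambda>x. ?e x * of_real (\<phi> x)" and R = "max R R'"])
    fix x
    have 1: "(?e has_vector_derivative (- \<i> * of_real \<xi>) * ?e x) (at x)"
      by (auto intro!: derivative_eq_intros has_vector_derivative_real_field simp: mult.commute)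
    have 2: "((\<lambda>x. of_real (\<phi> x) :: complex) has_vector_derivative of_real (deriv \<phi> x)) (at x)"
      by (rule has_vector_derivative_of_real) (use test_function_DERIV[OF assms] in \<open>simp add: has_real_derivative_iff_has_vector_derivative\<close>)
    show "((\<lambda>x. ?e x * of_real (\<phi> x)) has_vector_derivative
        (- \<i> * of_real \<xi>) * (?e x * of_real (\<phi> x)) + ?e x * of_real (deriv \<phi> x)) (at x)"
      using has_vector_derivative_mult[OF 1 2] by (simp add: algebra_simps)
  next
    show "continuous_on UNIV (\<lambda>x. (- \<i> * of_real \<xi>) * (?e x * of_real (\<phi> x)) + ?e x * of_real (deriv \<phi> x))"
      by (intro continuous_intros test_function_continuous[OF assms] test_function_continuous[OF d])
  qed (use R R' in auto)
  then have "(- \<i> * of_real \<xi>) * (LINT x|lborel. ?e x * of_real (\<phi> x)) + (LINT x|lborel. ?e x * of_real (deriv \<phi> x)) = 0"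
    using int[OF assms] int[OF d] by (subst (asm) Bochner_Integration.integral_add) simp_all
  then show ?thesis by (simp add: fourier_eq_lborel add_eq_0_iff)
qed

lemma norm_fourier_le:
  assumes "test_function \<phi>"
  shows "norm (fourier (\<lambda>y. of_real (\<phi> y)) \<xi>) \<le> (LINT x|lborel. \<bar>\<phi> x\<bar>)"
proof -
  note [measurable] = test_function_measurable[OF assms]
  have m: "(\<lambda>y. complex_of_real (\<phi> y)) \<in> borel_measurable borel" by measurable
  have "norm (fourier (\<lambda>y. of_real (\<phi> y)) \<xi>) \<le> (LINT x|lborel. norm (exp (- \<i> * of_real (x * \<xi>)) * complex_of_real (\<phi> x)))"
    unfolding fourier_eq_lborel[OF m] by (rule integral_norm_bound)
  then show ?thesis by (simp add: norm_mult norm_exp_eq_Re)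
qed

text \<open>Up to a factor of modulus one, the weighted transform is the transform of
  \<open>deriv \<phi>\<close>, and \<open>\<xi>^2\<close> times it is that of the third derivative.
  Each transform is bounded by an L1 norm, and adding the two bounds gives the denominator
  \<open>1 + \<xi>^2\<close>.\<close>

lemma fourier_decay:
  assumes "test_function \<phi>"
  obtains C where "\<And>\<xi>. norm (of_real \<bar>\<xi>\<bar> * fourier (\<lambda>y. of_real (\<phi> y)) \<xi>) \<le> C / (1 + \<xi>\<^sup>2)"
proof -
  note d1 = test_function_deriv[OF assms] and d2 = test_function_deriv[OF test_function_deriv[OF assms]]
  note d3 = test_function_deriv[OF d2]
  let ?F = "\<lambda>\<xi>. fourier (\<lambda>y. of_real (\<phi> y)) \<xi>"
  define C where "C = (LINT x|lborel. \<bar>deriv \<phi> x\<bar>) + (LINT x|lborel. \<bar>deriv (deriv (deriv \<phi>)) x\<bar>)"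
  have "norm (of_real \<bar>\<xi>\<bar> * ?F \<xi>) \<le> C / (1 + \<xi>\<^sup>2)" for \<xi>
  proof -
    have "norm (fourier (\<lambda>y. of_real (deriv \<phi> y)) \<xi>) = norm (of_real \<bar>\<xi>\<bar> * ?F \<xi>)"
      by (simp add: fourier_deriv[OF assms] norm_mult)
    moreover have "norm (fourier (\<lambda>y. of_real (deriv (deriv (deriv \<phi>)) y)) \<xi>) = norm (of_real \<bar>\<xi>\<bar> * ?F \<xi>) * \<xi>\<^sup>2"
      by (simp add: fourier_deriv[OF assms] fourier_deriv[OF d1] fourier_deriv[OF d2] norm_mult power2_eq_square)
    ultimately have "norm (of_real \<bar>\<xi>\<bar> * ?F \<xi>) * (1 + \<xi>\<^sup>2) \<le> C"
      using norm_fourier_le[OF d1, of \<xi>] norm_fourier_le[OF d3, of \<xi>] unfolding C_def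
      by (simp only: distrib_left mult_1_right)
    then show ?thesis by (simp only: pos_le_divide_eq one_plus_square_pos)
  qed
  then show thesis by (rule that)
qed

text \<open>The form in which Fubini's hypothesis gets checked: a product majorant reduces a double
  integral to one-dimensional integrability.\<close>

lemma integrable_pair_bound:
  fixes f :: "real \<times> real \<Rightarrow> 'a::{banach, second_countable_topology}"
  assumes [measurable]: "f \<in> borel_measurable (lborel \<Otimes>\<^sub>M lborel)"
    and a: "integrable lborel a" and b: "integrable lborel b"
    and le: "\<And>x y. norm (f (x, y)) \<le> a x * (b y :: real)"
  shows "integrable (lborel \<Otimes>\<^sub>M lborel) f"
proof (rule Bochner_Integration.integrable_bound)
  have [measurable]: "a \<in> borel_measurable borel" "b \<in> borel_measurable borel" using a b by auto
  show "integrable (lborel \<Otimes>\<^sub>M lborel) (\<lambda>(x, y). a x * b y)"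
  proof (rule lborel_pair.Fubini_integrable)
    show "integrable lborel (\<lambda>x. LINT y|lborel. norm (case (x, y) of (x, y) \<Rightarrow> a x * b y))"
      using a by (simp add: abs_mult)
  qed (use b in simp_all)
  have "norm (f p) \<le> norm (case p of (x, y) \<Rightarrow> a x * b y)" for p
    using le[of "fst p" "snd p"] abs_ge_self[of "a (fst p) * b (snd p)"] by (simp add: case_prod_beta)
  then show "AE p in lborel \<Otimes>\<^sub>M lborel. norm (f p) \<le> norm (case p of (x, y) \<Rightarrow> a x * b y)" by (rule AE_I2)
qed simp

text \<open>The Abel means of the Fourier integral of \<open>|\<xi>|\<close>; the two half-lines contribute
  \<open>1/z\<^sup>2\<close> with \<open>z = e - is\<close> and its conjugate.\<close>

lemma fourier_abs_exp:
  fixes e s :: real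
  assumes e: "e > 0"
  shows "(LINT \<xi>|lborel. exp (\<i> * of_real (s * \<xi>)) * of_real (\<bar>\<xi>\<bar> * exp (- e * \<bar>\<xi>\<bar>))) =
    complex_of_real (2 * (e\<^sup>2 - s\<^sup>2) / (e\<^sup>2 + s\<^sup>2)\<^sup>2)"
proof -
  define f where "f \<xi> = exp (\<i> * of_real (s * \<xi>)) * complex_of_real (\<bar>\<xi>\<bar> * exp (- e * \<bar>\<xi>\<bar>))" for \<xi> :: real
  have [measurable]: "f \<in> borel_measurable borel" unfolding f_def by measurable
  have nf: "norm (f \<xi>) = \<bar>\<xi>\<bar> * exp (- e * \<bar>\<xi>\<bar>)" for \<xi>
    by (simp add: f_def norm_mult norm_exp_eq_Re del: of_real_mult)
  have int: "integrable lborel f"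
    by (rule integrable_decay[where A = "1 / e + 6 / e ^ 3"]) (use exp_decay_bound[OF e] nf in simp_all)
  have int': "integrable lborel (\<lambda>\<xi>. f \<xi> + f (- \<xi>))"
    using int lborel_integrable_real_affine[OF int, of "-1" 0] by simp
  define z z' where "z = complex_of_real e - \<i> * of_real s" and "z' = complex_of_real e + \<i> * of_real s"
  have zz: "z * z' = of_real (e\<^sup>2 + s\<^sup>2)" by (simp add: z_def z'_def algebra_simps power2_eq_square)
  have "e\<^sup>2 + s\<^sup>2 > 0" using e by (simp add: add_pos_nonneg)
  then have "z * z' \<noteq> 0" unfolding zz by (simp only: of_real_eq_0_iff)
  then have z0: "z \<noteq> 0" "z' \<noteq> 0" by auto
  \<comment> \<open>Primitive of \<open>\<xi> * exp (- c * \<xi>)\<close>, with value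
    \<open>- 1 / c^2\<close> at 0 and limit 0 at infinity when \<open>Re c = e > 0\<close>.\<close>
  define F where "F c \<xi> = - (of_real \<xi> / c + 1 / c\<^sup>2) * exp (- c * of_real \<xi>)" for c :: complex and \<xi> :: real
  have dF: "(F c has_vector_derivative of_real \<xi> * exp (- c * of_real \<xi>)) (at \<xi>)" if "c \<noteq> 0" for c \<xi>
  proof -
    have "((\<lambda>w. - (w / c + 1 / c\<^sup>2) * exp (- c * w)) has_field_derivative w * exp (- c * w)) (at w)" for w
      using that by (auto intro!: derivative_eq_intros simp: field_simps power2_eq_square)
    then show ?thesis
      unfolding F_def by (rule has_vector_derivative_real_field)
  qed
  have limF: "(F c \<longlongrightarrow> 0) at_top" if "c \<noteq> 0" "Re c = e" for c
  proof (rule Lim_null_comparison)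
    have a: "norm c > 0" using that by simp
    show "((\<lambda>\<xi>. (\<xi> / norm c + 1 / (norm c)\<^sup>2) * exp (- e * \<xi>)) \<longlongrightarrow> 0) at_top"
      using e a by real_asymp
    show "\<forall>\<^sub>F \<xi> in at_top. norm (F c \<xi>) \<le> (\<xi> / norm c + 1 / (norm c)\<^sup>2) * exp (- e * \<xi>)"
      using eventually_ge_at_top[of 0]
    proof eventually_elim
      case (elim \<xi>)
      have "norm (of_real \<xi> / c + 1 / c\<^sup>2) \<le> norm (of_real \<xi> / c) + norm (1 / c\<^sup>2)" by (rule norm_triangle_ineq)
      also have "\<dots> = \<xi> / norm c + 1 / (norm c)\<^sup>2" using elim by (simp add: norm_divide norm_power)
      finally have "norm (of_real \<xi> / c + 1 / c\<^sup>2) * exp (- e * \<xi>) \<le> (\<xi> / norm c + 1 / (norm c)\<^sup>2) * exp (- e * \<xi>)"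
        by (rule mult_right_mono) simp
      moreover have "norm (F c \<xi>) = norm (of_real \<xi> / c + 1 / c\<^sup>2) * exp (- e * \<xi>)"
        unfolding F_def using that(2) by (simp only: norm_mult norm_minus_cancel norm_exp_eq_Re) simp
      ultimately show ?case by simp
    qed
  qed
  define g where "g \<xi> = of_real \<xi> * exp (- z * of_real \<xi>) + of_real \<xi> * exp (- z' * of_real \<xi>)" for \<xi> :: real
  have fg: "f \<xi> + f (- \<xi>) = g \<xi>" if "\<xi> \<ge> 0" for \<xi>
  proof -
    have "f \<xi> = of_real \<xi> * exp (- z * of_real \<xi>)"
      using that unfolding f_def z_def by (simp add: exp_of_real[symmetric] exp_add[symmetric] algebra_simps)
    moreover have "f (- \<xi>) = of_real \<xi> * exp (- z' * of_real \<xi>)"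
      using that unfolding f_def z'_def by (simp add: exp_of_real[symmetric] exp_add[symmetric] algebra_simps)
    ultimately show ?thesis by (simp add: g_def)
  qed
  have fgi: "indicator {0..} \<xi> *\<^sub>R (f \<xi> + f (- \<xi>)) = indicator {0..} \<xi> *\<^sub>R g \<xi>" for \<xi>
    using fg[of \<xi>] by (cases "\<xi> \<ge> 0") simp_all
  have "(LINT \<xi>|lborel. f \<xi>) = (LINT \<xi>|lborel. indicator {0..} \<xi> *\<^sub>R g \<xi>)"
    unfolding integral_split_at_zero[OF int] fgi ..
  also have "\<dots> = (0 + 0) - (F z 0 + F z' 0)"
  proof (rule integral_FTC_atLeast)
    show "integrable lborel (\<lambda>\<xi>. indicator {0..} \<xi> *\<^sub>R g \<xi>)"
      unfolding fgi[symmetric] by (intro integrable_mult_indicator int') simp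
    show "((\<lambda>\<xi>. F z \<xi> + F z' \<xi>) has_vector_derivative g \<xi>) (at \<xi>)" for \<xi>
      unfolding g_def by (intro has_vector_derivative_add dF z0)
    show "continuous_on {0..} g" unfolding g_def by (intro continuous_intros)
    show "((\<lambda>\<xi>. F z \<xi> + F z' \<xi>) \<longlongrightarrow> 0 + 0) at_top"
      by (intro tendsto_add limF z0) (simp_all add: z_def z'_def)
  qed
  also have "\<dots> = 1 / z\<^sup>2 + 1 / z'\<^sup>2" by (simp add: F_def)
  also have "\<dots> = (z\<^sup>2 + z'\<^sup>2) / (z * z')\<^sup>2" using z0 by (simp add: field_simps)
  also have "z\<^sup>2 + z'\<^sup>2 = of_real (2 * (e\<^sup>2 - s\<^sup>2))"
    by (simp add: z_def z'_def power2_eq_square algebra_simps)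
  also have "of_real (2 * (e\<^sup>2 - s\<^sup>2)) / (z * z')\<^sup>2 = complex_of_real (2 * (e\<^sup>2 - s\<^sup>2) / (e\<^sup>2 + s\<^sup>2)\<^sup>2)"
    unfolding zz by simp
  finally show ?thesis unfolding f_def .
qed

text \<open>Minus one half of the Abel mean computed in \<open>fourier_abs_exp\<close>. As
  \<open>e\<close> tends to 0 it tends to \<open>1 / s^2\<close> away from 0, while a negative spike
  of width \<open>e\<close> keeps the total mass at zero.\<close>

definition abel_kernel :: "real \<Rightarrow> real \<Rightarrow> real"
  where "abel_kernel e s = (s\<^sup>2 - e\<^sup>2) / (e\<^sup>2 + s\<^sup>2)\<^sup>2"

lemma abel_kernel_measurable [measurable]: "abel_kernel e \<in> borel_measurable borel"
  unfolding abel_kernel_def by measurable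

lemma abel_kernel_minus: "abel_kernel e (- s) = abel_kernel e s"
  by (simp add: abel_kernel_def)

lemma abel_kernel_abs_le:
  assumes "e \<noteq> 0"
  shows "\<bar>abel_kernel e s\<bar> \<le> 1 / (e\<^sup>2 + s\<^sup>2)"
proof -
  have p: "e\<^sup>2 + s\<^sup>2 > 0" using assms by (simp add: add_pos_nonneg)
  have "\<bar>s\<^sup>2 - e\<^sup>2\<bar> \<le> e\<^sup>2 + s\<^sup>2" by (simp add: abs_le_iff)
  then have "\<bar>s\<^sup>2 - e\<^sup>2\<bar> / (e\<^sup>2 + s\<^sup>2)\<^sup>2 \<le> (e\<^sup>2 + s\<^sup>2) / (e\<^sup>2 + s\<^sup>2)\<^sup>2"
    by (rule divide_right_mono) simp
  also have "\<dots> = 1 / (e\<^sup>2 + s\<^sup>2)" using p by (simp add: power2_eq_square[of "e\<^sup>2 + s\<^sup>2"])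
  finally show ?thesis by (simp add: abel_kernel_def)
qed

text \<open>\<open>- s / (e^2 + s^2)\<close> is a primitive that vanishes at 0 and at infinity. The
  zero mass mirrors the vanishing of the symbol at frequency 0, and it allows the term
  \<open>2 * \<phi> x\<close> to be inserted for free in \<open>abel_mean_eq\<close>.\<close>

lemma abel_kernel_integral:
  assumes e: "e > 0"
  shows abel_kernel_integrable: "integrable lborel (abel_kernel e)"
    and abel_kernel_integral_zero: "(LINT s|lborel. abel_kernel e s) = 0"
proof -
  show i: "integrable lborel (abel_kernel e)"
    by (rule Bochner_Integration.integrable_bound[OF integrable_inverse_square_plus[OF e]])
      (use abel_kernel_abs_le[of e] e in simp_all)
  have p: "e\<^sup>2 + s\<^sup>2 \<noteq> 0" for s :: real using e by (metis add_pos_nonneg less_irrefl zero_le_power2 zero_less_power)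
  have "((\<lambda>s. - (2 * s) / (e\<^sup>2 + s\<^sup>2)) has_real_derivative 2 * abel_kernel e s) (at s)" for s
  proof -
    have "((\<lambda>s. - (2 * s) / (e\<^sup>2 + s\<^sup>2)) has_real_derivative
        (- 2 * (e\<^sup>2 + s\<^sup>2) - - (2 * s) * (2 * s)) / ((e\<^sup>2 + s\<^sup>2) * (e\<^sup>2 + s\<^sup>2))) (at s)"
      by (rule DERIV_divide) (use p in \<open>auto intro!: derivative_eq_intros\<close>)
    moreover have "- 2 * (e\<^sup>2 + s\<^sup>2) - - (2 * s) * (2 * s) = 2 * (s\<^sup>2 - e\<^sup>2)"
      by (simp add: power2_eq_square algebra_simps)
    ultimately show ?thesis unfolding abel_kernel_def power2_eq_square[of "e\<^sup>2 + s\<^sup>2"] by simp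
  qed
  then have D: "((\<lambda>s. - (2 * s) / (e\<^sup>2 + s\<^sup>2)) has_vector_derivative (abel_kernel e s + abel_kernel e (- s))) (at s)" for s
    by (simp add: has_real_derivative_iff_has_vector_derivative abel_kernel_def)
  have "(LINT s|lborel. abel_kernel e s) = 0 - (- (2 * 0) / (e\<^sup>2 + 0\<^sup>2))"
    unfolding integral_split_at_zero[OF i]
  proof (rule integral_FTC_atLeast[OF _ D])
    have "integrable lborel (\<lambda>s. abel_kernel e s + abel_kernel e (- s))"
      using Bochner_Integration.integrable_add[OF i i] unfolding abel_kernel_minus .
    then show "integrable lborel (\<lambda>s. indicator {0..} s *\<^sub>R (abel_kernel e s + abel_kernel e (- s)))"
      by (intro integrable_mult_indicator) simp_all
    show "continuous_on {0..} (\<lambda>s. abel_kernel e s + abel_kernel e (- s))"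
      unfolding abel_kernel_def by (intro continuous_intros) (use p in simp_all)
    show "((\<lambda>s. - (2 * s) / (e\<^sup>2 + s\<^sup>2)) \<longlongrightarrow> 0) at_top"
      using e by real_asymp
  qed
  then show "(LINT s|lborel. abel_kernel e s) = 0" by simp
qed

text \<open>Since the kernel is even, the convolution can be written with
  \<open>\<phi> (x + s)\<close> or with \<open>\<phi> (x - s)\<close>; using both, and adding the
  multiple \<open>2 * \<phi> x\<close> of the zero-mass kernel, produces the second
  difference.\<close>

lemma abel_mean_eq:
  assumes \<phi>: "decay_C2 A \<phi>" and int\<phi>: "integrable lborel \<phi>" and e: "e > 0"
  shows "(LINT y|lborel. - 2 * \<phi> y * abel_kernel e (x - y)) = (LINT s|lborel. second_diff \<phi> x s * abel_kernel e s)"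
proof -
  have [measurable]: "\<phi> \<in> borel_measurable borel" using int\<phi> by auto
  have bk: "\<bar>abel_kernel e s\<bar> \<le> 1 / e\<^sup>2" for s
  proof -
    have "1 / (e\<^sup>2 + s\<^sup>2) \<le> 1 / e\<^sup>2" using e by (intro divide_left_mono mult_pos_pos add_pos_nonneg) simp_all
    then show ?thesis using abel_kernel_abs_le[of e s] e by linarith
  qed
  have int: "integrable lborel (\<lambda>s. \<psi> s * abel_kernel e s)" if "integrable lborel \<psi>" for \<psi>
  proof (rule Bochner_Integration.integrable_bound)
    show "integrable lborel (\<lambda>s. 1 / e\<^sup>2 * \<bar>\<psi> s\<bar>)" using that by (intro integrable_mult_right integrable_abs)
    show "(\<lambda>s. \<psi> s * abel_kernel e s) \<in> borel_measurable lborel" using that by measurable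
    have "norm (\<psi> s * abel_kernel e s) \<le> norm (1 / e\<^sup>2 * \<bar>\<psi> s\<bar>)" for s
    proof -
      have "\<bar>\<psi> s\<bar> * \<bar>abel_kernel e s\<bar> \<le> \<bar>\<psi> s\<bar> * (1 / e\<^sup>2)" by (rule mult_left_mono[OF bk]) simp
      then show ?thesis by (simp add: abs_mult)
    qed
    then show "AE s in lborel. norm (\<psi> s * abel_kernel e s) \<le> norm (1 / e\<^sup>2 * \<bar>\<psi> s\<bar>)" by (rule AE_I2)
  qed
  have ip: "integrable lborel (\<lambda>s. \<phi> (x + s))" and im: "integrable lborel (\<lambda>s. \<phi> (x - s))"
    using lborel_integrable_real_affine[OF int\<phi>, of 1 x] lborel_integrable_real_affine[OF int\<phi>, of "-1" x] by simp_all
  have P: "(LINT s|lborel. \<phi> (x + s) * abel_kernel e s) = (LINT y|lborel. \<phi> y * abel_kernel e (x - y))"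
  proof -
    have "(LINT y|lborel. \<phi> y * abel_kernel e (y - x)) = (LINT s|lborel. \<phi> (x + s) * abel_kernel e s)"
      by (subst lborel_integral_real_affine[of 1 _ x]) simp_all
    moreover have "abel_kernel e (y - x) = abel_kernel e (x - y)" for y
      using abel_kernel_minus[of e "x - y"] by simp
    ultimately show ?thesis by simp
  qed
  have M: "(LINT s|lborel. \<phi> (x - s) * abel_kernel e s) = (LINT y|lborel. \<phi> y * abel_kernel e (x - y))"
    by (subst (2) lborel_integral_real_affine[of "-1" _ x]) simp_all
  have "(LINT s|lborel. second_diff \<phi> x s * abel_kernel e s) =
    (LINT s|lborel. 2 * \<phi> x * abel_kernel e s - \<phi> (x + s) * abel_kernel e s - \<phi> (x - s) * abel_kernel e s)"
    by (simp add: second_diff_def algebra_simps)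
  also have "\<dots> = 2 * \<phi> x * (LINT s|lborel. abel_kernel e s) - (LINT s|lborel. \<phi> (x + s) * abel_kernel e s) - (LINT s|lborel. \<phi> (x - s) * abel_kernel e s)"
    using int[OF ip] int[OF im] abel_kernel_integrable[OF e]
    by (subst Bochner_Integration.integral_diff, simp, simp)+ simp
  also have "\<dots> = - 2 * (LINT y|lborel. \<phi> y * abel_kernel e (x - y))"
    unfolding P M abel_kernel_integral_zero[OF e] by simp
  also have "\<dots> = (LINT y|lborel. - 2 * (\<phi> y * abel_kernel e (x - y)))" by (rule integral_mult_right_zero[symmetric])
  finally show ?thesis by (simp add: mult.assoc)
qed

text \<open>The majorant is the limit itself:
  \<open>|abel_kernel e s| \<le> 1 / (e^2 + s^2) \<le> 1 / s^2\<close>. For the bare values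
  \<open>\<phi> (x + s)\<close> this majorant is in general not integrable, which is why second
  differences are formed first.\<close>

lemma abel_mean_tendsto:
  assumes \<phi>: "decay_C2 A \<phi>" and e: "\<And>n::nat. e n > 0" "e \<longlonglongrightarrow> 0"
  shows "(\<lambda>n. LINT s|lborel. second_diff \<phi> x s * abel_kernel (e n) s) \<longlonglongrightarrow> (LINT s|lborel. second_diff \<phi> x s / s\<^sup>2)"
proof -
  have [measurable]: "\<phi> \<in> borel_measurable borel"
    by (rule borel_measurable_continuous_onI[OF decay_C2_continuous[OF \<phi>]])
  show ?thesis
  proof (rule integral_dominated_convergence[where w = "\<lambda>s. \<bar>second_diff \<phi> x s / s\<^sup>2\<bar>"])
  show "integrable lborel (\<lambda>s. \<bar>second_diff \<phi> x s / s\<^sup>2\<bar>)"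
    by (rule integrable_abs[OF integrable_second_diff[OF \<phi>]])
  show "AE s in lborel. (\<lambda>n. second_diff \<phi> x s * abel_kernel (e n) s) \<longlonglongrightarrow> second_diff \<phi> x s / s\<^sup>2"
    using AE_lborel_singleton[of "0::real"]
  proof eventually_elim
    case (elim s)
    then have s: "s \<noteq> 0" by simp
    have "(\<lambda>n. second_diff \<phi> x s * ((s\<^sup>2 - (e n)\<^sup>2) / ((e n)\<^sup>2 + s\<^sup>2)\<^sup>2)) \<longlonglongrightarrow>
        second_diff \<phi> x s * ((s\<^sup>2 - 0\<^sup>2) / (0\<^sup>2 + s\<^sup>2)\<^sup>2)"
      by (intro tendsto_intros e) (use s in simp)
    then show ?case unfolding abel_kernel_def using s by (simp add: power2_eq_square)
  qed
  show "AE s in lborel. norm (second_diff \<phi> x s * abel_kernel (e n) s) \<le> \<bar>second_diff \<phi> x s / s\<^sup>2\<bar>" for n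
    using AE_lborel_singleton[of "0::real"]
  proof eventually_elim
    case (elim s)
    then have s: "s\<^sup>2 > 0" by simp
    have "\<bar>abel_kernel (e n) s\<bar> \<le> 1 / ((e n)\<^sup>2 + s\<^sup>2)"
      using e(1)[of n] by (intro abel_kernel_abs_le) simp
    also have "\<dots> \<le> 1 / s\<^sup>2" using s by (intro divide_left_mono mult_pos_pos add_nonneg_pos) simp_all
    finally have "\<bar>second_diff \<phi> x s\<bar> * \<bar>abel_kernel (e n) s\<bar> \<le> \<bar>second_diff \<phi> x s\<bar> * (1 / s\<^sup>2)"
      by (rule mult_left_mono) simp
    then show ?case by (simp add: abs_mult)
  qed
  qed measurable
qed

text \<open>The multiplier integral is approximated by Abel means, in which the frequency integral
  can be carried out first; letting the damping go to 0 on both sides identifies it with the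
  singular integral.\<close>

lemma half_laplacian_eq_frac_lap:
  assumes tf: "test_function \<phi>"
  shows "half_laplacian \<phi> x = frac_lap \<phi> x"
proof -
  note [measurable] = test_function_measurable[OF tf]
  obtain A where A: "decay_C2 A \<phi>" using test_function_decay[OF tf] .
  obtain C where C: "\<And>\<xi>. norm (of_real \<bar>\<xi>\<bar> * fourier (\<lambda>y. of_real (\<phi> y)) \<xi>) \<le> C / (1 + \<xi>\<^sup>2)"
    using fourier_decay[OF tf] by blast
  have m\<phi>: "(\<lambda>y. complex_of_real (\<phi> y)) \<in> borel_measurable borel" by measurable
  define F where "F \<xi> = (LINT y|lborel. exp (- \<i> * of_real (y * \<xi>)) * complex_of_real (\<phi> y))" for \<xi>
  have F: "fourier (\<lambda>y. of_real (\<phi> y)) = F" unfolding F_def fourier_eq_lborel[OF m\<phi>] ..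
  have mF [measurable]: "F \<in> borel_measurable borel" unfolding F_def by measurable
  define H where "H \<xi> = exp (\<i> * of_real (x * \<xi>)) * (of_real \<bar>\<xi>\<bar> * F \<xi>)" for \<xi>
  have [measurable]: "H \<in> borel_measurable borel" unfolding H_def by measurable
  have nH: "norm (H \<xi>) \<le> C / (1 + \<xi>\<^sup>2)" for \<xi>
    using C[of \<xi>] unfolding F H_def by (simp add: norm_mult norm_exp_eq_Re)
  have iH: "integrable lborel H" by (rule integrable_decay[OF _ nH]) simp
  define e :: "nat \<Rightarrow> real" where "e n = inverse (real (Suc n))" for n
  have e: "e n > 0" "e \<longlonglongrightarrow> 0" for n
    using LIMSEQ_inverse_real_of_nat by (simp_all add: e_def[abs_def])
  have "(\<lambda>n. LINT \<xi>|lborel. of_real (exp (- e n * \<bar>\<xi>\<bar>)) * H \<xi>) \<longlonglongrightarrow> (LINT \<xi>|lborel. H \<xi>)"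
  proof (rule integral_dominated_convergence[where w = "\<lambda>\<xi>. norm (H \<xi>)"])
    show "integrable lborel (\<lambda>\<xi>. norm (H \<xi>))" by (rule integrable_norm[OF iH])
    show "AE \<xi> in lborel. (\<lambda>n. of_real (exp (- e n * \<bar>\<xi>\<bar>)) * H \<xi>) \<longlonglongrightarrow> H \<xi>"
    proof (rule AE_I2)
      fix \<xi>
      have "(\<lambda>n. of_real (exp (- e n * \<bar>\<xi>\<bar>)) * H \<xi>) \<longlonglongrightarrow> of_real (exp (- 0 * \<bar>\<xi>\<bar>)) * H \<xi>"
        by (intro tendsto_intros e)
      then show "(\<lambda>n. of_real (exp (- e n * \<bar>\<xi>\<bar>)) * H \<xi>) \<longlonglongrightarrow> H \<xi>" by simp
    qed
    show "AE \<xi> in lborel. norm (of_real (exp (- e n * \<bar>\<xi>\<bar>)) * H \<xi>) \<le> norm (H \<xi>)" for n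
    proof (rule AE_I2)
      fix \<xi>
      have "exp (- e n * \<bar>\<xi>\<bar>) \<le> 1" using e(1)[of n] by simp
      then have "exp (- e n * \<bar>\<xi>\<bar>) * norm (H \<xi>) \<le> 1 * norm (H \<xi>)" by (rule mult_right_mono) simp
      then show "norm (of_real (exp (- e n * \<bar>\<xi>\<bar>)) * H \<xi>) \<le> norm (H \<xi>)" by (simp add: norm_mult)
    qed
  qed measurable
  then have lim1: "(\<lambda>n. Re (LINT \<xi>|lborel. of_real (exp (- e n * \<bar>\<xi>\<bar>)) * H \<xi>)) \<longlonglongrightarrow> Re (LINT \<xi>|lborel. H \<xi>)"
    by (rule tendsto_Re)
  have eq: "Re (LINT \<xi>|lborel. of_real (exp (- e n * \<bar>\<xi>\<bar>)) * H \<xi>) = (LINT s|lborel. second_diff \<phi> x s * abel_kernel (e n) s)" for n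
  proof -
    define a where "a \<xi> = \<bar>\<xi>\<bar> * exp (- e n * \<bar>\<xi>\<bar>)" for \<xi>
    have "a \<in> borel_measurable borel" unfolding a_def by measurable
    then have ia: "integrable lborel a"
      by (rule integrable_decay[where A = "1 / e n + 6 / e n ^ 3"])
        (use exp_decay_bound[OF e(1), of _ n] in \<open>simp_all add: a_def\<close>)
    \<comment> \<open>The damping in \<open>a\<close> makes this double integral absolutely
      convergent. Without it \<open>|\<xi>| * |\<phi> y|\<close> is not integrable in
      \<open>\<xi>\<close>, and the order of integration could not be exchanged.\<close>
    define G where "G \<xi> y = exp (\<i> * of_real ((x - y) * \<xi>)) * of_real (a \<xi>) * complex_of_real (\<phi> y)" for \<xi> y
    have mG: "case_prod G \<in> borel_measurable (lborel \<Otimes>\<^sub>M lborel)" unfolding G_def a_def by measurable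
    have nG: "norm (case_prod G (\<xi>, y)) \<le> \<bar>a \<xi>\<bar> * \<bar>\<phi> y\<bar>" for \<xi> y
      by (simp add: G_def norm_mult norm_exp_eq_Re del: of_real_mult)
    have iG: "integrable (lborel \<Otimes>\<^sub>M lborel) (case_prod G)"
      by (rule integrable_pair_bound[OF mG integrable_abs[OF ia] integrable_abs[OF test_function_integrable[OF tf]] nG])
    have "(LINT \<xi>|lborel. of_real (exp (- e n * \<bar>\<xi>\<bar>)) * H \<xi>) = (LINT \<xi>|lborel. LINT y|lborel. G \<xi> y)"
    proof (rule Bochner_Integration.integral_cong[OF refl])
      fix \<xi>
      have "of_real (exp (- e n * \<bar>\<xi>\<bar>)) * H \<xi> = (exp (\<i> * of_real (x * \<xi>)) * of_real (a \<xi>)) * F \<xi>"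
        unfolding H_def a_def by simp
      also have "\<dots> = (LINT y|lborel. (exp (\<i> * of_real (x * \<xi>)) * of_real (a \<xi>)) * (exp (- \<i> * of_real (y * \<xi>)) * complex_of_real (\<phi> y)))"
        unfolding F_def by (rule integral_mult_right_zero[symmetric])
      also have "\<dots> = (LINT y|lborel. G \<xi> y)"
      proof (rule Bochner_Integration.integral_cong[OF refl])
        fix y
        have "exp (\<i> * of_real ((x - y) * \<xi>)) = exp (\<i> * of_real (x * \<xi>)) * exp (- \<i> * of_real (y * \<xi>))"
          unfolding exp_add[symmetric] by (simp add: algebra_simps)
        then show "(exp (\<i> * of_real (x * \<xi>)) * of_real (a \<xi>)) * (exp (- \<i> * of_real (y * \<xi>)) * complex_of_real (\<phi> y)) = G \<xi> y"
          unfolding G_def by simp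
      qed
      finally show "of_real (exp (- e n * \<bar>\<xi>\<bar>)) * H \<xi> = (LINT y|lborel. G \<xi> y)" .
    qed
    also have "\<dots> = (LINT y|lborel. LINT \<xi>|lborel. G \<xi> y)"
      by (rule lborel_pair.Fubini_integral[OF iG, symmetric])
    also have "\<dots> = (LINT y|lborel. complex_of_real (- 2 * \<phi> y * abel_kernel (e n) (x - y)))"
    proof (rule Bochner_Integration.integral_cong[OF refl])
      fix y
      have "(LINT \<xi>|lborel. G \<xi> y) = (LINT \<xi>|lborel. exp (\<i> * of_real ((x - y) * \<xi>)) * of_real (a \<xi>)) * complex_of_real (\<phi> y)"
        unfolding G_def by (rule integral_mult_left_zero)
      also have "\<dots> = complex_of_real (2 * ((e n)\<^sup>2 - (x - y)\<^sup>2) / ((e n)\<^sup>2 + (x - y)\<^sup>2)\<^sup>2) * complex_of_real (\<phi> y)"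
        unfolding a_def fourier_abs_exp[OF e(1)] ..
      also have "\<dots> = complex_of_real (- 2 * \<phi> y * abel_kernel (e n) (x - y))"
      proof -
        have "2 * ((e n)\<^sup>2 - (x - y)\<^sup>2) / ((e n)\<^sup>2 + (x - y)\<^sup>2)\<^sup>2 * \<phi> y = - 2 * \<phi> y * abel_kernel (e n) (x - y)"
          unfolding abel_kernel_def divide_inverse by (simp add: left_diff_distrib right_diff_distrib)
        then show ?thesis by (metis of_real_mult)
      qed
      finally show "(LINT \<xi>|lborel. G \<xi> y) = complex_of_real (- 2 * \<phi> y * abel_kernel (e n) (x - y))" .
    qed
    also have "\<dots> = complex_of_real (LINT y|lborel. - 2 * \<phi> y * abel_kernel (e n) (x - y))"
      by (rule integral_complex_of_real)
    finally show ?thesis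
      using abel_mean_eq[OF A test_function_integrable[OF tf] e(1)[of n], of x] by simp
  qed
  have "Re (LINT \<xi>|lborel. H \<xi>) = (LINT s|lborel. second_diff \<phi> x s / s\<^sup>2)"
    using LIMSEQ_unique[OF lim1[unfolded eq] abel_mean_tendsto[OF A e]] .
  moreover have "inverse_fourier (\<lambda>\<xi>. of_real \<bar>\<xi>\<bar> * fourier (\<lambda>y. of_real (\<phi> y)) \<xi>) x = (LINT \<xi>|lborel. H \<xi>) / of_real (2 * pi)"
  proof -
    have "H \<in> borel_measurable lborel" by measurable
    from integral_completion[OF this] show ?thesis unfolding inverse_fourier_def F H_def by simp
  qed
  ultimately show ?thesis
    unfolding half_laplacian_def frac_lap_def by (simp only: Re_divide_of_real)
qed

section \<open>Non-compactly supported test functions\<close>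

text \<open>The classical smooth function \<open>exp (- 1/x)\<close>, with polynomials in
  \<open>1/x\<close> as prefactors so that the family is closed under differentiation: the
  derivative replaces \<open>p\<close> by \<open>X^2 * (p - p')\<close>.\<close>

definition flat :: "real poly \<Rightarrow> real \<Rightarrow> real"
  where "flat p x = (if x > 0 then poly p (1 / x) * exp (- (1 / x)) else 0)"

lemma tendsto_poly_exp_neg: "((\<lambda>t. poly p t * exp (- t)) \<longlongrightarrow> (0::real)) at_top"
proof -
  have "((\<lambda>t. \<Sum>i\<le>degree p. coeff p i * (t ^ i / exp t)) \<longlongrightarrow> (\<Sum>i\<le>degree p. coeff p i * 0)) at_top"
    by (intro tendsto_intros tendsto_power_div_exp_0)
  moreover have "(\<Sum>i\<le>degree p. coeff p i * (t ^ i / exp t)) = poly p t * exp (- t)" for t :: real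
    by (simp add: poly_altdef sum_distrib_right exp_minus divide_inverse mult.assoc)
  ultimately show ?thesis by simp
qed

lemma flat_DERIV: "(flat p has_real_derivative flat (monom 1 2 * (p - pderiv p)) x) (at x)"
proof -
  consider "x > 0" | "x < 0" | "x = 0" by linarith
  then show ?thesis
  proof cases
    case 1
    have "((\<lambda>x. poly p (1 / x) * exp (- (1 / x))) has_real_derivative
        poly (pderiv p) (1 / x) * (- (1 / x\<^sup>2)) * exp (- (1 / x)) + exp (- (1 / x)) * (1 / x\<^sup>2) * poly p (1 / x)) (at x)"
      using 1 by (auto intro!: derivative_eq_intros DERIV_chain2[OF poly_DERIV] simp: power2_eq_square)
    moreover have "poly (pderiv p) (1 / x) * (- (1 / x\<^sup>2)) * exp (- (1 / x)) + exp (- (1 / x)) * (1 / x\<^sup>2) * poly p (1 / x) =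
        flat (monom 1 2 * (p - pderiv p)) x"
      using 1 by (simp add: flat_def poly_monom power_one_over algebra_simps)
    ultimately have "((\<lambda>x. poly p (1 / x) * exp (- (1 / x))) has_real_derivative flat (monom 1 2 * (p - pderiv p)) x) (at x)"
      by simp
    then show ?thesis
      by (rule has_field_derivative_transform_within_open[where S = "{0<..}"]) (use 1 in \<open>simp_all add: flat_def\<close>)
  next
    case 2
    have "((\<lambda>_. 0) has_real_derivative flat (monom 1 2 * (p - pderiv p)) x) (at x)"
      using 2 by (simp add: flat_def)
    then show ?thesis
      by (rule has_field_derivative_transform_within_open[where S = "{..<0}"]) (use 2 in \<open>simp_all add: flat_def\<close>)
  next
    case 3
    \<comment> \<open>From the right of 0 the difference quotient is of the same kind, with
      \<open>p\<close> multiplied by \<open>X\<close> to account for the division by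
      \<open>h\<close>; exponential decay beats every polynomial.\<close>
    have "((\<lambda>h. poly (monom 1 1 * p) (1 / h) * exp (- (1 / h))) \<longlongrightarrow> 0) (at_right 0)"
      by (rule filterlim_compose[OF tendsto_poly_exp_neg]) (simp add: divide_inverse filterlim_inverse_at_top_right)
    then have "((\<lambda>h. (flat p (0 + h) - flat p 0) / h) \<longlongrightarrow> 0) (at_right 0)"
      by (rule Lim_transform_eventually)
        (auto intro!: eventually_mono[OF eventually_at_right_less[of 0]] simp: flat_def poly_monom)
    moreover have "((\<lambda>h. (flat p (0 + h) - flat p 0) / h) \<longlongrightarrow> 0) (at_left 0)"
      by (rule Lim_transform_eventually[OF tendsto_const])
        (auto intro!: eventually_mono[OF eventually_at_left_real[of "-1" 0]] simp: flat_def)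
    ultimately have "((\<lambda>h. (flat p (0 + h) - flat p 0) / h) \<longlongrightarrow> 0) (at 0)"
      by (simp only: filterlim_at_split)
    then show ?thesis using 3 by (simp add: DERIV_def flat_def)
  qed
qed

text \<open>A class closed under differentiation, so membership alone gives derivatives of all
  orders. The generators are those needed for a cutoff times \<open>inverse (t^2 + x^2)\<close> and
  its derivatives.\<close>

inductive smooth_alg :: "(real \<Rightarrow> real) \<Rightarrow> bool"
where
  smooth_alg_const: "smooth_alg (\<lambda>x. c)"
| smooth_alg_id: "smooth_alg (\<lambda>x. x)"
| smooth_alg_flat: "smooth_alg (\<lambda>x. flat p (a + b * x))"
| smooth_alg_inverse: "c > 0 \<Longrightarrow> smooth_alg (\<lambda>x. inverse (c + x\<^sup>2))"
| smooth_alg_add: "smooth_alg f \<Longrightarrow> smooth_alg g \<Longrightarrow> smooth_alg (\<lambda>x. f x + g x)"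
| smooth_alg_mult: "smooth_alg f \<Longrightarrow> smooth_alg g \<Longrightarrow> smooth_alg (\<lambda>x. f x * g x)"

lemma smooth_alg_DERIV:
  assumes "smooth_alg f"
  obtains f' where "smooth_alg f'" "\<And>x. (f has_real_derivative f' x) (at x)"
proof -
  have "\<exists>f'. smooth_alg f' \<and> (\<forall>x. (f has_real_derivative f' x) (at x))"
    using assms
  proof induction
    case (smooth_alg_const c)
    show ?case using smooth_alg.smooth_alg_const[of 0] by (intro exI[of _ "\<lambda>x. 0"]) simp
  next
    case smooth_alg_id
    show ?case using smooth_alg.smooth_alg_const[of 1] by (intro exI[of _ "\<lambda>x. 1"]) simp
  next
    case (smooth_alg_flat p a b)
    have "((\<lambda>x. flat p (a + b * x)) has_real_derivative flat (monom 1 2 * (p - pderiv p)) (a + b * x) * b) (at x)" for x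
      by (rule DERIV_chain2[OF flat_DERIV]) (auto intro!: derivative_eq_intros)
    then show ?case
      using smooth_alg.smooth_alg_mult[OF smooth_alg.smooth_alg_flat smooth_alg.smooth_alg_const] by blast
  next
    case (smooth_alg_inverse c)
    have nz: "c + x\<^sup>2 \<noteq> 0" for x :: real using smooth_alg_inverse by (metis add_pos_nonneg less_irrefl zero_le_power2)
    have "((\<lambda>x. inverse (c + x\<^sup>2)) has_real_derivative (- 2 * x) * (inverse (c + x\<^sup>2) * inverse (c + x\<^sup>2))) (at x)" for x
      using nz[of x] by (auto intro!: derivative_eq_intros)
    moreover have "smooth_alg (\<lambda>x. (- 2 * x) * (inverse (c + x\<^sup>2) * inverse (c + x\<^sup>2)))"
      by (intro smooth_alg.intros smooth_alg_inverse)
    ultimately show ?case by blast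
  next
    case (smooth_alg_add f g)
    then obtain f' g' where d: "smooth_alg f'" "smooth_alg g'"
      "\<And>x. (f has_real_derivative f' x) (at x)" "\<And>x. (g has_real_derivative g' x) (at x)" by blast
    have "((\<lambda>x. f x + g x) has_real_derivative f' x + g' x) (at x)" for x by (intro DERIV_add d)
    then show ?case using smooth_alg.smooth_alg_add[OF d(1,2)] by blast
  next
    case (smooth_alg_mult f g)
    then obtain f' g' where d: "smooth_alg f'" "smooth_alg g'"
      "\<And>x. (f has_real_derivative f' x) (at x)" "\<And>x. (g has_real_derivative g' x) (at x)" by blast
    have "((\<lambda>x. f x * g x) has_real_derivative f' x * g x + g' x * f x) (at x)" for x by (intro DERIV_mult d)
    then show ?case
      using smooth_alg.smooth_alg_add[OF smooth_alg.smooth_alg_mult[OF d(1) smooth_alg_mult(2)]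
          smooth_alg.smooth_alg_mult[OF d(2) smooth_alg_mult(1)]] by blast
  qed
  then show thesis using that by blast
qed

lemma smooth_alg_iter_deriv: "smooth_alg f \<Longrightarrow> smooth_alg ((deriv ^^ n) f)"
proof (induction n arbitrary: f)
  case (Suc n)
  obtain f' where f': "smooth_alg f'" "\<And>x. (f has_real_derivative f' x) (at x)"
    using smooth_alg_DERIV[OF Suc.prems] by blast
  then have "deriv f = f'" by (auto intro!: ext DERIV_imp_deriv)
  then have "(deriv ^^ Suc n) f = (deriv ^^ n) f'" by (simp add: funpow_swap1)
  then show ?case using Suc.IH[OF f'(1)] by simp
qed simp

lemma smooth_alg_test_function:
  assumes f: "smooth_alg f" and 0: "\<And>x. \<bar>x\<bar> \<ge> R \<Longrightarrow> f x = 0"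
  shows "test_function f"
proof -
  have "(deriv ^^ n) f differentiable (at x)" for n x
    using smooth_alg_DERIV[OF smooth_alg_iter_deriv[OF f, of n]] real_differentiable_def by metis
  moreover have "bounded {x. f x \<noteq> 0}"
    unfolding bounded_iff
  proof (intro exI[of _ R] ballI)
    fix x assume "x \<in> {x. f x \<noteq> 0}"
    then show "norm x \<le> R" using 0[of x] by (cases "R \<le> \<bar>x\<bar>") simp_all
  qed
  ultimately show ?thesis unfolding test_function_def compact_closure by blast
qed

lemma test_function_shift:
  assumes "test_function \<phi>"
  shows "test_function (\<lambda>x. \<phi> (x + c))"
proof -
  have it: "(deriv ^^ n) (\<lambda>x. \<phi> (x + c)) = (\<lambda>x. (deriv ^^ n) \<phi> (x + c))" for n
  proof (induction n)
    case (Suc n)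
    have "deriv (\<lambda>x. g (x + c)) = (\<lambda>x. deriv g (x + c))" for g :: "real \<Rightarrow> real"
      unfolding deriv_def by (simp add: DERIV_shift)
    then show ?case using Suc by simp
  qed simp
  have "(deriv ^^ n) (\<lambda>x. \<phi> (x + c)) differentiable (at x)" for n x
    using assms unfolding it test_function_def real_differentiable_def by (metis DERIV_shift)
  moreover have "bounded {x. \<phi> (x + c) \<noteq> 0}"
  proof -
    obtain R where R: "\<And>x. \<bar>x\<bar> \<ge> R \<Longrightarrow> \<phi> x = 0" using test_function_support[OF assms] by blast
    show ?thesis unfolding bounded_iff
    proof (intro exI[of _ "R + \<bar>c\<bar>"] ballI)
      fix x assume "x \<in> {x. \<phi> (x + c) \<noteq> 0}"
      then have "\<bar>x + c\<bar> < R" using R[of "x + c"] by force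
      then show "norm x \<le> R + \<bar>c\<bar>" unfolding real_norm_def by linarith
    qed
  qed
  ultimately show ?thesis unfolding test_function_def compact_closure by blast
qed

lemma frac_lap_shift: "frac_lap (\<lambda>x. \<phi> (x + c)) x = frac_lap \<phi> (x + c)"
  unfolding frac_lap_def second_diff_def by (simp add: algebra_simps)

text \<open>On the open interval from -1 to 1 this is \<open>exp (2 - 2 / (1 - x^2))\<close>; the
  factor \<open>exp 2\<close> normalises the value at 0 to 1.\<close>

definition cutoff :: "real \<Rightarrow> real"
  where "cutoff x = exp 2 * (flat 1 (1 - x) * flat 1 (1 + x))"

lemma cutoff_0: "cutoff 0 = 1"
  by (simp add: cutoff_def flat_def exp_add[symmetric])

lemma cutoff_eq_0: "\<bar>x\<bar> \<ge> 1 \<Longrightarrow> cutoff x = 0"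
  by (auto simp: cutoff_def flat_def)

lemma smooth_alg_cutoff: "smooth_alg (\<lambda>x. cutoff (x * c))"
proof -
  have "smooth_alg (\<lambda>x. exp 2 * (flat 1 (1 + (- c) * x) * flat 1 (1 + c * x)))"
    by (intro smooth_alg.intros)
  then show ?thesis by (simp add: cutoff_def mult.commute)
qed

lemma test_function_cutoff: "test_function cutoff"
  using smooth_alg_test_function[OF smooth_alg_cutoff[of 1], of 1] cutoff_eq_0 by simp

lemma inverse_square_decay:
  fixes t x :: real
  assumes t: "t > 0"
  shows "inverse (t\<^sup>2 + x\<^sup>2) \<le> (1 + 1 / t\<^sup>2) / (1 + x\<^sup>2)"
proof -
  have p: "t\<^sup>2 + x\<^sup>2 > 0" using t by (simp add: add_pos_nonneg)
  have "1 + x\<^sup>2 \<le> (1 + 1 / t\<^sup>2) * (t\<^sup>2 + x\<^sup>2)"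
    using t by (simp add: distrib_left distrib_right)
  then have "inverse (t\<^sup>2 + x\<^sup>2) * (1 + x\<^sup>2) \<le> 1 + 1 / t\<^sup>2"
    using p by (simp add: divide_le_eq divide_inverse[symmetric] inverse_eq_divide)
  then show ?thesis by (simp only: pos_le_divide_eq one_plus_square_pos)
qed

lemma DERIV_inverse_square:
  fixes t x :: real
  assumes t: "t > 0"
  shows "((\<lambda>x. inverse (t\<^sup>2 + x\<^sup>2)) has_real_derivative - 2 * x * (inverse (t\<^sup>2 + x\<^sup>2))\<^sup>2) (at x)"
    and "((\<lambda>x. - 2 * x * (inverse (t\<^sup>2 + x\<^sup>2))\<^sup>2) has_real_derivative
      - 2 * (inverse (t\<^sup>2 + x\<^sup>2))\<^sup>2 + 8 * x\<^sup>2 * (inverse (t\<^sup>2 + x\<^sup>2)) ^ 3) (at x)"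
proof -
  have nz: "t\<^sup>2 + x\<^sup>2 \<noteq> 0" using t by (metis add_pos_nonneg less_irrefl zero_le_power2 zero_less_power)
  show 1: "((\<lambda>x. inverse (t\<^sup>2 + x\<^sup>2)) has_real_derivative - 2 * x * (inverse (t\<^sup>2 + x\<^sup>2))\<^sup>2) (at x)"
    using nz t by (auto intro!: derivative_eq_intros simp: power2_eq_square)
  show "((\<lambda>x. - 2 * x * (inverse (t\<^sup>2 + x\<^sup>2))\<^sup>2) has_real_derivative
      - 2 * (inverse (t\<^sup>2 + x\<^sup>2))\<^sup>2 + 8 * x\<^sup>2 * (inverse (t\<^sup>2 + x\<^sup>2)) ^ 3) (at x)"
    using t by (auto intro!: derivative_eq_intros 1 simp: power2_eq_square power3_eq_cube)
qed

lemma inverse_square_deriv2_le: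
  fixes t x :: real
  assumes t: "t > 0"
  defines "p \<equiv> inverse (t\<^sup>2 + x\<^sup>2)"
  shows "\<bar>- 2 * p\<^sup>2 + 8 * x\<^sup>2 * p ^ 3\<bar> \<le> 10 * p\<^sup>2"
proof -
  have pos: "t\<^sup>2 + x\<^sup>2 > 0" using t by (simp add: add_pos_nonneg)
  then have p: "p > 0" unfolding p_def by simp
  have "x\<^sup>2 * p \<le> (t\<^sup>2 + x\<^sup>2) * p" using p by (intro mult_right_mono) simp_all
  also have "\<dots> = 1" unfolding p_def using pos by (intro right_inverse) linarith
  finally have "x\<^sup>2 * p \<le> 1" .
  then have "(x\<^sup>2 * p) * p\<^sup>2 \<le> 1 * p\<^sup>2" by (rule mult_right_mono) simp
  moreover have "0 \<le> (x\<^sup>2 * p) * p\<^sup>2" using p by simp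
  moreover have "8 * x\<^sup>2 * p ^ 3 = 8 * ((x\<^sup>2 * p) * p\<^sup>2)" by (simp add: power2_eq_square power3_eq_cube)
  moreover have "0 \<le> p\<^sup>2" by simp
  ultimately show ?thesis unfolding abs_le_iff by linarith
qed

text \<open>Cutting the kernel off at scale \<open>n\<close> keeps the decay bounds uniform in \<open>n\<close>, since the
  derivatives of the cutoff are of size \<open>1/n\<close> on the region \<open>|x| \<le> n\<close>.\<close>

lemma cutoff_inverse_square_decay:
  fixes t :: real
  assumes t: "t > 0"
  obtains B where "\<And>n::nat. decay_C2 B (\<lambda>x. cutoff (x * (1 / real (Suc n))) * inverse (t\<^sup>2 + x\<^sup>2))"
    "decay_C2 B (\<lambda>x. inverse (t\<^sup>2 + x\<^sup>2))"
proof -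
  define p where "p x = inverse (t\<^sup>2 + x\<^sup>2)" for x :: real
  define p' where "p' x = - 2 * x * (p x)\<^sup>2" for x
  define p'' where "p'' x = - 2 * (p x)\<^sup>2 + 8 * x\<^sup>2 * (p x) ^ 3" for x
  have Dp: "(p has_real_derivative p' x) (at x)" "(p' has_real_derivative p'' x) (at x)" for x
    using DERIV_inverse_square[OF t] unfolding p''_def[abs_def] p'_def[abs_def] p_def[abs_def] by blast+
  define c where "c = 1 + 1 / t\<^sup>2"
  have c: "c \<ge> 1" using t by (simp add: c_def)
  have p0: "p x > 0" for x using t by (simp add: p_def add_pos_nonneg)
  have pc: "p x \<le> c / (1 + x\<^sup>2)" for x unfolding p_def c_def by (rule inverse_square_decay[OF t])
  have p2: "(p x)\<^sup>2 \<le> c\<^sup>2 / (1 + x\<^sup>2)\<^sup>2" for x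
    using power_mono[OF pc less_imp_le[OF p0], of x 2] by (simp add: power_divide)
  have p''b: "\<bar>p'' x\<bar> \<le> 10 * (p x)\<^sup>2" for x unfolding p''_def p_def by (rule inverse_square_deriv2_le[OF t])
  note d1 = test_function_deriv[OF test_function_cutoff]
  note d2 = test_function_deriv[OF d1]
  have ex: "\<exists>A\<ge>0. \<forall>x. \<bar>\<phi> x\<bar> \<le> A" if tf: "test_function \<phi>" for \<phi>
  proof -
    obtain A where A: "A \<ge> 0" "\<And>x. \<bar>\<phi> x\<bar> \<le> A / (1 + x\<^sup>2)\<^sup>2" using test_function_bound[OF tf] by blast
    have "A / (1 + x\<^sup>2)\<^sup>2 \<le> A / 1" for x
      by (rule divide_left_mono[OF _ A(1)]) (use one_plus_square_pos[of x] in \<open>simp_all add: one_le_power\<close>)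
    then show ?thesis using A by (metis div_by_1 order_trans)
  qed
  obtain A0 A1 A2 where A012: "A0 \<ge> 0" "A1 \<ge> 0" "A2 \<ge> 0" "\<And>x. \<bar>cutoff x\<bar> \<le> A0"
    "\<And>x. \<bar>deriv cutoff x\<bar> \<le> A1" "\<And>x. \<bar>deriv (deriv cutoff) x\<bar> \<le> A2"
    using ex[OF test_function_cutoff] ex[OF d1] ex[OF d2] by blast
  define A where "A = A0 + A1 + A2 + 1"
  have A: "A \<ge> 1" "\<bar>cutoff x\<bar> \<le> A" "\<bar>deriv cutoff x\<bar> \<le> A" "\<bar>deriv (deriv cutoff) x\<bar> \<le> A" for x
    using A012(1-3) A012(4-6)[of x] unfolding A_def by linarith+
  \<comment> \<open>\<open>16 = 2 + 2 + 10 + 2\<close> counts the four terms in the second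
    derivative of the product. The summand \<open>c\<close> serves the function values, and
    \<open>A\<close> bounds the cutoff together with its first two derivatives.\<close>
  define B where "B = A * (c + 16 * c\<^sup>2)"
  have "c * 1 \<le> c * c" using c by (intro mult_left_mono) simp_all
  then have cc: "c \<le> c\<^sup>2" by (simp add: power2_eq_square)
  have "1 * (c + 16 * c\<^sup>2) \<le> B" unfolding B_def using A(1) c by (intro mult_right_mono) simp_all
  then have "c + 16 * c\<^sup>2 \<le> B" by simp
  moreover have "0 \<le> c" "0 \<le> c\<^sup>2" using c by simp_all
  ultimately have B1: "c \<le> B" "10 * c\<^sup>2 \<le> B" by linarith+
  have "A * c \<le> A * (c + 16 * c\<^sup>2)" using A(1) by (intro mult_left_mono) simp_all
  then have B2: "A * c \<le> B" unfolding B_def .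
  have "\<bar>p x\<bar> \<le> B / (1 + x\<^sup>2)" for x
  proof -
    have "c / (1 + x\<^sup>2) \<le> B / (1 + x\<^sup>2)" using B1(1) by (rule divide_right_mono) (simp add: less_imp_le one_plus_square_pos)
    then show ?thesis using pc[of x] p0[of x] by linarith
  qed
  moreover have "\<bar>p'' x\<bar> \<le> B / (1 + x\<^sup>2)\<^sup>2" for x
  proof -
    have "10 * c\<^sup>2 / (1 + x\<^sup>2)\<^sup>2 \<le> B / (1 + x\<^sup>2)\<^sup>2" using B1(2) by (rule divide_right_mono) simp
    moreover have "10 * (c\<^sup>2 / (1 + x\<^sup>2)\<^sup>2) = 10 * c\<^sup>2 / (1 + x\<^sup>2)\<^sup>2" by simp
    ultimately show ?thesis using p''b[of x] p2[of x] by linarith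
  qed
  ultimately have dp: "decay_C2 B p" unfolding decay_C2_def using Dp by blast
  have "decay_C2 B (\<lambda>x. cutoff (x * r) * p x)" if r: "r = 1 / real (Suc n)" for n r
  proof -
    have r01: "0 < r" "r \<le> 1" using r by simp_all
    define \<phi>' where "\<phi>' x = deriv cutoff (x * r) * r * p x + p' x * cutoff (x * r)" for x
    define \<phi>'' where "\<phi>'' x = (deriv (deriv cutoff) (x * r) * r * r * p x + p' x * (deriv cutoff (x * r) * r)) +
      (p'' x * cutoff (x * r) + deriv cutoff (x * r) * r * p' x)" for x
    have C1: "((\<lambda>x. cutoff (x * r)) has_real_derivative deriv cutoff (x * r) * r) (at x)" for x
      by (rule DERIV_chain2[OF test_function_DERIV[OF test_function_cutoff]]) (auto intro!: derivative_eq_intros)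
    have C2: "((\<lambda>x. deriv cutoff (x * r) * r) has_real_derivative deriv (deriv cutoff) (x * r) * r * r) (at x)" for x
      by (rule DERIV_cmult_right[OF DERIV_chain2[OF test_function_DERIV[OF d1]]]) (auto intro!: derivative_eq_intros)
    have D1: "((\<lambda>x. cutoff (x * r) * p x) has_real_derivative \<phi>' x) (at x)" for x
      unfolding \<phi>'_def by (rule DERIV_mult[OF C1 Dp(1)])
    have D2: "(\<phi>' has_real_derivative \<phi>'' x) (at x)" for x
      unfolding \<phi>'_def[abs_def] \<phi>''_def by (intro DERIV_add DERIV_mult C1 C2 Dp)
    have 0: "\<phi>'' x = 0" if x: "\<bar>x * r\<bar> > 1" for x
    proof -
      have z: "cutoff y = 0" if "y \<in> {y. \<bar>y\<bar> > 1}" for y using cutoff_eq_0 that by simp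
      have o: "open {y::real. \<bar>y\<bar> > 1}" by (intro open_Collect_less continuous_intros)
      have z1: "deriv cutoff y = 0" if "y \<in> {y. \<bar>y\<bar> > 1}" for y
        by (rule DERIV_imp_deriv, rule has_field_derivative_transform_within_open[OF DERIV_const o that]) (simp add: z)
      have z2: "deriv (deriv cutoff) y = 0" if "y \<in> {y. \<bar>y\<bar> > 1}" for y
        by (rule DERIV_imp_deriv, rule has_field_derivative_transform_within_open[OF DERIV_const o that]) (simp add: z1)
      show ?thesis using x z[of "x * r"] z1[of "x * r"] z2[of "x * r"] by (simp add: \<phi>''_def)
    qed
    have b2: "\<bar>\<phi>'' x\<bar> \<le> B / (1 + x\<^sup>2)\<^sup>2" for x
    proof (cases "\<bar>x * r\<bar> > 1")
      case True
      have "B \<ge> 0" using B1(1) c by linarith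
      then show ?thesis using 0[OF True] by simp
    next
      case False
      then have xr: "\<bar>x\<bar> * r \<le> 1" using r01 by (simp add: abs_mult)
      \<comment> \<open>On the support of the cutoff both \<open>r \<le> 1\<close> and
        \<open>r * |x| \<le> 1\<close>: derivatives that fall on the cutoff gain powers of
        \<open>r\<close>, and these count as decay in \<open>x\<close>.\<close>
      have rr: "r * r \<le> 2 / (1 + x\<^sup>2)"
      proof -
        have "(\<bar>x\<bar> * r) * (\<bar>x\<bar> * r) \<le> 1" using mult_mono[OF xr xr] r01 by simp
        then have "x\<^sup>2 * (r * r) \<le> 1" by (simp add: power2_eq_square mult_ac)
        moreover have "r * r \<le> 1" using mult_mono[OF r01(2) r01(2)] r01 by simp
        ultimately have "r * r * (1 + x\<^sup>2) \<le> 2" by (simp add: distrib_left mult.commute)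
        then show ?thesis by (simp only: pos_le_divide_eq one_plus_square_pos)
      qed
      have t1: "\<bar>deriv (deriv cutoff) (x * r) * r * r * p x\<bar> \<le> A * (2 * (c\<^sup>2 / (1 + x\<^sup>2)\<^sup>2))"
      proof -
        have "\<bar>deriv (deriv cutoff) (x * r)\<bar> * ((r * r) * p x) \<le> A * ((2 / (1 + x\<^sup>2)) * (c / (1 + x\<^sup>2)))"
          using A rr pc p0[of x] r01 one_plus_square_pos[of x] by (intro mult_mono) (simp_all add: less_imp_le)
        also have "\<dots> = A * (2 * (c / (1 + x\<^sup>2)\<^sup>2))" by (simp add: power2_eq_square)
        also have "\<dots> \<le> A * (2 * (c\<^sup>2 / (1 + x\<^sup>2)\<^sup>2))"
          using A(1) by (intro mult_left_mono divide_right_mono cc) simp_all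
        finally show ?thesis using r01 p0[of x] by (simp add: abs_mult mult.assoc)
      qed
      have t2: "\<bar>p' x * (deriv cutoff (x * r) * r)\<bar> \<le> A * (2 * (c\<^sup>2 / (1 + x\<^sup>2)\<^sup>2))"
      proof -
        have "\<bar>deriv cutoff (x * r)\<bar> * (2 * ((\<bar>x\<bar> * r) * (p x)\<^sup>2)) \<le> A * (2 * (1 * (c\<^sup>2 / (1 + x\<^sup>2)\<^sup>2)))"
          using A xr p2[of x] r01 by (intro mult_mono) simp_all
        then show ?thesis using r01 by (simp add: p'_def abs_mult mult_ac)
      qed
      have t3: "\<bar>p'' x * cutoff (x * r)\<bar> \<le> A * (10 * (c\<^sup>2 / (1 + x\<^sup>2)\<^sup>2))"
      proof -
        have "\<bar>p'' x\<bar> \<le> 10 * (c\<^sup>2 / (1 + x\<^sup>2)\<^sup>2)" using p''b[of x] p2[of x] by linarith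
        then have "\<bar>cutoff (x * r)\<bar> * \<bar>p'' x\<bar> \<le> A * (10 * (c\<^sup>2 / (1 + x\<^sup>2)\<^sup>2))"
          using A(1) A(2) by (intro mult_mono) simp_all
        then show ?thesis by (simp add: abs_mult mult.commute)
      qed
      have "\<bar>\<phi>'' x\<bar> \<le> \<bar>deriv (deriv cutoff) (x * r) * r * r * p x\<bar> + \<bar>p' x * (deriv cutoff (x * r) * r)\<bar> +
          (\<bar>p'' x * cutoff (x * r)\<bar> + \<bar>p' x * (deriv cutoff (x * r) * r)\<bar>)"
        unfolding \<phi>''_def using mult.commute[of "deriv cutoff (x * r) * r" "p' x"] by linarith
      also have "\<dots> \<le> 16 * (A * (c\<^sup>2 / (1 + x\<^sup>2)\<^sup>2))" using t1 t2 t3 by linarith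
      also have "\<dots> = A * (16 * c\<^sup>2) / (1 + x\<^sup>2)\<^sup>2" by simp
      also have "\<dots> \<le> B / (1 + x\<^sup>2)\<^sup>2"
        unfolding B_def using A(1) c by (intro divide_right_mono mult_left_mono) simp_all
      finally show ?thesis .
    qed
    have b0: "\<bar>cutoff (x * r) * p x\<bar> \<le> B / (1 + x\<^sup>2)" for x
    proof -
      have "\<bar>cutoff (x * r)\<bar> * p x \<le> A * (c / (1 + x\<^sup>2))"
        using A(1) A(2) pc p0[of x] by (intro mult_mono) simp_all
      also have "\<dots> \<le> B / (1 + x\<^sup>2)"
        using divide_right_mono[OF B2, of "1 + x\<^sup>2"] by (simp add: less_imp_le one_plus_square_pos)
      finally show ?thesis using p0[of x] by (simp add: abs_mult)
    qed
    show ?thesis unfolding decay_C2_def using D1 D2 b0 b2 by blast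
  qed
  then show thesis using that[of B] dp unfolding p_def[abs_def] by blast
qed

text \<open>The second difference divided by \<open>s^2\<close> is a rational function whose poles
  come only from the quadratics \<open>P\<close> and \<open>M\<close>. Its primitive consists of
  arctangents, which produce the value, and of logarithms, whose difference vanishes at 0 and at
  infinity.\<close>

lemma frac_lap_inverse_square:
  fixes t x :: real
  assumes t: "t > 0"
  shows "frac_lap (\<lambda>x. inverse (t\<^sup>2 + x\<^sup>2)) x = (t\<^sup>2 - x\<^sup>2) / (t * (t\<^sup>2 + x\<^sup>2)\<^sup>2)"
proof -
  define a b u where "a = t\<^sup>2 - x\<^sup>2" and "b = - 2 * x" and "u = t\<^sup>2 + x\<^sup>2"
  define P M where "P s = t\<^sup>2 + (x + s)\<^sup>2" and "M s = t\<^sup>2 + (x - s)\<^sup>2" for s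
  have pos: "t\<^sup>2 + y\<^sup>2 > 0" for y using t by (simp add: add_pos_nonneg)
  have up: "u > 0" and Pp: "P s > 0" and Mp: "M s > 0" for s
    unfolding u_def P_def M_def by (rule pos)+
  define g where "g s = ((a + b * (s + x)) / P s + (a - b * (s - x)) / M s) / u\<^sup>2" for s
  have key: "second_diff (\<lambda>x. inverse (t\<^sup>2 + x\<^sup>2)) x s / s\<^sup>2 = g s" if s: "s \<noteq> 0" for s
  proof -
    \<comment> \<open>The numerator left after cancelling \<open>s^2\<close>. Identity 1 finds it in
      the second difference, identity 2 in the partial fractions with coefficients \<open>a\<close>
      and \<open>b\<close>.\<close>
    define N where "N = 2 * (s\<^sup>2 + t\<^sup>2 - 3 * x\<^sup>2)"
    have 1: "2 * (P s * M s) - u * M s - u * P s = s\<^sup>2 * N"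
      unfolding P_def M_def u_def N_def by algebra
    have 2: "(a + b * (s + x)) * M s + (a - b * (s - x)) * P s = u * N"
      unfolding P_def M_def u_def N_def a_def b_def by algebra
    have "second_diff (\<lambda>x. inverse (t\<^sup>2 + x\<^sup>2)) x s = (2 * (P s * M s) - u * M s - u * P s) / (u * (P s * M s))"
    proof -
      have "second_diff (\<lambda>x. inverse (t\<^sup>2 + x\<^sup>2)) x s = 2 * (1 / u) - 1 / P s - 1 / M s"
        by (simp add: second_diff_def u_def P_def M_def inverse_eq_divide)
      also have "\<dots> = (2 * (P s * M s) - u * M s - u * P s) / (u * (P s * M s))"
        using up Pp[of s] Mp[of s] by (simp add: diff_divide_distrib)
      finally show ?thesis .
    qed
    then have L: "second_diff (\<lambda>x. inverse (t\<^sup>2 + x\<^sup>2)) x s / s\<^sup>2 = N / (u * (P s * M s))"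
      unfolding 1 using s by simp
    have "g s = ((a + b * (s + x)) * M s + (a - b * (s - x)) * P s) / (P s * M s) / u\<^sup>2"
      using Pp[of s] Mp[of s] by (simp add: g_def add_divide_distrib)
    then have "g s = N / (u * (P s * M s))" unfolding 2 using up by (simp add: power2_eq_square)
    then show ?thesis using L by simp
  qed
  obtain B where B: "decay_C2 B (\<lambda>x. inverse (t\<^sup>2 + x\<^sup>2))" using cutoff_inverse_square_decay[OF t] by blast
  have cg: "continuous_on UNIV g"
    unfolding g_def P_def M_def
    by (intro continuous_intros) (use t up in simp_all)
  have [measurable]: "g \<in> borel_measurable borel" by (rule borel_measurable_continuous_onI[OF cg])
  have mp: "(\<lambda>x. inverse (t\<^sup>2 + x\<^sup>2)) \<in> borel_measurable borel" by measurable
  have AEg: "AE s in lborel. second_diff (\<lambda>x. inverse (t\<^sup>2 + x\<^sup>2)) x s / s\<^sup>2 = g s"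
    using AE_lborel_singleton[of "0::real"] by eventually_elim (simp add: key)
  have mg: "(\<lambda>s. second_diff (\<lambda>x. inverse (t\<^sup>2 + x\<^sup>2)) x s / s\<^sup>2) \<in> borel_measurable lborel"
    using borel_measurable_second_diff[OF mp] by measurable
  have ig: "integrable lborel g"
    using integrable_second_diff[OF B, of x] integrable_cong_AE[OF mg _ AEg] by simp
  have ge: "g (- s) = g s" for s
  proof -
    have "P (- s) = M s" "M (- s) = P s" unfolding P_def M_def by simp_all
    moreover have "a + b * (- s + x) = a - b * (s - x)" "a - b * (- s - x) = a + b * (s + x)" by algebra+
    ultimately show ?thesis unfolding g_def by (simp only: add.commute)
  qed
  define G where "G s = ((a / t) * (arctan ((s + x) / t) + arctan ((s - x) / t)) +
      (b / 2) * (ln (P s) - ln (M s))) * (2 / u\<^sup>2)" for s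
  have DG: "(G has_real_derivative g s + g (- s)) (at s)" for s
  proof -
    have D1: "((\<lambda>s. arctan ((s + c) / t)) has_real_derivative t / (t\<^sup>2 + (s + c)\<^sup>2)) (at s)" for c
    proof -
      have "((\<lambda>s. arctan ((s + c) / t)) has_real_derivative inverse (1 + ((s + c) / t)\<^sup>2) * (1 / t)) (at s)"
        by (rule DERIV_chain2[OF DERIV_arctan]) (use t in \<open>auto intro!: derivative_eq_intros\<close>)
      moreover have "inverse (1 + ((s + c) / t)\<^sup>2) * (1 / t) = t / (t\<^sup>2 + (s + c)\<^sup>2)"
      proof -
        have "1 + ((s + c) / t)\<^sup>2 = (t\<^sup>2 + (s + c)\<^sup>2) / t\<^sup>2" unfolding power_divide using t by (simp add: add_divide_distrib)
        then show ?thesis using t by (simp add: power2_eq_square[of t])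
      qed
      ultimately show ?thesis by simp
    qed
    have DP: "((\<lambda>s. ln (P s)) has_real_derivative 2 * (s + x) / P s) (at s)"
      unfolding P_def by (rule derivative_eq_intros refl pos)+ (simp add: add.commute)
    have DM: "((\<lambda>s. ln (M s)) has_real_derivative 2 * (s - x) / M s) (at s)"
      unfolding M_def by (rule derivative_eq_intros refl pos)+ (simp add: divide_inverse algebra_simps)
    have D1': "((\<lambda>s. arctan ((s - x) / t)) has_real_derivative t / (t\<^sup>2 + (s - x)\<^sup>2)) (at s)"
      using D1[of "- x"] by simp
    have "(G has_real_derivative ((a / t) * (t / (t\<^sup>2 + (s + x)\<^sup>2) + t / (t\<^sup>2 + (s - x)\<^sup>2)) +
        (b / 2) * (2 * (s + x) / P s - 2 * (s - x) / M s)) * (2 / u\<^sup>2)) (at s)"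
      unfolding G_def by (intro DERIV_cmult_right DERIV_add DERIV_cmult DERIV_diff D1 D1' DP DM)
    moreover have "t\<^sup>2 + (s + x)\<^sup>2 = P s" "t\<^sup>2 + (s - x)\<^sup>2 = M s"
      unfolding P_def M_def by (simp_all add: add.commute power2_commute)
    moreover have "((a / t) * (t / P s + t / M s) + (b / 2) * (2 * (s + x) / P s - 2 * (s - x) / M s)) * (2 / u\<^sup>2) = g s + g s"
    proof -
      have e1: "(a / t) * (t / P s + t / M s) = a / P s + a / M s" using t by (simp add: distrib_left)
      have e2: "(b / 2) * (2 * (s + x) / P s - 2 * (s - x) / M s) = b * (s + x) / P s - b * (s - x) / M s"
      proof -
        have "(b / 2) * (2 * y / z) = b * y / z" for y z by simp
        then show ?thesis by (simp only: right_diff_distrib[of "b / 2"])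
      qed
      have e3: "a / P s + a / M s + (b * (s + x) / P s - b * (s - x) / M s) = (a + b * (s + x)) / P s + (a - b * (s - x)) / M s"
        by (simp only: add_divide_distrib diff_divide_distrib)
      have "y * (2 / v) = y / v + y / v" for y v :: real by simp
      then show ?thesis unfolding e1 e2 e3 g_def .
    qed
    ultimately show ?thesis unfolding ge by simp
  qed
  have "(LINT s|lborel. g s) = (a / t) * (pi / 2 + pi / 2) * (2 / u\<^sup>2) - G 0"
    unfolding integral_split_at_zero[OF ig]
  proof (rule integral_FTC_atLeast)
    show "integrable lborel (\<lambda>s. indicator {0..} s *\<^sub>R (g s + g (- s)))"
      unfolding ge by (intro integrable_mult_indicator Bochner_Integration.integrable_add ig) simp
    show "(G has_vector_derivative g s + g (- s)) (at s)" for s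
      using DG by (simp add: has_real_derivative_iff_has_vector_derivative)
    show "continuous_on {0..} (\<lambda>s. g s + g (- s))"
      unfolding ge by (intro continuous_intros continuous_on_subset[OF cg]) simp_all
    have "((\<lambda>s. ((a / t) * (arctan ((s + x) / t) + arctan ((s - x) / t)) +
      (b / 2) * (ln (P s) - ln (M s))) * (2 / u\<^sup>2)) \<longlongrightarrow> ((a / t) * (pi / 2 + pi / 2) + (b / 2) * 0) * (2 / u\<^sup>2)) at_top"
    proof (intro tendsto_intros)
      show "((\<lambda>s. arctan ((s + x) / t)) \<longlongrightarrow> pi / 2) at_top" using t by real_asymp
      show "((\<lambda>s. arctan ((s - x) / t)) \<longlongrightarrow> pi / 2) at_top" using t by real_asymp
      show "((\<lambda>s. ln (P s) - ln (M s)) \<longlongrightarrow> 0) at_top" unfolding P_def M_def by real_asymp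
    qed
    then show "(G \<longlongrightarrow> (a / t) * (pi / 2 + pi / 2) * (2 / u\<^sup>2)) at_top" unfolding G_def[abs_def] by simp
  qed
  also have "G 0 = 0" by (simp add: G_def P_def M_def arctan_minus)
  finally have "(LINT s|lborel. g s) = (a / t) * pi * (2 / u\<^sup>2)" by simp
  moreover have "(LINT s|lborel. second_diff (\<lambda>x. inverse (t\<^sup>2 + x\<^sup>2)) x s / s\<^sup>2) = (LINT s|lborel. g s)"
    by (rule integral_cong_AE[OF mg _ AEg]) simp
  ultimately have "frac_lap (\<lambda>x. inverse (t\<^sup>2 + x\<^sup>2)) x = (a / t) * pi * (2 / u\<^sup>2) / (2 * pi)"
    unfolding frac_lap_def by simp
  also have "\<dots> = a / (t * u\<^sup>2)" by simp
  finally show ?thesis unfolding a_def u_def .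
qed

section \<open>Logarithmic representation of weak solutions\<close>

lemma inverse_square_shift_le:
  fixes x c :: real
  shows "\<bar>1 / (1 + (x - c)\<^sup>2)\<bar> \<le> (2 * (1 + c\<^sup>2)) / (1 + x\<^sup>2)"
proof -
  have "x\<^sup>2 \<le> 2 * c\<^sup>2 + 2 * (x - c)\<^sup>2"
    using zero_le_power2[of "x - 2 * c"] by (simp add: power2_eq_square algebra_simps)
  moreover have "0 \<le> c\<^sup>2 * (x - c)\<^sup>2" by simp
  moreover have "2 * (1 + c\<^sup>2) * (1 + (x - c)\<^sup>2) = 2 + 2 * c\<^sup>2 + 2 * (x - c)\<^sup>2 + 2 * (c\<^sup>2 * (x - c)\<^sup>2)"
    by (simp add: distrib_left distrib_right)
  ultimately have "1 + x\<^sup>2 \<le> 2 * (1 + c\<^sup>2) * (1 + (x - c)\<^sup>2)" by linarith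
  then have "(1 + x\<^sup>2) / (1 + (x - c)\<^sup>2) \<le> 2 * (1 + c\<^sup>2)"
    using one_plus_square_pos[of "x - c"] by (simp only: pos_divide_le_eq)
  then have "1 / (1 + (x - c)\<^sup>2) * (1 + x\<^sup>2) \<le> 2 * (1 + c\<^sup>2)" by simp
  then have "1 / (1 + (x - c)\<^sup>2) \<le> (2 * (1 + c\<^sup>2)) / (1 + x\<^sup>2)"
    by (simp only: pos_le_divide_eq one_plus_square_pos)
  then show ?thesis using one_plus_square_pos[of "x - c"] by simp
qed

text \<open>The linear problem behind the equation, with \<open>f\<close> in the place of
  \<open>K * exp w\<close>, stated for Borel measure, continuous representatives and the
  singular-integral form of the operator.\<close>

locale weak_half_laplace =
  fixes u f :: "real \<Rightarrow> real"
  assumes cont_u: "continuous_on UNIV u" and cont_f: "continuous_on UNIV f"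
    and integrable_u: "integrable lborel (\<lambda>x. u x / (1 + x\<^sup>2))" and integrable_f: "integrable lborel f"
    and weak: "\<And>\<phi>. test_function \<phi> \<Longrightarrow> (LINT x|lborel. u x * frac_lap \<phi> x) = (LINT x|lborel. f x * \<phi> x)"
begin

lemma meas_u [measurable]: "u \<in> borel_measurable borel"
  by (rule borel_measurable_continuous_onI[OF cont_u])

lemma meas_f [measurable]: "f \<in> borel_measurable borel"
  by (rule borel_measurable_continuous_onI[OF cont_f])

lemma integrable_u_decay:
  assumes [measurable]: "k \<in> borel_measurable borel" and "\<And>x. \<bar>k x\<bar> \<le> C / (1 + x\<^sup>2)"
  shows "integrable lborel (\<lambda>x. u x * k x)"
proof (rule Bochner_Integration.integrable_bound)
  show "integrable lborel (\<lambda>x. C * (u x / (1 + x\<^sup>2)))" by (intro integrable_mult_right integrable_u)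
  have "norm (u x * k x) \<le> norm (C * (u x / (1 + x\<^sup>2)))" for x
  proof -
    have "\<bar>u x\<bar> * \<bar>k x\<bar> \<le> \<bar>u x\<bar> * (C / (1 + x\<^sup>2))" using assms(2) by (rule mult_left_mono) simp
    also have "\<dots> \<le> \<bar>C\<bar> * (\<bar>u x\<bar> / (1 + x\<^sup>2))"
      using mult_right_mono[OF abs_ge_self[of C], of "\<bar>u x\<bar> / (1 + x\<^sup>2)"] by (simp add: mult.commute)
    finally show ?thesis by (simp add: abs_mult)
  qed
  then show "AE x in lborel. norm (u x * k x) \<le> norm (C * (u x / (1 + x\<^sup>2)))" by (rule AE_I2)
qed simp

text \<open>The test function is approximated by its cutoffs at scale \<open>n\<close>. Since
  \<open>u\<close> is only integrable against \<open>1 / (1 + x^2)\<close>, the limit needs the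
  half-Laplacians of the cutoffs bounded by \<open>320 * B / (1 + x^2)\<close> with \<open>B\<close>
  independent of \<open>n\<close>.\<close>

lemma weak_inverse_square:
  assumes t: "t > 0"
  shows "(LINT x|lborel. u x * ((t\<^sup>2 - x\<^sup>2) / (t * (t\<^sup>2 + x\<^sup>2)\<^sup>2))) = (LINT x|lborel. f x * inverse (t\<^sup>2 + x\<^sup>2))"
proof -
  define p where "p x = inverse (t\<^sup>2 + x\<^sup>2)" for x :: real
  define \<phi> where "\<phi> n x = cutoff (x * (1 / real (Suc n))) * p x" for n x
  obtain B where B: "\<And>n. decay_C2 B (\<phi> n)" "decay_C2 B p"
    using cutoff_inverse_square_decay[OF t] unfolding \<phi>_def[abs_def] p_def[abs_def] by blast
  have bd: "\<bar>\<phi> n x\<bar> \<le> B / (1 + x\<^sup>2)" "\<bar>p x\<bar> \<le> B / (1 + x\<^sup>2)" for n x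
    using B unfolding decay_C2_def by blast+
  have B0: "B \<ge> 0" using bd(2)[of 0] by simp
  have [measurable]: "p \<in> borel_measurable borel" unfolding p_def by measurable
  have m\<phi> [measurable]: "\<phi> n \<in> borel_measurable borel" for n
    by (rule borel_measurable_continuous_onI[OF decay_C2_continuous[OF B(1)]])
  have mfl: "frac_lap \<psi> \<in> borel_measurable borel" if [measurable]: "\<psi> \<in> borel_measurable borel" for \<psi>
    unfolding frac_lap_def[abs_def] second_diff_def by measurable
  have tf: "test_function (\<phi> n)" for n
  proof (rule smooth_alg_test_function[of _ "real (Suc n)"])
    show "smooth_alg (\<phi> n)" unfolding \<phi>_def p_def
      using t by (intro smooth_alg_mult smooth_alg_cutoff smooth_alg_inverse) simp
    fix x assume "real (Suc n) \<le> \<bar>x\<bar>"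
    then have "1 \<le> \<bar>x * (1 / real (Suc n))\<bar>" by (simp add: abs_mult)
    then show "\<phi> n x = 0" unfolding \<phi>_def by (simp only: cutoff_eq_0)
  qed
  have lim: "(\<lambda>n. \<phi> n x) \<longlonglongrightarrow> p x" for x
  proof -
    have "isCont cutoff 0" using test_function_DERIV[OF test_function_cutoff] DERIV_isCont by blast
    moreover have "(\<lambda>n. x * (1 / real (Suc n))) \<longlonglongrightarrow> 0"
      using tendsto_mult_left[OF LIMSEQ_inverse_real_of_nat, of x] by (simp add: divide_inverse)
    ultimately have "(\<lambda>n. cutoff (x * (1 / real (Suc n)))) \<longlonglongrightarrow> cutoff 0" by (rule isCont_tendsto_compose)
    then have "(\<lambda>n. cutoff (x * (1 / real (Suc n))) * p x) \<longlonglongrightarrow> cutoff 0 * p x" by (intro tendsto_intros)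
    then show ?thesis unfolding \<phi>_def cutoff_0 by simp
  qed
  \<comment> \<open>Pointwise convergence of the half-Laplacians is itself a dominated convergence,
    in \<open>s\<close>, with \<open>second_diff_bound B x\<close> as the common majorant.\<close>
  have limfl: "(\<lambda>n. frac_lap (\<phi> n) x) \<longlonglongrightarrow> frac_lap p x" for x
    unfolding frac_lap_def
  proof (intro tendsto_divide tendsto_const)
    show "(\<lambda>n. LINT s|lborel. second_diff (\<phi> n) x s / s\<^sup>2) \<longlonglongrightarrow> (LINT s|lborel. second_diff p x s / s\<^sup>2)"
    proof (rule integral_dominated_convergence[OF _ _ second_diff_bound_integrable[OF B0, of x]])
      show "AE s in lborel. (\<lambda>n. second_diff (\<phi> n) x s / s\<^sup>2) \<longlonglongrightarrow> second_diff p x s / s\<^sup>2"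
        unfolding second_diff_def divide_inverse by (intro AE_I2 tendsto_intros lim)
      show "AE s in lborel. norm (second_diff (\<phi> n) x s / s\<^sup>2) \<le> second_diff_bound B x s" for n
        using second_diff_decay[OF B(1), of n x] by (intro AE_I2) simp
    qed simp_all
  qed simp
  have "(\<lambda>n. LINT x|lborel. u x * frac_lap (\<phi> n) x) \<longlonglongrightarrow> (LINT x|lborel. u x * frac_lap p x)"
  proof (rule integral_dominated_convergence)
    show "integrable lborel (\<lambda>x. \<bar>u x * (320 * B / (1 + x\<^sup>2))\<bar>)"
      by (rule integrable_abs, rule integrable_u_decay[where C = "320 * B"]) (use B0 in simp_all)
    show "AE x in lborel. (\<lambda>n. u x * frac_lap (\<phi> n) x) \<longlonglongrightarrow> u x * frac_lap p x"
      by (intro AE_I2 tendsto_intros limfl)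
    have "norm (u x * frac_lap (\<phi> n) x) \<le> \<bar>u x * (320 * B / (1 + x\<^sup>2))\<bar>" for n x
    proof -
      have "\<bar>u x\<bar> * \<bar>frac_lap (\<phi> n) x\<bar> \<le> \<bar>u x\<bar> * (320 * B / (1 + x\<^sup>2))"
        using frac_lap_bound[OF B(1)] by (rule mult_left_mono) simp
      then show ?thesis using B0 by (simp add: abs_mult)
    qed
    then show "AE x in lborel. norm (u x * frac_lap (\<phi> n) x) \<le> \<bar>u x * (320 * B / (1 + x\<^sup>2))\<bar>" for n by (intro AE_I2)
  qed (use mfl[of p] mfl[OF m\<phi>] in simp_all)
  moreover have "(\<lambda>n. LINT x|lborel. f x * \<phi> n x) \<longlonglongrightarrow> (LINT x|lborel. f x * p x)"
  proof (rule integral_dominated_convergence)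
    show "integrable lborel (\<lambda>x. \<bar>f x * B\<bar>)" using integrable_f by simp
    show "AE x in lborel. (\<lambda>n. f x * \<phi> n x) \<longlonglongrightarrow> f x * p x"
      by (intro AE_I2 tendsto_intros lim)
    have "norm (f x * \<phi> n x) \<le> \<bar>f x * B\<bar>" for n x
    proof -
      have "B / (1 + x\<^sup>2) \<le> B / 1" by (rule divide_left_mono[OF _ B0]) (use one_plus_square_pos[of x] in simp_all)
      then have "\<bar>f x\<bar> * \<bar>\<phi> n x\<bar> \<le> \<bar>f x\<bar> * B" using bd(1)[of n x] by (intro mult_left_mono) simp_all
      then show ?thesis using B0 by (simp add: abs_mult)
    qed
    then show "AE x in lborel. norm (f x * \<phi> n x) \<le> \<bar>f x * B\<bar>" for n by (intro AE_I2)
  qed simp_all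
  ultimately have "(LINT x|lborel. u x * frac_lap p x) = (LINT x|lborel. f x * p x)"
    unfolding weak[OF tf] by (rule LIMSEQ_unique)
  moreover have "frac_lap p x = (t\<^sup>2 - x\<^sup>2) / (t * (t\<^sup>2 + x\<^sup>2)\<^sup>2)" for x
    unfolding p_def[abs_def] by (rule frac_lap_inverse_square[OF t])
  ultimately show ?thesis unfolding p_def by simp
qed

end

text \<open>Translation invariance, so that the Poisson formulas have to be proved at the origin
  only. The weight survives because \<open>1 + x^2\<close> and \<open>1 + (x - c)^2\<close> are
  comparable.\<close>

lemma weak_half_laplace_shift:
  assumes "weak_half_laplace u f"
  shows "weak_half_laplace (\<lambda>x. u (x + c)) (\<lambda>x. f (x + c))"
proof -
  interpret weak_half_laplace u f by (rule assms)
  show ?thesis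
  proof
    show "continuous_on UNIV (\<lambda>x. u (x + c))" "continuous_on UNIV (\<lambda>x. f (x + c))"
      by (auto intro!: continuous_on_compose2[OF cont_u] continuous_on_compose2[OF cont_f] continuous_intros)
    show "integrable lborel (\<lambda>x. f (x + c))"
      using lborel_integrable_real_affine[OF integrable_f, of 1 c] by (simp add: add.commute)
    have "integrable lborel (\<lambda>x. u x * (1 / (1 + (x - c)\<^sup>2)))"
      using inverse_square_shift_le by (intro integrable_u_decay) simp_all
    from lborel_integrable_real_affine[OF this, of 1 c]
    show "integrable lborel (\<lambda>x. u (x + c) / (1 + x\<^sup>2))" by (simp add: add.commute)
    fix \<phi> assume tf: "test_function \<phi>"
    have "(LINT x|lborel. u (x + c) * frac_lap \<phi> x) = (LINT x|lborel. u x * frac_lap \<phi> (x + - c))"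
      by (subst (2) lborel_integral_real_affine[of 1 _ c]) (simp_all add: add.commute)
    also have "\<dots> = (LINT x|lborel. u x * frac_lap (\<lambda>x. \<phi> (x + - c)) x)"
      by (simp only: frac_lap_shift)
    also have "\<dots> = (LINT x|lborel. f x * \<phi> (x + - c))"
      by (rule weak[OF test_function_shift[OF tf]])
    also have "\<dots> = (LINT x|lborel. f (x + c) * \<phi> x)"
      by (subst lborel_integral_real_affine[of 1 _ c]) (simp_all add: add.commute)
    finally show "(LINT x|lborel. u (x + c) * frac_lap \<phi> x) = (LINT x|lborel. f (x + c) * \<phi> x)" .
  qed
qed

section \<open>Integrable majorants for logarithmic singularities\<close>

lemma integral_inverse_sqrt:
  fixes r :: real
  assumes r: "r \<ge> 0"
  shows integrable_inverse_sqrt: "integrable lborel (\<lambda>x. indicator {- r..r} x / sqrt \<bar>x\<bar>)"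
    and LINT_inverse_sqrt: "(LINT x|lborel. indicator {- r..r} x / sqrt \<bar>x\<bar>) = 4 * sqrt r"
proof -
  let ?f = "\<lambda>x::real. indicator {0..r} x / sqrt \<bar>x\<bar>"
  have D: "((\<lambda>x. 2 * sqrt x) has_vector_derivative 1 / sqrt x) (at x)" if "x \<in> {0<..<r}" for x
    using DERIV_cmult[OF DERIV_real_sqrt, of x 2] that
    unfolding has_real_derivative_iff_has_vector_derivative by (simp add: inverse_eq_divide)
  have "((\<lambda>x. 1 / sqrt x) has_integral 2 * sqrt r - 2 * sqrt 0) {0..r}"
    by (rule fundamental_theorem_of_calculus_interior[OF r _ D]) (intro continuous_intros)
  moreover have "((\<lambda>x. 1 / sqrt x) has_integral 2 * sqrt r) {0..r} \<longleftrightarrow> (?f has_integral 2 * sqrt r) {0..r}"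
    by (rule has_integral_cong) simp
  ultimately have "(?f has_integral 2 * sqrt r) {0..r}" by simp
  then have "(?f has_integral 2 * sqrt r) UNIV"
    by (rule has_integral_on_superset) auto
  then have nn: "integral\<^sup>N lborel ?f = ennreal (2 * sqrt r)"
    by (intro nn_integral_has_integral_lborel) auto
  have hb: "has_bochner_integral lborel ?f (2 * sqrt r)"
    by (rule has_bochner_integral_nn_integral[OF _ _ _ nn]) (use r in auto)
  have e1: "indicator {0..} x * (indicator {- r..r} x / sqrt \<bar>x\<bar>) = ?f x" for x :: real
    using r by (auto simp: indicator_def)
  show i: "integrable lborel (\<lambda>x. indicator {- r..r} x / sqrt \<bar>x\<bar>)"
    by (rule integrable_even_iff, simp, simp add: indicator_def minus_le_iff conj_commute, unfold e1)
      (use hb in \<open>simp add: has_bochner_integral_iff\<close>)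
  have "(LINT x|lborel. indicator {- r..r} x / sqrt \<bar>x\<bar>) = (LINT x|lborel. 2 * ?f x)"
    unfolding integral_split_at_zero[OF i]
    by (rule Bochner_Integration.integral_cong[OF refl]) (use r in \<open>auto simp: indicator_def\<close>)
  also have "\<dots> = 2 * (LINT x|lborel. ?f x)" by (rule integral_mult_right_zero)
  also have "\<dots> = 4 * sqrt r" using hb by (simp add: has_bochner_integral_iff)
  finally show "(LINT x|lborel. indicator {- r..r} x / sqrt \<bar>x\<bar>) = 4 * sqrt r" .
qed

text \<open>The fourth root is chosen so that both uses end at the integrable singularity
  \<open>1 / sqrt |x|\<close>: a logarithm of \<open>1 / x^2\<close> to the first power, and a
  squared logarithm of \<open>1 / |x|\<close>.\<close>

lemma ln_le_sqrt_sqrt: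
  fixes y :: real
  assumes "y > 0"
  shows "ln y \<le> 4 * sqrt (sqrt y)"
proof -
  have "ln y = 4 * ln (sqrt (sqrt y))" using assms by (simp add: ln_sqrt)
  also have "\<dots> \<le> 4 * sqrt (sqrt y)" using less_imp_le[OF ln_less_self[of "sqrt (sqrt y)"]] assms by simp
  finally show ?thesis .
qed

text \<open>Twice the integral of \<open>t / (t^2 + x^2)\<close> over \<open>0 < t < b\<close>. At
  \<open>x = 0\<close> division by zero gives \<open>ln 0 = 0\<close>, which keeps the function
  nonnegative everywhere.\<close>

definition log_kernel :: "real \<Rightarrow> real \<Rightarrow> real"
  where "log_kernel b x = ln ((b\<^sup>2 + x\<^sup>2) / x\<^sup>2)"

lemma log_kernel_measurable [measurable]: "log_kernel b \<in> borel_measurable borel"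
  unfolding log_kernel_def by measurable

lemma log_kernel_nonneg: "log_kernel b x \<ge> 0"
proof (cases "x = 0")
  case False
  then have "1 \<le> (b\<^sup>2 + x\<^sup>2) / x\<^sup>2" by simp
  then show ?thesis unfolding log_kernel_def by (rule ln_ge_zero)
qed (simp add: log_kernel_def)

lemma log_kernel_le: "log_kernel b x \<le> (b\<^sup>2 + 4 * (1 + b\<^sup>2)) * (1 + indicator {- 1..1} x / sqrt \<bar>x\<bar>)"
proof (cases "\<bar>x\<bar> \<le> 1")
  case False
  then have x: "1 \<le> x\<^sup>2" by (simp add: abs_square_le_1 linorder_not_le less_imp_le) (metis abs_square_less_1 not_less less_imp_le)
  have "x \<noteq> 0" using False by auto
  then have "log_kernel b x = ln (1 + b\<^sup>2 / x\<^sup>2)" by (simp add: log_kernel_def add_divide_distrib add.commute)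
  also have "\<dots> \<le> b\<^sup>2 / x\<^sup>2" by (rule ln_add_one_self_le_self) simp
  also have "\<dots> \<le> b\<^sup>2 / 1" using x \<open>x \<noteq> 0\<close> by (intro divide_left_mono) simp_all
  also have "\<dots> \<le> (b\<^sup>2 + 4 * (1 + b\<^sup>2)) * 1" by simp
  also have "\<dots> \<le> (b\<^sup>2 + 4 * (1 + b\<^sup>2)) * (1 + indicator {- 1..1} x / sqrt \<bar>x\<bar>)"
    by (rule mult_left_mono) simp_all
  finally show ?thesis .
next
  case True
  show ?thesis
  proof (cases "x = 0")
    case False
    have "(b\<^sup>2 + x\<^sup>2) / x\<^sup>2 \<le> (1 + b\<^sup>2) / x\<^sup>2"
      using True by (intro divide_right_mono) (simp_all add: abs_square_le_1)
    then have "sqrt (sqrt ((b\<^sup>2 + x\<^sup>2) / x\<^sup>2)) \<le> sqrt (sqrt ((1 + b\<^sup>2) / x\<^sup>2))" by simp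
    also have "\<dots> = sqrt (sqrt (1 + b\<^sup>2)) / sqrt \<bar>x\<bar>" by (simp add: real_sqrt_divide)
    also have "\<dots> \<le> (1 + b\<^sup>2) / sqrt \<bar>x\<bar>"
    proof (rule divide_right_mono)
      have "(1 + b\<^sup>2) * 1 \<le> (1 + b\<^sup>2) * (1 + b\<^sup>2)" by (intro mult_left_mono) simp_all
      then have "sqrt (1 + b\<^sup>2) \<le> 1 + b\<^sup>2" by (intro real_le_lsqrt) (simp_all add: power2_eq_square[of "1 + b\<^sup>2"])
      moreover have "sqrt (sqrt (1 + b\<^sup>2)) \<le> sqrt (1 + b\<^sup>2)"
      proof -
        have "sqrt (1 + b\<^sup>2) \<le> 1 + b\<^sup>2" by fact
        then show ?thesis by simp
      qed
      ultimately show "sqrt (sqrt (1 + b\<^sup>2)) \<le> 1 + b\<^sup>2" by linarith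
    qed simp
    finally have 1: "sqrt (sqrt ((b\<^sup>2 + x\<^sup>2) / x\<^sup>2)) \<le> (1 + b\<^sup>2) / sqrt \<bar>x\<bar>" .
    have "log_kernel b x \<le> 4 * sqrt (sqrt ((b\<^sup>2 + x\<^sup>2) / x\<^sup>2))"
      unfolding log_kernel_def using False by (intro ln_le_sqrt_sqrt divide_pos_pos add_nonneg_pos) simp_all
    also have "\<dots> \<le> 4 * ((1 + b\<^sup>2) / sqrt \<bar>x\<bar>)" using 1 by (rule mult_left_mono) simp
    also have "\<dots> = 4 * (1 + b\<^sup>2) * (1 / sqrt \<bar>x\<bar>)" by (simp only: times_divide_eq_right mult_1_right)
    also have "\<dots> \<le> (b\<^sup>2 + 4 * (1 + b\<^sup>2)) * (1 + 1 / sqrt \<bar>x\<bar>)" by (intro mult_mono) simp_all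
    finally show ?thesis using True by (simp add: abs_le_iff)
  qed (simp add: log_kernel_def)
qed

text \<open>Near \<open>z\<close> the function \<open>f\<close> is bounded and the singularity
  integrable; elsewhere the weight is 1 and \<open>f\<close> itself is integrable.\<close>

lemma integrable_log_singular:
  fixes f :: "real \<Rightarrow> real"
  assumes f: "continuous_on UNIV f" "integrable lborel f"
  shows "integrable lborel (\<lambda>x. f x * (1 + indicator {- 1..1} (x - z) / sqrt \<bar>x - z\<bar>))"
proof -
  have [measurable]: "f \<in> borel_measurable borel" using f(2) by auto
  have "compact (f ` {z - 1..z + 1})" by (rule compact_continuous_image[OF continuous_on_subset[OF f(1) subset_UNIV] compact_Icc])
  from this[THEN compact_imp_bounded, unfolded bounded_iff]
  obtain M where M: "\<forall>y \<in> f ` {z - 1..z + 1}. norm y \<le> M" by (elim exE) (rule that)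
  have s: "integrable lborel (\<lambda>x::real. M * (indicator {- 1..1} (x - z) / sqrt \<bar>x - z\<bar>))"
    using lborel_integrable_real_affine[OF integrable_inverse_sqrt[of 1], of 1 "- z"]
    by (intro integrable_mult_right) (simp add: add.commute)
  have "integrable lborel (\<lambda>x. f x * (indicator {- 1..1} (x - z) / sqrt \<bar>x - z\<bar>))"
  proof (rule Bochner_Integration.integrable_bound[OF s])
    have "norm (f x * (indicator {- 1..1} (x - z) / sqrt \<bar>x - z\<bar>)) \<le> norm (M * (indicator {- 1..1} (x - z) / sqrt \<bar>x - z\<bar>))" for x
    proof (cases "x \<in> {z - 1..z + 1}")
      case True
      then have "\<bar>f x\<bar> \<le> M" using M by auto
      then have "\<bar>f x\<bar> * (indicator {- 1..1} (x - z) / sqrt \<bar>x - z\<bar>) \<le> \<bar>M\<bar> * (indicator {- 1..1} (x - z) / sqrt \<bar>x - z\<bar>)"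
        by (intro mult_right_mono) simp_all
      then show ?thesis by (simp add: abs_mult)
    next
      case False
      then have "x - z \<notin> {- 1..1}" by auto
      then show ?thesis by simp
    qed
    then show "AE x in lborel. norm (f x * (indicator {- 1..1} (x - z) / sqrt \<bar>x - z\<bar>)) \<le> norm (M * (indicator {- 1..1} (x - z) / sqrt \<bar>x - z\<bar>))"
      by (rule AE_I2)
  qed measurable
  from Bochner_Integration.integrable_add[OF f(2) this] show ?thesis by (simp add: distrib_left)
qed

lemma integrable_log_kernel:
  fixes f :: "real \<Rightarrow> real"
  assumes f: "continuous_on UNIV f" "integrable lborel f"
  shows "integrable lborel (\<lambda>x. f x * log_kernel b (x - z))"
proof -
  define c where "c = b\<^sup>2 + 4 * (1 + b\<^sup>2)"
  have c: "c \<ge> 0" by (simp add: c_def)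
  have [measurable]: "f \<in> borel_measurable borel" using f(2) by auto
  show ?thesis
  proof (rule Bochner_Integration.integrable_bound)
    show "integrable lborel (\<lambda>x. c * (f x * (1 + indicator {- 1..1} (x - z) / sqrt \<bar>x - z\<bar>)))"
      by (intro integrable_mult_right integrable_log_singular f)
    have "norm (f x * log_kernel b (x - z)) \<le> norm (c * (f x * (1 + indicator {- 1..1} (x - z) / sqrt \<bar>x - z\<bar>)))" for x
    proof -
      have "\<bar>f x\<bar> * log_kernel b (x - z) \<le> \<bar>f x\<bar> * (c * (1 + indicator {- 1..1} (x - z) / sqrt \<bar>x - z\<bar>))"
        unfolding c_def by (intro mult_left_mono log_kernel_le) simp
      moreover have "0 \<le> 1 + indicator {- 1..1} (x - z) / sqrt \<bar>x - z\<bar>" by simp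
      ultimately show ?thesis using c log_kernel_nonneg[of b "x - z"] by (simp add: abs_mult mult_ac)
    qed
    then show "AE x in lborel. norm (f x * log_kernel b (x - z)) \<le> norm (c * (f x * (1 + indicator {- 1..1} (x - z) / sqrt \<bar>x - z\<bar>)))"
      by (rule AE_I2)
  qed simp
qed

text \<open>After multiplication by \<open>t\<close>, both sides of
  \<open>weak_inverse_square\<close> have elementary primitives in \<open>t\<close>: one is a
  multiple of the Poisson kernel, the other a logarithm.\<close>

lemma integral_poisson_derivative:
  fixes a b x :: real
  assumes a: "0 < a" "a \<le> b"
  shows "(LINT t|lborel. indicator {a..b} t *\<^sub>R ((t\<^sup>2 - x\<^sup>2) / (t\<^sup>2 + x\<^sup>2)\<^sup>2)) = a / (a\<^sup>2 + x\<^sup>2) - b / (b\<^sup>2 + x\<^sup>2)"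
    and "(LINT t|lborel. indicator {a..b} t *\<^sub>R (t / (t\<^sup>2 + x\<^sup>2))) = ln (b\<^sup>2 + x\<^sup>2) / 2 - ln (a\<^sup>2 + x\<^sup>2) / 2"
proof -
  have nz: "t\<^sup>2 + x\<^sup>2 > 0" if "a \<le> t" for t using that a by (intro add_pos_nonneg) simp_all
  have D1: "((\<lambda>t. - t / (t\<^sup>2 + x\<^sup>2)) has_real_derivative (t\<^sup>2 - x\<^sup>2) / (t\<^sup>2 + x\<^sup>2)\<^sup>2) (at t)" if "a \<le> t" for t
  proof -
    have "((\<lambda>t. - t / (t\<^sup>2 + x\<^sup>2)) has_real_derivative
        ((- 1) * (t\<^sup>2 + x\<^sup>2) - (- t) * (2 * t)) / ((t\<^sup>2 + x\<^sup>2) * (t\<^sup>2 + x\<^sup>2))) (at t)"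
      by (rule DERIV_divide) (use nz[OF that] in \<open>auto intro!: derivative_eq_intros\<close>)
    moreover have "(- 1) * (t\<^sup>2 + x\<^sup>2) - (- t) * (2 * t) = t\<^sup>2 - x\<^sup>2" by (simp add: power2_eq_square)
    ultimately show ?thesis unfolding power2_eq_square[of "t\<^sup>2 + x\<^sup>2"] by (simp only:)
  qed
  have "(LINT t|lborel. indicator {a..b} t *\<^sub>R ((t\<^sup>2 - x\<^sup>2) / (t\<^sup>2 + x\<^sup>2)\<^sup>2)) = - b / (b\<^sup>2 + x\<^sup>2) - - a / (a\<^sup>2 + x\<^sup>2)"
  proof (rule integral_FTC_atLeastAtMost[OF a(2)])
    show "continuous_on {a..b} (\<lambda>t. (t\<^sup>2 - x\<^sup>2) / (t\<^sup>2 + x\<^sup>2)\<^sup>2)"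
      by (intro continuous_intros ballI) (use nz in force)
    show "((\<lambda>t. - t / (t\<^sup>2 + x\<^sup>2)) has_vector_derivative (t\<^sup>2 - x\<^sup>2) / (t\<^sup>2 + x\<^sup>2)\<^sup>2) (at t within {a..b})" if "a \<le> t" "t \<le> b" for t
      using D1[OF that(1)] unfolding has_real_derivative_iff_has_vector_derivative
      by (rule has_vector_derivative_at_within)
  qed
  then show "(LINT t|lborel. indicator {a..b} t *\<^sub>R ((t\<^sup>2 - x\<^sup>2) / (t\<^sup>2 + x\<^sup>2)\<^sup>2)) = a / (a\<^sup>2 + x\<^sup>2) - b / (b\<^sup>2 + x\<^sup>2)"
    by simp
  have D2: "((\<lambda>t. ln (t\<^sup>2 + x\<^sup>2) / 2) has_real_derivative t / (t\<^sup>2 + x\<^sup>2)) (at t)" if "a \<le> t" for t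
  proof -
    have "((\<lambda>t. ln (t\<^sup>2 + x\<^sup>2)) has_real_derivative 2 * t / (t\<^sup>2 + x\<^sup>2)) (at t)"
      by (rule derivative_eq_intros refl nz[OF that])+ simp
    moreover have "2 * t / c / 2 = t / c" for c by simp
    ultimately show ?thesis using DERIV_cdivide[where c = 2] by metis
  qed
  show "(LINT t|lborel. indicator {a..b} t *\<^sub>R (t / (t\<^sup>2 + x\<^sup>2))) = ln (b\<^sup>2 + x\<^sup>2) / 2 - ln (a\<^sup>2 + x\<^sup>2) / 2"
  proof (rule integral_FTC_atLeastAtMost[OF a(2)])
    show "continuous_on {a..b} (\<lambda>t. t / (t\<^sup>2 + x\<^sup>2))"
      by (intro continuous_intros ballI) (use nz in force)
    show "((\<lambda>t. ln (t\<^sup>2 + x\<^sup>2) / 2) has_vector_derivative t / (t\<^sup>2 + x\<^sup>2)) (at t within {a..b})" if "a \<le> t" "t \<le> b" for t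
      using D2[OF that(1)] unfolding has_real_derivative_iff_has_vector_derivative
      by (rule has_vector_derivative_at_within)
  qed
qed

section \<open>Poisson averages and the two-point logarithmic formula\<close>

context weak_half_laplace begin

text \<open>The tested equation is multiplied by \<open>t\<close> and integrated over
  \<open>a \<le> t \<le> b\<close>; Fubini is legitimate because \<open>a > 0\<close> keeps the
  kernels away from their singularity.\<close>

lemma weak_interval:
  assumes a: "0 < a" "a \<le> b"
  shows "(LINT x|lborel. u x * (a / (a\<^sup>2 + x\<^sup>2) - b / (b\<^sup>2 + x\<^sup>2))) =
    (LINT x|lborel. f x * (ln (b\<^sup>2 + x\<^sup>2) / 2 - ln (a\<^sup>2 + x\<^sup>2) / 2))"
proof -
  define G where "G x t = indicator {a..b} t *\<^sub>R (u x * ((t\<^sup>2 - x\<^sup>2) / (t\<^sup>2 + x\<^sup>2)\<^sup>2))" for x t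
  define H where "H x t = indicator {a..b} t *\<^sub>R (f x * (t / (t\<^sup>2 + x\<^sup>2)))" for x t
  have ii: "integrable lborel (indicator {a..b} :: real \<Rightarrow> real)"
    by (rule integrable_real_indicator) (simp_all add: emeasure_lborel_Icc_eq)
  have kb: "\<bar>(t\<^sup>2 - x\<^sup>2) / (t\<^sup>2 + x\<^sup>2)\<^sup>2\<bar> \<le> (1 + 1 / a\<^sup>2) / (1 + x\<^sup>2)" if "a \<le> t" for t x
  proof -
    have "\<bar>abel_kernel t x\<bar> \<le> 1 / (t\<^sup>2 + x\<^sup>2)" using that a by (intro abel_kernel_abs_le) simp
    also have "\<dots> \<le> 1 / (a\<^sup>2 + x\<^sup>2)"
      using that a by (intro divide_left_mono mult_pos_pos add_pos_nonneg add_right_mono power_mono) simp_all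
    also have "\<dots> \<le> (1 + 1 / a\<^sup>2) / (1 + x\<^sup>2)" using inverse_square_decay[OF a(1), of x] by (simp add: inverse_eq_divide)
    finally show ?thesis unfolding abel_kernel_def abs_divide by (simp add: abs_minus_commute)
  qed
  have iG: "integrable (lborel \<Otimes>\<^sub>M lborel) (case_prod G)"
  proof (rule integrable_pair_bound[OF _ _ ii])
    show "integrable lborel (\<lambda>x. \<bar>u x * ((1 + 1 / a\<^sup>2) / (1 + x\<^sup>2))\<bar>)"
      by (rule integrable_abs, rule integrable_u_decay[where C = "1 + 1 / a\<^sup>2"]) simp_all
    fix x t
    show "norm (case (x, t) of (x, t) \<Rightarrow> G x t) \<le> \<bar>u x * ((1 + 1 / a\<^sup>2) / (1 + x\<^sup>2))\<bar> * indicator {a..b} t"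
    proof (cases "t \<in> {a..b}")
      case True
      then have "\<bar>u x\<bar> * \<bar>(t\<^sup>2 - x\<^sup>2) / (t\<^sup>2 + x\<^sup>2)\<^sup>2\<bar> \<le> \<bar>u x\<bar> * ((1 + 1 / a\<^sup>2) / (1 + x\<^sup>2))"
        by (intro mult_left_mono kb) simp_all
      moreover have "0 \<le> (1 + 1 / a\<^sup>2) / (1 + x\<^sup>2)" by (intro divide_nonneg_pos one_plus_square_pos) simp
      ultimately show ?thesis using True by (simp only: G_def prod.case indicator_simps scaleR_one real_norm_def abs_mult[of "u x"] abs_of_nonneg mult_1_right)
    qed (simp add: G_def)
  qed (unfold G_def, measurable)
  have iH: "integrable (lborel \<Otimes>\<^sub>M lborel) (case_prod H)"
  proof (rule integrable_pair_bound[OF _ _ ii])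
    show "integrable lborel (\<lambda>x. \<bar>f x * (1 / a)\<bar>)" using integrable_f by simp
    fix x t
    show "norm (case (x, t) of (x, t) \<Rightarrow> H x t) \<le> \<bar>f x * (1 / a)\<bar> * indicator {a..b} t"
    proof (cases "t \<in> {a..b}")
      case True
      then have t: "a \<le> t" "0 < t" using a by auto
      have "t / (t\<^sup>2 + x\<^sup>2) \<le> t / t\<^sup>2" using t by (intro divide_left_mono mult_pos_pos add_pos_nonneg) simp_all
      also have "\<dots> = 1 / t" using t by (simp add: power2_eq_square)
      also have "\<dots> \<le> 1 / a" using t a by (intro divide_left_mono) simp_all
      finally have "\<bar>f x\<bar> * (t / (t\<^sup>2 + x\<^sup>2)) \<le> \<bar>f x\<bar> * (1 / a)" by (rule mult_left_mono) simp
      moreover have "0 \<le> t / (t\<^sup>2 + x\<^sup>2)" "0 \<le> 1 / a" using t a by simp_all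
      ultimately show ?thesis using True by (simp only: H_def prod.case indicator_simps scaleR_one real_norm_def abs_mult[of "f x"] abs_of_nonneg mult_1_right)
    qed (simp add: H_def)
  qed (unfold H_def, measurable)
  have GH: "(LINT x|lborel. G x t) = (LINT x|lborel. H x t)" for t
  proof (cases "t \<in> {a..b}")
    case True
    then have t: "0 < t" using a by simp
    have "(LINT x|lborel. G x t) = (LINT x|lborel. t * (u x * ((t\<^sup>2 - x\<^sup>2) / (t * (t\<^sup>2 + x\<^sup>2)\<^sup>2))))"
      using True t by (simp add: G_def)
    also have "\<dots> = t * (LINT x|lborel. u x * ((t\<^sup>2 - x\<^sup>2) / (t * (t\<^sup>2 + x\<^sup>2)\<^sup>2)))" by (rule integral_mult_right_zero)
    also have "\<dots> = t * (LINT x|lborel. f x * inverse (t\<^sup>2 + x\<^sup>2))" by (simp only: weak_inverse_square[OF t])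
    also have "\<dots> = (LINT x|lborel. t * (f x * inverse (t\<^sup>2 + x\<^sup>2)))" by (rule integral_mult_right_zero[symmetric])
    also have "\<dots> = (LINT x|lborel. H x t)" using True by (simp add: H_def divide_inverse mult_ac)
    finally show ?thesis .
  qed (simp add: G_def H_def)
  have "(LINT x|lborel. LINT t|lborel. G x t) = (LINT t|lborel. LINT x|lborel. G x t)"
    by (rule lborel_pair.Fubini_integral[OF iG, symmetric])
  also have "\<dots> = (LINT t|lborel. LINT x|lborel. H x t)" unfolding GH ..
  also have "\<dots> = (LINT x|lborel. LINT t|lborel. H x t)"
    by (rule lborel_pair.Fubini_integral[OF iH])
  finally have eq: "(LINT x|lborel. LINT t|lborel. G x t) = (LINT x|lborel. LINT t|lborel. H x t)" .
  have "(LINT t|lborel. G x t) = u x * (a / (a\<^sup>2 + x\<^sup>2) - b / (b\<^sup>2 + x\<^sup>2))" for x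
  proof -
    have "(LINT t|lborel. G x t) = (LINT t|lborel. u x * (indicator {a..b} t *\<^sub>R ((t\<^sup>2 - x\<^sup>2) / (t\<^sup>2 + x\<^sup>2)\<^sup>2)))"
      unfolding G_def by (rule Bochner_Integration.integral_cong[OF refl]) simp
    also have "\<dots> = u x * (LINT t|lborel. indicator {a..b} t *\<^sub>R ((t\<^sup>2 - x\<^sup>2) / (t\<^sup>2 + x\<^sup>2)\<^sup>2))" by (rule integral_mult_right_zero)
    finally show ?thesis unfolding integral_poisson_derivative(1)[OF a] .
  qed
  moreover have "(LINT t|lborel. H x t) = f x * (ln (b\<^sup>2 + x\<^sup>2) / 2 - ln (a\<^sup>2 + x\<^sup>2) / 2)" for x
  proof -
    have "(LINT t|lborel. H x t) = (LINT t|lborel. f x * (indicator {a..b} t *\<^sub>R (t / (t\<^sup>2 + x\<^sup>2))))"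
      unfolding H_def by (rule Bochner_Integration.integral_cong[OF refl]) simp
    also have "\<dots> = f x * (LINT t|lborel. indicator {a..b} t *\<^sub>R (t / (t\<^sup>2 + x\<^sup>2)))" by (rule integral_mult_right_zero)
    finally show ?thesis unfolding integral_poisson_derivative(2)[OF a] .
  qed
  ultimately show ?thesis using eq by simp
qed

lemma poisson_integrable:
  assumes "t > 0"
  shows "integrable lborel (\<lambda>x. u x * (t / (t\<^sup>2 + x\<^sup>2)))"
proof (rule integrable_u_decay)
  fix x
  have "t * inverse (t\<^sup>2 + x\<^sup>2) \<le> t * ((1 + 1 / t\<^sup>2) / (1 + x\<^sup>2))"
    using assms by (intro mult_left_mono inverse_square_decay) simp_all
  then show "\<bar>t / (t\<^sup>2 + x\<^sup>2)\<bar> \<le> (t * (1 + 1 / t\<^sup>2)) / (1 + x\<^sup>2)"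
    using assms by (simp add: divide_inverse abs_mult)
qed simp

text \<open>The kernel has mass \<open>pi\<close> and concentrates at 0. Because \<open>u\<close>
  may be unbounded, the rescaling argument is applied only to \<open>u\<close> on
  \<open>[-1, 1]\<close>; the remainder is dominated by \<open>2 * |u x| / (1 + x^2)\<close> and
  tends to 0 pointwise.\<close>

lemma poisson_tendsto:
  assumes e: "\<And>n::nat. 0 < e n" "\<And>n. e n \<le> 1" "e \<longlonglongrightarrow> 0"
  shows "(\<lambda>n. LINT x|lborel. u x * (e n / ((e n)\<^sup>2 + x\<^sup>2))) \<longlonglongrightarrow> pi * u 0"
proof -
  define v where "v x = indicator {- 1..1} x * u x" for x :: real
  define w where "w x = indicator (- {- 1..1}) x * u x" for x :: real
  have [measurable]: "v \<in> borel_measurable borel" "w \<in> borel_measurable borel"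
    unfolding v_def w_def by measurable
  have "compact (u ` {- 1..1})" by (rule compact_continuous_image[OF continuous_on_subset[OF cont_u subset_UNIV] compact_Icc])
  from this[THEN compact_imp_bounded, unfolded bounded_iff]
  obtain M where M: "\<forall>y \<in> u ` {- 1..1}. norm y \<le> M" by (elim exE) (rule that)
  have M0: "0 \<le> M" using M norm_ge_zero by (metis atLeastAtMost_iff imageI neg_le_0_iff_le order_trans zero_le_one)
  have vM: "\<bar>v x\<bar> \<le> M" for x using M M0 by (cases "x \<in> {- 1..1}") (auto simp: v_def)
  have 1: "(\<lambda>n. LINT x|lborel. v x * (e n / ((e n)\<^sup>2 + x\<^sup>2))) \<longlonglongrightarrow> pi * u 0"
  proof -
    have eq: "(LINT x|lborel. v x * (e n / ((e n)\<^sup>2 + x\<^sup>2))) = (LINT y|lborel. v (e n * y) * (1 / (1 + y\<^sup>2)))" for n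
    proof -
      have en: "e n > 0" by (rule e)
      have "(LINT x|lborel. v x * (e n / ((e n)\<^sup>2 + x\<^sup>2))) =
          \<bar>e n\<bar> *\<^sub>R (LINT y|lborel. v (0 + e n * y) * (e n / ((e n)\<^sup>2 + (0 + e n * y)\<^sup>2)))"
        by (rule lborel_integral_real_affine) (use en in simp)
      also have "\<dots> = (LINT y|lborel. e n * (v (e n * y) * (e n / ((e n)\<^sup>2 + (e n * y)\<^sup>2))))"
        by (simp only: abs_of_pos[OF en] real_scaleR_def add_0 integral_mult_right_zero)
      also have "\<dots> = (LINT y|lborel. v (e n * y) * (1 / (1 + y\<^sup>2)))"
      proof (rule Bochner_Integration.integral_cong[OF refl])
        fix y
        have "(e n)\<^sup>2 + (e n * y)\<^sup>2 = (e n * e n) * (1 + y\<^sup>2)" by (simp add: power2_eq_square algebra_simps)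
        then show "e n * (v (e n * y) * (e n / ((e n)\<^sup>2 + (e n * y)\<^sup>2))) = v (e n * y) * (1 / (1 + y\<^sup>2))"
          using en by simp
      qed
      finally show ?thesis .
    qed
    have "(\<lambda>n. LINT y|lborel. v (e n * y) * (1 / (1 + y\<^sup>2))) \<longlonglongrightarrow> (LINT y|lborel. u 0 * (1 / (1 + y\<^sup>2)))"
    proof (rule integral_dominated_convergence)
      show "integrable lborel (\<lambda>y. M * (1 / (1 + y\<^sup>2)))"
        using integrable_inverse_square_plus[of 1] by (intro integrable_mult_right) simp
      have "norm (v (e n * y) * (1 / (1 + y\<^sup>2))) \<le> M * (1 / (1 + y\<^sup>2))" for n y
        using mult_right_mono[OF vM[of "e n * y"], of "1 / (1 + y\<^sup>2)"] one_plus_square_pos[of y] by (simp add: abs_mult)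
      then show "AE y in lborel. norm (v (e n * y) * (1 / (1 + y\<^sup>2))) \<le> M * (1 / (1 + y\<^sup>2))" for n by (rule AE_I2)
      show "AE y in lborel. (\<lambda>n. v (e n * y) * (1 / (1 + y\<^sup>2))) \<longlonglongrightarrow> u 0 * (1 / (1 + y\<^sup>2))"
      proof (rule AE_I2)
        fix y
        have ey: "(\<lambda>n. e n * y) \<longlonglongrightarrow> 0" using tendsto_mult_right[OF e(3), of y] by simp
        have "isCont u 0" using cont_u continuous_on_eq_continuous_at[OF open_UNIV] by blast
        then have "(\<lambda>n. u (e n * y)) \<longlonglongrightarrow> u 0" using ey by (rule isCont_tendsto_compose)
        moreover have "\<forall>\<^sub>F n in sequentially. u (e n * y) = v (e n * y)"
        proof -
          have "\<forall>\<^sub>F n in sequentially. dist (e n * y) 0 < 1" using ey unfolding tendsto_iff by simp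
          then show ?thesis by eventually_elim (auto simp: v_def indicator_def)
        qed
        ultimately have "(\<lambda>n. v (e n * y)) \<longlonglongrightarrow> u 0" by (rule Lim_transform_eventually)
        then show "(\<lambda>n. v (e n * y) * (1 / (1 + y\<^sup>2))) \<longlonglongrightarrow> u 0 * (1 / (1 + y\<^sup>2))" by (intro tendsto_intros)
      qed
    qed simp_all
    moreover have "(LINT y|lborel. u 0 * (1 / (1 + y\<^sup>2))) = u 0 * (LINT y|lborel. 1 / (1 + y\<^sup>2))" by (rule integral_mult_right_zero)
    moreover have "(LINT y|lborel. 1 / (1 + y\<^sup>2)) = pi" using LINT_inverse_square_plus[of 1] by simp
    ultimately show ?thesis unfolding eq by (simp add: mult.commute)
  qed
  have 2: "(\<lambda>n. LINT x|lborel. w x * (e n / ((e n)\<^sup>2 + x\<^sup>2))) \<longlonglongrightarrow> (LINT x|(lborel::real measure). 0)"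
  proof (rule integral_dominated_convergence)
    show "integrable lborel (\<lambda>x. \<bar>u x * (2 / (1 + x\<^sup>2))\<bar>)"
      by (rule integrable_abs, rule integrable_u_decay[where C = 2]) simp_all
    have "norm (w x * (e n / ((e n)\<^sup>2 + x\<^sup>2))) \<le> \<bar>u x * (2 / (1 + x\<^sup>2))\<bar>" for n x
    proof (cases "x \<in> {- 1..1}")
      case False
      then have "1 < \<bar>x\<bar>" by auto
      then have x: "1 \<le> x\<^sup>2" by (metis abs_1 abs_le_square_iff less_imp_le one_power2)
      have "e n / ((e n)\<^sup>2 + x\<^sup>2) \<le> 1 / x\<^sup>2"
        using e(1,2)[of n] x \<open>1 < \<bar>x\<bar>\<close> by (intro frac_le) auto
      also have "\<dots> \<le> 2 / (1 + x\<^sup>2)"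
      proof -
        have x0: "0 < x\<^sup>2" using x by linarith
        show ?thesis
          unfolding pos_le_divide_eq[OF one_plus_square_pos] times_divide_eq_left mult_1 pos_divide_le_eq[OF x0]
          using x by linarith
      qed
      finally have "\<bar>u x\<bar> * (e n / ((e n)\<^sup>2 + x\<^sup>2)) \<le> \<bar>u x\<bar> * (2 / (1 + x\<^sup>2))" by (rule mult_left_mono) simp
      moreover have "0 \<le> e n / ((e n)\<^sup>2 + x\<^sup>2)" "0 \<le> 2 / (1 + x\<^sup>2)" using e(1)[of n] by (simp_all add: less_imp_le)
      moreover have "w x = u x" using False by (simp add: w_def)
      ultimately show ?thesis by (simp only: real_norm_def abs_mult[of "u x"] abs_of_nonneg)
    qed (simp add: w_def)
    then show "AE x in lborel. norm (w x * (e n / ((e n)\<^sup>2 + x\<^sup>2))) \<le> \<bar>u x * (2 / (1 + x\<^sup>2))\<bar>" for n by (rule AE_I2)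
    show "AE x in lborel. (\<lambda>n. w x * (e n / ((e n)\<^sup>2 + x\<^sup>2))) \<longlonglongrightarrow> 0"
      using AE_lborel_singleton[of "0::real"]
    proof eventually_elim
      case (elim x)
      then have "(\<lambda>n. w x * (e n / ((e n)\<^sup>2 + x\<^sup>2))) \<longlonglongrightarrow> w x * (0 / (0\<^sup>2 + x\<^sup>2))"
        by (intro tendsto_intros e) simp
      then show ?case by simp
    qed
  qed simp_all
  have split: "(LINT x|lborel. u x * (e n / ((e n)\<^sup>2 + x\<^sup>2))) =
      (LINT x|lborel. v x * (e n / ((e n)\<^sup>2 + x\<^sup>2))) + (LINT x|lborel. w x * (e n / ((e n)\<^sup>2 + x\<^sup>2)))" for n
  proof -
    let ?k = "\<lambda>x. e n / ((e n)\<^sup>2 + x\<^sup>2)"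
    have i: "integrable lborel (\<lambda>x. indicator S x *\<^sub>R (u x * ?k x))" if "S \<in> sets lborel" for S
      by (rule integrable_mult_indicator[OF that poisson_integrable[OF e(1)]])
    have "integrable lborel (\<lambda>x. v x * ?k x)" "integrable lborel (\<lambda>x. w x * ?k x)"
      using i[of "{- 1..1}"] i[of "- {- 1..1}"] by (simp_all add: v_def w_def mult.assoc)
    moreover have vw: "u x = v x + w x" for x by (simp add: v_def w_def indicator_def)
    have "(LINT x|lborel. u x * ?k x) = (LINT x|lborel. v x * ?k x + w x * ?k x)"
      by (rule Bochner_Integration.integral_cong[OF refl]) (simp only: vw distrib_right)
    ultimately show ?thesis by (simp only: Bochner_Integration.integral_add)
  qed
  show ?thesis using tendsto_add[OF 1 2] unfolding split by simp
qed

end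

lemma log_kernel_eq: "x \<noteq> 0 \<Longrightarrow> log_kernel b x = ln (b\<^sup>2 + x\<^sup>2) - 2 * ln \<bar>x\<bar>"
proof -
  assume x: "x \<noteq> 0"
  then have "ln (x\<^sup>2) = 2 * ln \<bar>x\<bar>" using ln_realpow[of "\<bar>x\<bar>" 2] by simp
  moreover have "b\<^sup>2 + x\<^sup>2 > 0" using x by (simp add: add_nonneg_pos)
  ultimately show ?thesis unfolding log_kernel_def using x by (simp add: ln_div)
qed

text \<open>The limit of \<open>weak_interval\<close> as \<open>a\<close> tends to 0. The upper end
  \<open>b\<close> stays finite, because \<open>log_kernel b\<close> increases to infinity with
  \<open>b\<close>; only differences of this formula at two points have a limit.\<close>

lemma (in weak_half_laplace) poisson_formula_0:
  assumes b: "b \<ge> 1"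
  shows "pi * u 0 - (LINT x|lborel. u x * (b / (b\<^sup>2 + x\<^sup>2))) = (LINT x|lborel. f x * (log_kernel b x / 2))"
proof -
  define e :: "nat \<Rightarrow> real" where "e n = inverse (real (Suc n))" for n
  have e: "e n > 0" "e n \<le> 1" "e \<longlonglongrightarrow> 0" for n
    using LIMSEQ_inverse_real_of_nat by (simp_all add: e_def[abs_def] inverse_le_1_iff)
  have eqn: "(LINT x|lborel. u x * (e n / ((e n)\<^sup>2 + x\<^sup>2))) - (LINT x|lborel. u x * (b / (b\<^sup>2 + x\<^sup>2))) =
     (LINT x|lborel. f x * (ln (b\<^sup>2 + x\<^sup>2) / 2 - ln ((e n)\<^sup>2 + x\<^sup>2) / 2))" for n
  proof -
    have "e n \<le> b" using e(2)[of n] b by linarith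
    from weak_interval[OF e(1)[of n] this] show ?thesis
      using poisson_integrable[OF e(1)[of n]] poisson_integrable[of b] b
      by (simp add: right_diff_distrib)
  qed
  have l1: "(\<lambda>n. (LINT x|lborel. u x * (e n / ((e n)\<^sup>2 + x\<^sup>2))) - (LINT x|lborel. u x * (b / (b\<^sup>2 + x\<^sup>2)))) \<longlonglongrightarrow>
      pi * u 0 - (LINT x|lborel. u x * (b / (b\<^sup>2 + x\<^sup>2)))"
    by (intro tendsto_diff tendsto_const poisson_tendsto e)
  have l2: "(\<lambda>n. LINT x|lborel. f x * (ln (b\<^sup>2 + x\<^sup>2) / 2 - ln ((e n)\<^sup>2 + x\<^sup>2) / 2)) \<longlonglongrightarrow>
      (LINT x|lborel. f x * (log_kernel b x / 2))"
  proof (rule integral_dominated_convergence)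
    show "integrable lborel (\<lambda>x. \<bar>f x * log_kernel b x\<bar>)"
      using integrable_log_kernel[OF cont_f integrable_f, of b 0] by (intro integrable_abs) simp
    show "AE x in lborel. (\<lambda>n. f x * (ln (b\<^sup>2 + x\<^sup>2) / 2 - ln ((e n)\<^sup>2 + x\<^sup>2) / 2)) \<longlonglongrightarrow> f x * (log_kernel b x / 2)"
      using AE_lborel_singleton[of "0::real"]
    proof eventually_elim
      case (elim x)
      then have x: "x \<noteq> 0" by simp
      have "(\<lambda>n. f x * (ln (b\<^sup>2 + x\<^sup>2) / 2 - ln ((e n)\<^sup>2 + x\<^sup>2) / 2)) \<longlonglongrightarrow> f x * (ln (b\<^sup>2 + x\<^sup>2) / 2 - ln (0\<^sup>2 + x\<^sup>2) / 2)"
        by (intro tendsto_intros e) (use x in simp_all)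
      moreover have "ln (x\<^sup>2) = 2 * ln \<bar>x\<bar>" using ln_realpow[of "\<bar>x\<bar>" 2] x by simp
      ultimately show ?case using log_kernel_eq[OF x, of b] by (simp add: diff_divide_distrib)
    qed
    show "AE x in lborel. norm (f x * (ln (b\<^sup>2 + x\<^sup>2) / 2 - ln ((e n)\<^sup>2 + x\<^sup>2) / 2)) \<le> \<bar>f x * log_kernel b x\<bar>" for n
      using AE_lborel_singleton[of "0::real"]
    proof eventually_elim
      case (elim x)
      then have x: "x \<noteq> 0" by simp
      have "(e n)\<^sup>2 \<le> b\<^sup>2" using e(1,2)[of n] b by (intro power_mono) simp_all
      then have 1: "ln ((e n)\<^sup>2 + x\<^sup>2) \<le> ln (b\<^sup>2 + x\<^sup>2)" using x by (subst ln_le_cancel_iff) (simp_all add: add_nonneg_pos)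
      have 2: "ln (x\<^sup>2) \<le> ln ((e n)\<^sup>2 + x\<^sup>2)" using x by (subst ln_le_cancel_iff) (simp_all add: add_nonneg_pos)
      have "ln (x\<^sup>2) = 2 * ln \<bar>x\<bar>" using ln_realpow[of "\<bar>x\<bar>" 2] x by simp
      then have "\<bar>ln (b\<^sup>2 + x\<^sup>2) / 2 - ln ((e n)\<^sup>2 + x\<^sup>2) / 2\<bar> \<le> \<bar>log_kernel b x\<bar>"
        using 1 2 log_kernel_eq[OF x, of b] unfolding abs_le_iff by linarith
      then show ?case by (simp add: abs_mult mult_left_mono)
    qed
  qed simp_all
  show ?thesis using LIMSEQ_unique[OF l1[unfolded eqn] l2] .
qed

lemma (in weak_half_laplace) poisson_formula:
  assumes b: "b \<ge> 1"
  shows "pi * u z - (LINT x|lborel. u x * (b / (b\<^sup>2 + (x - z)\<^sup>2))) = (LINT x|lborel. f x * (log_kernel b (x - z) / 2))"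
proof -
  interpret S: weak_half_laplace "\<lambda>x. u (x + z)" "\<lambda>x. f (x + z)"
    by (rule weak_half_laplace_shift) unfold_locales
  have "(LINT x|lborel. u x * (b / (b\<^sup>2 + (x - z)\<^sup>2))) = (LINT x|lborel. u (x + z) * (b / (b\<^sup>2 + x\<^sup>2)))"
    by (subst lborel_integral_real_affine[of 1 _ z]) (simp_all add: add.commute)
  moreover have "(LINT x|lborel. f x * (log_kernel b (x - z) / 2)) = (LINT x|lborel. f (x + z) * (log_kernel b x / 2))"
    by (subst lborel_integral_real_affine[of 1 _ z]) (simp_all add: add.commute)
  ultimately show ?thesis using S.poisson_formula_0[OF b] by simp
qed

text \<open>The additive constant does not involve \<open>b\<close>, which allows dominated
  convergence as \<open>b\<close> tends to infinity. It comes from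
  \<open>(x - z)^2 \<le> 2 * (x - y)^2 + 2 * (z - y)^2\<close>.\<close>

lemma ln_ratio_bound:
  fixes b x y z :: real
  assumes "b \<ge> 1"
  shows "ln (b\<^sup>2 + (x - z)\<^sup>2) \<le> ln (b\<^sup>2 + (x - y)\<^sup>2) + ln (2 * (1 + (z - y)\<^sup>2))"
proof -
  have b: "1 \<le> b\<^sup>2" using assms by (simp add: one_le_power)
  have "(x - z)\<^sup>2 \<le> 2 * (x - y)\<^sup>2 + 2 * (z - y)\<^sup>2"
    using zero_le_power2[of "x - y + (z - y)"] by (simp add: power2_eq_square algebra_simps)
  moreover have "1 * (z - y)\<^sup>2 \<le> b\<^sup>2 * (z - y)\<^sup>2" using b by (rule mult_right_mono) simp
  moreover have "0 \<le> (z - y)\<^sup>2 * (x - y)\<^sup>2" "0 \<le> b\<^sup>2" by simp_all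
  moreover have "(b\<^sup>2 + (x - y)\<^sup>2) * (2 * (1 + (z - y)\<^sup>2)) =
      2 * b\<^sup>2 + 2 * (x - y)\<^sup>2 + 2 * (b\<^sup>2 * (z - y)\<^sup>2) + 2 * ((z - y)\<^sup>2 * (x - y)\<^sup>2)"
    by (simp add: distrib_left distrib_right mult.commute)
  ultimately have "b\<^sup>2 + (x - z)\<^sup>2 \<le> (b\<^sup>2 + (x - y)\<^sup>2) * (2 * (1 + (z - y)\<^sup>2))" by linarith
  then have le: "b\<^sup>2 + (x - z)\<^sup>2 \<le> (b\<^sup>2 + (x - y)\<^sup>2) * (2 * (1 + (z - y)\<^sup>2))" .
  have p: "b\<^sup>2 + c\<^sup>2 > 0" for c using less_le_trans[OF zero_less_one b] by (simp add: add_pos_nonneg)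
  have "0 < (b\<^sup>2 + (x - y)\<^sup>2) * (2 * (1 + (z - y)\<^sup>2))"
    using p[of "x - y"] one_plus_square_pos[of "z - y"] by (intro mult_pos_pos) simp_all
  then have "ln (b\<^sup>2 + (x - z)\<^sup>2) \<le> ln ((b\<^sup>2 + (x - y)\<^sup>2) * (2 * (1 + (z - y)\<^sup>2)))"
    using le by (simp only: ln_le_cancel_iff[OF p])
  also have "\<dots> = ln (b\<^sup>2 + (x - y)\<^sup>2) + ln (2 * (1 + (z - y)\<^sup>2))"
    using p[of "x - y"] one_plus_square_pos[of "z - y"] by (intro ln_mult_pos) simp_all
  finally show ?thesis .
qed

text \<open>\<open>b * |c| \<le> b^2 + c^2\<close> bounds the difference of the two kernels by
  \<open>|z - y| * (1 / A + 1 / B)\<close>, and this has a majorant in \<open>x\<close> that is free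
  of \<open>b\<close>.\<close>

lemma poisson_difference_bound:
  fixes b x y z :: real
  assumes b: "b \<ge> 1"
  shows "\<bar>b / (b\<^sup>2 + (x - z)\<^sup>2) - b / (b\<^sup>2 + (x - y)\<^sup>2)\<bar> \<le> \<bar>z - y\<bar> * (2 * (1 + z\<^sup>2) + 2 * (1 + y\<^sup>2)) / (1 + x\<^sup>2)"
proof -
  define A B where "A = b\<^sup>2 + (x - z)\<^sup>2" and "B = b\<^sup>2 + (x - y)\<^sup>2"
  have b2: "1 \<le> b\<^sup>2" using b by (simp add: one_le_power)
  have A: "A > 0" and B: "B > 0" unfolding A_def B_def using less_le_trans[OF zero_less_one b2] by (simp_all add: add_pos_nonneg)
  have am: "b * \<bar>c\<bar> \<le> b\<^sup>2 + c\<^sup>2" for c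
  proof -
    have "(b - \<bar>c\<bar>)\<^sup>2 = b\<^sup>2 + c\<^sup>2 - 2 * (b * \<bar>c\<bar>)" by (simp add: power2_diff)
    moreover have "0 \<le> (b - \<bar>c\<bar>)\<^sup>2" "0 \<le> b * \<bar>c\<bar>" using b by simp_all
    ultimately show ?thesis by linarith
  qed
  have "B - A = (z - y) * ((x - y) + (x - z))" unfolding A_def B_def by (simp add: power2_eq_square algebra_simps)
  then have "b * \<bar>B - A\<bar> \<le> b * (\<bar>z - y\<bar> * (\<bar>x - y\<bar> + \<bar>x - z\<bar>))"
    using b by (intro mult_left_mono) (simp_all add: abs_mult mult_left_mono)
  also have "\<dots> = \<bar>z - y\<bar> * (b * \<bar>x - y\<bar> + b * \<bar>x - z\<bar>)" by (simp add: algebra_simps)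
  also have "\<dots> \<le> \<bar>z - y\<bar> * (B + A)" unfolding A_def B_def by (intro mult_left_mono add_mono am) simp
  finally have 1: "b * \<bar>B - A\<bar> \<le> \<bar>z - y\<bar> * (B + A)" .
  have "b / A - b / B = b * (B - A) / (A * B)" using A B by (simp add: field_simps)
  then have "\<bar>b / A - b / B\<bar> = b * \<bar>B - A\<bar> / (A * B)" using A B b by (simp add: abs_mult)
  also have "\<dots> \<le> \<bar>z - y\<bar> * (B + A) / (A * B)" using 1 A B by (intro divide_right_mono) simp_all
  also have "\<dots> = \<bar>z - y\<bar> * (1 / A + 1 / B)" using A B by (simp add: field_simps)
  also have "\<dots> \<le> \<bar>z - y\<bar> * ((2 * (1 + z\<^sup>2)) / (1 + x\<^sup>2) + (2 * (1 + y\<^sup>2)) / (1 + x\<^sup>2))"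
  proof (intro mult_left_mono add_mono)
    have "1 / A \<le> 1 / (1 + (x - z)\<^sup>2)" unfolding A_def using b2 one_plus_square_pos[of "x - z"] A[unfolded A_def]
      by (intro divide_left_mono) simp_all
    then show "1 / A \<le> (2 * (1 + z\<^sup>2)) / (1 + x\<^sup>2)" using inverse_square_shift_le[of x z] by linarith
    have "1 / B \<le> 1 / (1 + (x - y)\<^sup>2)" unfolding B_def using b2 one_plus_square_pos[of "x - y"] B[unfolded B_def]
      by (intro divide_left_mono) simp_all
    then show "1 / B \<le> (2 * (1 + y\<^sup>2)) / (1 + x\<^sup>2)" using inverse_square_shift_le[of x y] by linarith
  qed simp
  also have "\<dots> = \<bar>z - y\<bar> * (2 * (1 + z\<^sup>2) + 2 * (1 + y\<^sup>2)) / (1 + x\<^sup>2)"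
    by (simp only: add_divide_distrib[symmetric] times_divide_eq_right)
  finally show ?thesis unfolding A_def B_def .
qed

context weak_half_laplace begin

lemma poisson_difference_tendsto:
  "(\<lambda>n. LINT x|lborel. u x * (real (Suc n) / ((real (Suc n))\<^sup>2 + (x - z)\<^sup>2) - real (Suc n) / ((real (Suc n))\<^sup>2 + (x - y)\<^sup>2))) \<longlonglongrightarrow> 0"
proof -
  define C where "C = \<bar>z - y\<bar> * (2 * (1 + z\<^sup>2) + 2 * (1 + y\<^sup>2))"
  have C: "C \<ge> 0" unfolding C_def by simp
  let ?d = "\<lambda>n x. real (Suc n) / ((real (Suc n))\<^sup>2 + (x - z)\<^sup>2) - real (Suc n) / ((real (Suc n))\<^sup>2 + (x - y)\<^sup>2)"
  have "(\<lambda>n. LINT x|lborel. u x * ?d n x) \<longlonglongrightarrow> (LINT x|(lborel::real measure). 0)"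
  proof (rule integral_dominated_convergence)
    show "integrable lborel (\<lambda>x. \<bar>u x * (C / (1 + x\<^sup>2))\<bar>)"
      by (rule integrable_abs, rule integrable_u_decay[where C = C]) (use C in simp_all)
    have "norm (u x * ?d n x) \<le> \<bar>u x * (C / (1 + x\<^sup>2))\<bar>" for n x
    proof -
      have "\<bar>?d n x\<bar> \<le> C / (1 + x\<^sup>2)" unfolding C_def by (rule poisson_difference_bound) simp
      then have "\<bar>u x\<bar> * \<bar>?d n x\<bar> \<le> \<bar>u x\<bar> * (C / (1 + x\<^sup>2))" by (rule mult_left_mono) simp
      moreover have "0 \<le> C / (1 + x\<^sup>2)" using C by simp
      ultimately show ?thesis by (simp only: real_norm_def abs_mult[of "u x"] abs_of_nonneg)
    qed
    then show "AE x in lborel. norm (u x * ?d n x) \<le> \<bar>u x * (C / (1 + x\<^sup>2))\<bar>" for n by (rule AE_I2)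
    have l: "(\<lambda>n. real (Suc n) / ((real (Suc n))\<^sup>2 + c)) \<longlonglongrightarrow> 0" for c by real_asymp
    have "(\<lambda>n. u x * ?d n x) \<longlonglongrightarrow> u x * (0 - 0)" for x by (intro tendsto_intros l)
    then show "AE x in lborel. (\<lambda>n. u x * ?d n x) \<longlonglongrightarrow> 0" by (intro AE_I2) simp
  qed simp_all
  then show ?thesis by simp
qed

text \<open>Subtract the Poisson formulas at \<open>z\<close> and \<open>y\<close> and let
  \<open>b\<close> tend to infinity. The Poisson averages merge, and so do the parts of the kernels
  that contain \<open>b\<close>, leaving only the logarithms of the distances.\<close>

lemma two_point:
  shows integrable_two_point: "integrable lborel (\<lambda>x. f x * (ln \<bar>x - y\<bar> - ln \<bar>x - z\<bar>))"
    and two_point_formula: "pi * (u z - u y) = (LINT x|lborel. f x * (ln \<bar>x - y\<bar> - ln \<bar>x - z\<bar>))"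
proof -
  define c where "c = ln (2 * (1 + (z - y)\<^sup>2))"
  define q where "q b x = ln (b\<^sup>2 + (x - z)\<^sup>2) - ln (b\<^sup>2 + (x - y)\<^sup>2)" for b x
  define m where "m x = ln \<bar>x - y\<bar> - ln \<bar>x - z\<bar>" for x
  have [measurable]: "q b \<in> borel_measurable borel" "m \<in> borel_measurable borel" for b
    unfolding q_def m_def by measurable
  have qc: "\<bar>q b x\<bar> \<le> c" if "b \<ge> 1" for b x
    using ln_ratio_bound[OF that, of x z y] ln_ratio_bound[OF that, of x y z] power2_commute[of y z]
    unfolding q_def c_def abs_le_iff by simp
  have iq: "integrable lborel (\<lambda>x. f x * q b x)" if "b \<ge> 1" for b
  proof (rule Bochner_Integration.integrable_bound)
    show "integrable lborel (\<lambda>x. f x * c)" using integrable_f by simp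
    have "norm (f x * q b x) \<le> norm (f x * c)" for x
    proof -
      have "\<bar>f x\<bar> * \<bar>q b x\<bar> \<le> \<bar>f x\<bar> * \<bar>c\<bar>" using qc[OF that, of x] by (intro mult_left_mono) simp_all
      then show ?thesis by (simp add: abs_mult)
    qed
    then show "AE x in lborel. norm (f x * q b x) \<le> norm (f x * c)" by (rule AE_I2)
  qed simp
  have AEm: "AE x in lborel. f x * (log_kernel b (x - z) / 2) - f x * (log_kernel b (x - y) / 2) = f x * q b x / 2 + f x * m x" for b
    using AE_lborel_singleton[of y] AE_lborel_singleton[of z]
  proof eventually_elim
    case (elim x)
    then have "log_kernel b (x - z) / 2 - log_kernel b (x - y) / 2 = q b x / 2 + m x"
      by (simp add: log_kernel_eq q_def m_def) argo
    then have "f x * (log_kernel b (x - z) / 2 - log_kernel b (x - y) / 2) = f x * (q b x / 2 + m x)" by simp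
    then show ?case by (simp add: right_diff_distrib distrib_left)
  qed
  have ilk: "integrable lborel (\<lambda>x. f x * (log_kernel b (x - w) / 2))" for b w
    using integrable_divide[OF integrable_log_kernel[OF cont_f integrable_f, of b w], of 2] by simp
  have im: "integrable lborel (\<lambda>x. f x * m x)"
  proof -
    have "integrable lborel (\<lambda>x. (f x * (log_kernel 1 (x - z) / 2) - f x * (log_kernel 1 (x - y) / 2)) - f x * q 1 x / 2)"
      using iq[of 1] by (intro Bochner_Integration.integrable_diff ilk integrable_divide) simp
    moreover have "AE x in lborel. (f x * (log_kernel 1 (x - z) / 2) - f x * (log_kernel 1 (x - y) / 2)) - f x * q 1 x / 2 = f x * m x"
      using AEm[of 1] by eventually_elim simp
    ultimately show ?thesis by (subst integrable_cong_AE[symmetric]) simp_all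
  qed
  then show "integrable lborel (\<lambda>x. f x * (ln \<bar>x - y\<bar> - ln \<bar>x - z\<bar>))" unfolding m_def .
  define P where "P n = (LINT x|lborel. u x * (real (Suc n) / ((real (Suc n))\<^sup>2 + (x - z)\<^sup>2) - real (Suc n) / ((real (Suc n))\<^sup>2 + (x - y)\<^sup>2)))" for n
  have "pi * (u z - u y) = P n + (LINT x|lborel. f x * q (real (Suc n)) x) / 2 + (LINT x|lborel. f x * m x)" for n
  proof -
    define b where "b = real (Suc n)"
    have b: "b \<ge> 1" by (simp add: b_def)
    have ip: "integrable lborel (\<lambda>x. u x * (b / (b\<^sup>2 + (x - w)\<^sup>2)))" for w
    proof -
      interpret S: weak_half_laplace "\<lambda>x. u (x + w)" "\<lambda>x. f (x + w)"
        by (rule weak_half_laplace_shift) unfold_locales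
      have "integrable lborel (\<lambda>x. u (x + w) * (b / (b\<^sup>2 + x\<^sup>2)))" using b by (intro S.poisson_integrable) simp
      from lborel_integrable_real_affine[OF this, of 1 "- w"] show ?thesis by simp
    qed
    have "P n = (LINT x|lborel. u x * (b / (b\<^sup>2 + (x - z)\<^sup>2))) - (LINT x|lborel. u x * (b / (b\<^sup>2 + (x - y)\<^sup>2)))"
      unfolding P_def b_def[symmetric] right_diff_distrib by (rule Bochner_Integration.integral_diff[OF ip ip])
    then have "pi * (u z - u y) = P n + ((LINT x|lborel. f x * (log_kernel b (x - z) / 2)) - (LINT x|lborel. f x * (log_kernel b (x - y) / 2)))"
      using poisson_formula[OF b, of z] poisson_formula[OF b, of y] by (simp add: right_diff_distrib)
    also have "(LINT x|lborel. f x * (log_kernel b (x - z) / 2)) - (LINT x|lborel. f x * (log_kernel b (x - y) / 2)) =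
        (LINT x|lborel. f x * (log_kernel b (x - z) / 2) - f x * (log_kernel b (x - y) / 2))"
      by (rule Bochner_Integration.integral_diff[OF ilk ilk, symmetric])
    also have "\<dots> = (LINT x|lborel. f x * q b x / 2 + f x * m x)"
      by (rule integral_cong_AE[OF _ _ AEm]) simp_all
    also have "\<dots> = (LINT x|lborel. f x * q b x / 2) + (LINT x|lborel. f x * m x)"
      by (rule Bochner_Integration.integral_add[OF integrable_divide[OF iq[OF b]] im])
    finally show ?thesis by (simp add: b_def)
  qed
  moreover have "(\<lambda>n. P n + (LINT x|lborel. f x * q (real (Suc n)) x) / 2 + (LINT x|lborel. f x * m x)) \<longlonglongrightarrow>
      0 + (LINT x|(lborel::real measure). 0) / 2 + (LINT x|lborel. f x * m x)"
  proof (intro tendsto_add tendsto_const tendsto_divide)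
    show "P \<longlonglongrightarrow> 0" unfolding P_def[abs_def] by (rule poisson_difference_tendsto)
    show "(\<lambda>n. LINT x|lborel. f x * q (real (Suc n)) x) \<longlonglongrightarrow> (LINT x|(lborel::real measure). 0)"
    proof (rule integral_dominated_convergence)
      show "integrable lborel (\<lambda>x. \<bar>f x * c\<bar>)" using integrable_f by simp
      have "norm (f x * q (real (Suc n)) x) \<le> \<bar>f x * c\<bar>" for n x
      proof -
        have "\<bar>f x\<bar> * \<bar>q (real (Suc n)) x\<bar> \<le> \<bar>f x\<bar> * \<bar>c\<bar>"
          using qc[of "real (Suc n)" x] by (intro mult_left_mono) simp_all
        then show ?thesis by (simp add: abs_mult)
      qed
      then show "AE x in lborel. norm (f x * q (real (Suc n)) x) \<le> \<bar>f x * c\<bar>" for n by (rule AE_I2)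
      have "(\<lambda>n. q (real (Suc n)) x) \<longlonglongrightarrow> 0" for x unfolding q_def by real_asymp
      then have "(\<lambda>n. f x * q (real (Suc n)) x) \<longlonglongrightarrow> f x * 0" for x by (intro tendsto_intros)
      then show "AE x in lborel. (\<lambda>n. f x * q (real (Suc n)) x) \<longlonglongrightarrow> 0" by (intro AE_I2) simp
    qed simp_all
  qed simp
  ultimately have "(\<lambda>n::nat. pi * (u z - u y)) \<longlonglongrightarrow> (LINT x|lborel. f x * m x)" by simp
  then show "pi * (u z - u y) = (LINT x|lborel. f x * (ln \<bar>x - y\<bar> - ln \<bar>x - z\<bar>))"
    unfolding m_def by (simp add: LIMSEQ_const_iff)
qed

end

section \<open>Upper bounds for solutions\<close>

text \<open>The equation enters only in integrated form. Here \<open>\<delta>\<close> is going to be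
  twice that of Assumption (A), because the assumption bounds the square root of
  \<open>K\<close>.\<close>

locale liouville_solution =
  fixes K W :: "real \<Rightarrow> real" and C \<delta> :: real
  assumes K_pos: "\<And>x. 0 < K x" and K_even: "\<And>x. K (- x) = K x"
    and K_mono: "\<And>x y. \<bar>x\<bar> \<le> \<bar>y\<bar> \<Longrightarrow> K y \<le> K x" and K_cont: "continuous_on UNIV K"
    and \<delta>: "\<delta> > 0" and K_decay: "\<And>x. x \<noteq> 0 \<Longrightarrow> K x \<le> C * \<bar>x\<bar> powr (- 1 - \<delta>)"
    and W_cont: "continuous_on UNIV W"
    and integrable_dens: "integrable lborel (\<lambda>x. K x * exp (W x))"
    and integrable_repr: "\<And>y z. integrable lborel (\<lambda>x. K x * exp (W x) * (ln \<bar>x - y\<bar> - ln \<bar>x - z\<bar>))"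
    and repr: "\<And>y z. pi * (W z - W y) = (LINT x|lborel. K x * exp (W x) * (ln \<bar>x - y\<bar> - ln \<bar>x - z\<bar>))"
begin

definition f :: "real \<Rightarrow> real" where "f x = K x * exp (W x)"

lemma f_pos: "f x > 0" by (simp add: f_def K_pos)

lemma f_cont: "continuous_on UNIV f"
  unfolding f_def by (intro continuous_intros K_cont W_cont)

lemma f_meas [measurable]: "f \<in> borel_measurable borel"
  by (rule borel_measurable_continuous_onI[OF f_cont])

lemma f_int: "integrable lborel f"
  using integrable_dens unfolding f_def .

lemma W_meas [measurable]: "W \<in> borel_measurable borel"
  by (rule borel_measurable_continuous_onI[OF W_cont])

lemma f_set_int: "S \<in> sets borel \<Longrightarrow> integrable lborel (\<lambda>x. indicator S x * f x)"
  using integrable_mult_indicator[OF _ f_int, of S] by simp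

lemma f_tail:
  assumes "\<epsilon> > 0"
  obtains R where "R > 0" "(LINT x|lborel. indicator {x. R \<le> \<bar>x\<bar>} x * f x) \<le> \<epsilon>"
proof -
  have "(\<lambda>n. LINT x|lborel. indicator {x. real (Suc n) \<le> \<bar>x\<bar>} x * f x) \<longlonglongrightarrow> (LINT x|(lborel::real measure). 0)"
  proof (rule integral_dominated_convergence[OF _ _ f_int])
    show "AE x in lborel. (\<lambda>n. indicator {x. real (Suc n) \<le> \<bar>x\<bar>} x * f x) \<longlonglongrightarrow> 0"
    proof (rule AE_I2)
      fix x :: real
      obtain N where N: "\<bar>x\<bar> < real N" using reals_Archimedean2 by blast
      have "\<forall>\<^sub>F n in sequentially. 0 = indicator {x. real (Suc n) \<le> \<bar>x\<bar>} x * f x"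
        unfolding eventually_sequentially using N by (intro exI[of _ N]) auto
      then show "(\<lambda>n. indicator {x. real (Suc n) \<le> \<bar>x\<bar>} x * f x) \<longlonglongrightarrow> 0"
        by (rule Lim_transform_eventually[OF tendsto_const])
    qed
    show "AE x in lborel. norm (indicator {x. real (Suc n) \<le> \<bar>x\<bar>} x * f x) \<le> f x" for n
      using f_pos by (intro AE_I2) (auto simp: indicator_def less_imp_le)
  qed simp_all
  then have "(\<lambda>n. LINT x|lborel. indicator {x. real (Suc n) \<le> \<bar>x\<bar>} x * f x) \<longlonglongrightarrow> 0" by simp
  from LIMSEQ_D[OF this assms] obtain n where "norm ((LINT x|lborel. indicator {x. real (Suc n) \<le> \<bar>x\<bar>} x * f x) - 0) < \<epsilon>" by blast
  then show thesis using that[of "real (Suc n)"] by simp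
qed

text \<open>Three regimes for the distance of \<open>t\<close> to \<open>t1\<close>: from
  \<open>r / 2\<close> on, the ratio is at most 7; below \<open>\<rho>\<close> a square root
  replaces the logarithm; in between the ratio is at most \<open>4 * r / \<rho>\<close>. The large
  logarithm comes with the indicator of \<open>r / 2 \<le> |t|\<close>, where \<open>f\<close> has
  little mass.\<close>

lemma log_ratio_le:
  fixes r \<rho> t t1 :: real
  assumes r: "r > 0" and \<rho>: "0 < \<rho>" "\<rho> \<le> r / 2" and t1: "r \<le> \<bar>t1\<bar>" "\<bar>t1\<bar> \<le> 3 * r" and t: "t \<noteq> 0" "t \<noteq> t1"
  shows "ln \<bar>t - 0\<bar> - ln \<bar>t - t1\<bar> \<le> ln 7 + ln (4 * r / \<rho>) * indicator {t. r / 2 \<le> \<bar>t\<bar>} t +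
     2 * sqrt \<rho> * (indicator {- \<rho>..\<rho>} (t - t1) / sqrt \<bar>t - t1\<bar>)"
proof -
  have p: "\<bar>t\<bar> > 0" "\<bar>t - t1\<bar> > 0" using t by simp_all
  have "1 \<le> 4 * r / \<rho>" using \<rho> r by (simp add: pos_le_divide_eq)
  then have l0: "0 \<le> ln (4 * r / \<rho>)" by simp
  have tt: "\<bar>t\<bar> \<le> \<bar>t - t1\<bar> + 3 * r" using t1(2) abs_triangle_ineq[of "t - t1" t1] by simp
  have tt2: "\<bar>t1\<bar> \<le> \<bar>t\<bar> + \<bar>t - t1\<bar>"
    using abs_triangle_ineq[of t "t1 - t"] abs_minus_commute[of t t1] by simp
  have s0: "0 \<le> 2 * sqrt \<rho> * (indicator {- \<rho>..\<rho>} (t - t1) / sqrt \<bar>t - t1\<bar>)" using \<rho> by simp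
  have i0: "0 \<le> ln (4 * r / \<rho>) * indicator {t. r / 2 \<le> \<bar>t\<bar>} t" using l0 by simp
  have l7: "0 \<le> ln (7::real)" by simp
  consider "r / 2 \<le> \<bar>t - t1\<bar>" | "\<rho> \<le> \<bar>t - t1\<bar>" "\<bar>t - t1\<bar> < r / 2" | "\<bar>t - t1\<bar> < \<rho>" by linarith
  then show ?thesis
  proof cases
    case 1
    then have "r \<le> 2 * \<bar>t - t1\<bar>" by simp
    then have "\<bar>t\<bar> \<le> 7 * \<bar>t - t1\<bar>" using tt by argo
    then have "ln \<bar>t\<bar> \<le> ln (7 * \<bar>t - t1\<bar>)" using p by simp
    also have "\<dots> = ln 7 + ln \<bar>t - t1\<bar>" using p by (simp add: ln_mult)
    finally show ?thesis using s0 i0 by simp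
  next
    case 2
    then have "r / 2 \<le> \<bar>t\<bar>" using tt2 t1(1) by argo
    then have ind: "indicator {t. r / 2 \<le> \<bar>t\<bar>} t = (1::real)" by simp
    have "\<bar>t\<bar> \<le> 4 * r" using tt 2 r by argo
    also have "4 * r = (4 * r / \<rho>) * \<rho>" using \<rho> by simp
    also have "\<dots> \<le> (4 * r / \<rho>) * \<bar>t - t1\<bar>" using 2 r \<rho> by (intro mult_left_mono) simp_all
    finally have "ln \<bar>t\<bar> \<le> ln ((4 * r / \<rho>) * \<bar>t - t1\<bar>)" using p r \<rho> by simp
    also have "\<dots> = ln (4 * r / \<rho>) + ln \<bar>t - t1\<bar>" using p r \<rho> by (intro ln_mult_pos) simp_all
    finally show ?thesis using s0 l7 unfolding ind diff_zero mult_1_right by linarith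
  next
    case 3
    then have "r / 2 \<le> \<bar>t\<bar>" "\<bar>t - t1\<bar> \<le> \<rho>" using tt2 t1(1) \<rho> by argo+
    then have ind: "indicator {t. r / 2 \<le> \<bar>t\<bar>} t = (1::real)" "indicator {- \<rho>..\<rho>} (t - t1) = (1::real)"
      by (simp_all add: abs_le_iff)
    have "\<bar>t\<bar> \<le> 4 * r" using tt 3 \<rho> r by argo
    then have "ln \<bar>t\<bar> \<le> ln (4 * r)" using p r by simp
    also have "\<dots> = ln (4 * r / \<rho>) + ln \<rho>" using r \<rho> by (simp add: ln_div)
    finally have a: "ln \<bar>t\<bar> \<le> ln (4 * r / \<rho>) + ln \<rho>" .
    have "ln (\<rho> / \<bar>t - t1\<bar>) = 2 * ln (sqrt (\<rho> / \<bar>t - t1\<bar>))" using \<rho> p by (simp add: ln_sqrt)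
    also have "\<dots> \<le> 2 * sqrt (\<rho> / \<bar>t - t1\<bar>)" using less_imp_le[OF ln_less_self[of "sqrt (\<rho> / \<bar>t - t1\<bar>)"]] \<rho> p by simp
    finally have "ln \<rho> - ln \<bar>t - t1\<bar> \<le> 2 * sqrt \<rho> * (1 / sqrt \<bar>t - t1\<bar>)" using \<rho> p by (simp add: ln_div real_sqrt_divide)
    then show ?thesis using a l7 unfolding ind diff_zero mult_1_right by linarith
  qed
qed

text \<open>Doubling argument: maximising \<open>W + 2 ln (distance to the boundary)\<close> over an interval of
  length comparable to \<open>|x\<^sub>0|\<close> yields a point around which the density is controlled by its
  value at that point.\<close>

lemma W_upper_bound:
  obtains c R where "R > 0" "\<And>x. R \<le> \<bar>x\<bar> \<Longrightarrow> W x \<le> c + \<delta> * ln \<bar>x\<bar>"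
proof -
  define m where "m = (LINT x|lborel. f x)"
  have m0: "0 \<le> m" unfolding m_def using f_pos by (intro integral_nonneg_AE AE_I2) (simp add: less_imp_le)
  \<comment> \<open>Tail mass at most 1 lets the resulting multiple of the maximum be absorbed,
    since \<open>pi > 2\<close>; tail mass at most \<open>\<delta>\<close> becomes the coefficient
    of the logarithmic growth.\<close>
  obtain R0 where R0: "R0 > 0" "(LINT x|lborel. indicator {x. R0 \<le> \<bar>x\<bar>} x * f x) \<le> min 1 \<delta>"
    using f_tail[of "min 1 \<delta>"] \<delta> by auto
  define c0 where "c0 = pi * \<bar>W 0\<bar> + ln 7 * m + 32 * K 0"
  have c0: "c0 \<ge> 0" unfolding c0_def using m0 K_pos[of 0] by simp
  have "W x0 \<le> (c0 + ln 2 + \<delta> * ln 2) + \<delta> * ln \<bar>x0\<bar>" if x0: "4 * R0 + 2 \<le> \<bar>x0\<bar>" for x0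
  proof -
    define r where "r = \<bar>x0\<bar> / 2"
    have r: "r \<ge> 1" "r / 2 \<ge> R0" "r > 0" "\<bar>x0\<bar> = 2 * r" using x0 R0(1) by (simp_all add: r_def)
    define g where "g t = exp (W t / 2) * (r - \<bar>t - x0\<bar>)" for t
    have "continuous_on {x0 - r..x0 + r} g"
      unfolding g_def by (intro continuous_intros continuous_on_subset[OF W_cont]) simp_all
    then obtain t1 where t1: "t1 \<in> {x0 - r..x0 + r}" "\<And>t. t \<in> {x0 - r..x0 + r} \<Longrightarrow> g t \<le> g t1"
      using continuous_attains_sup[OF compact_Icc _ \<open>continuous_on {x0 - r..x0 + r} g\<close>] r(3) by auto
    define d where "d = r - \<bar>t1 - x0\<bar>"
    define M where "M = W t1"
    have g0: "g x0 \<le> g t1" using t1(2)[of x0] r(3) by simp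
    have "0 < g x0" using r by (simp add: g_def)
    then have "0 < exp (M / 2) * d" using g0 by (simp add: g_def d_def M_def)
    then have d: "d > 0" by (simp add: zero_less_mult_iff)
    have dr: "d \<le> r" by (simp add: d_def)
    have t1r: "r \<le> \<bar>t1\<bar>" "\<bar>t1\<bar> \<le> 3 * r" using t1(1) r(4) d unfolding d_def by auto
    have Wx0: "W x0 \<le> M + 2 * ln (d / r)"
    proof -
      have "exp (W x0 / 2) * r \<le> exp (M / 2) * d" using g0 by (simp add: g_def d_def M_def)
      then have "ln (exp (W x0 / 2) * r) \<le> ln (exp (M / 2) * d)" using r d by simp
      then have "W x0 / 2 + ln r \<le> M / 2 + ln d" using r d by (simp add: ln_mult)
      then show ?thesis using r d by (simp add: ln_div)
    qed
    \<comment> \<open>Within \<open>d / 2\<close> of \<open>t1\<close> the maximality of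
      \<open>g\<close> gives \<open>exp W \<le> 4 * exp M\<close>; the radius
      \<open>exp (- M)\<close> keeps the contribution of this neighbourhood, of order
      \<open>exp M * \<rho>\<close>, bounded.\<close>
    define \<rho> where "\<rho> = min (d / 2) (exp (- M))"
    have \<rho>: "0 < \<rho>" "\<rho> \<le> d / 2" "\<rho> \<le> exp (- M)" "\<rho> \<le> r / 2" using d dr by (simp_all add: \<rho>_def)
    have fs: "f s \<le> 4 * K 0 * exp M" if "\<bar>s - t1\<bar> \<le> \<rho>" for s
    proof -
      have s: "\<bar>s - t1\<bar> \<le> d / 2" using that \<rho> by linarith
      then have "2 * \<bar>s - t1\<bar> \<le> r - \<bar>t1 - x0\<bar>" unfolding d_def by argo
      moreover have "\<bar>t1 - x0\<bar> \<le> r" using d unfolding d_def by linarith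
      moreover have "\<bar>s - x0\<bar> \<le> \<bar>s - t1\<bar> + \<bar>t1 - x0\<bar>"
        using abs_triangle_ineq[of "s - t1" "t1 - x0"] by simp
      ultimately have "\<bar>s - x0\<bar> \<le> r" and ds: "d / 2 \<le> r - \<bar>s - x0\<bar>" unfolding d_def by argo+
      then have "s \<in> {x0 - r..x0 + r}" by (simp add: abs_le_iff)
      then have "exp (W s / 2) * (r - \<bar>s - x0\<bar>) \<le> exp (M / 2) * d" using t1(2)[of s] by (simp add: g_def d_def M_def)
      moreover have "exp (W s / 2) * (d / 2) \<le> exp (W s / 2) * (r - \<bar>s - x0\<bar>)"
        using ds by (rule mult_left_mono) simp
      ultimately have "exp (W s / 2) * (d / 2) \<le> exp (M / 2) * d" by linarith
      then have "(exp (W s / 2) / 2) * d \<le> exp (M / 2) * d" by simp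
      then have "exp (W s / 2) / 2 \<le> exp (M / 2)" using d by (rule mult_right_le_imp_le)
      then have "exp (W s / 2) \<le> 2 * exp (M / 2)" by simp
      then have "(exp (W s / 2))\<^sup>2 \<le> (2 * exp (M / 2))\<^sup>2" by (rule power_mono) simp
      then have "exp (W s) \<le> 4 * exp M" by (simp add: power2_eq_square exp_add[symmetric])
      then have "K s * exp (W s) \<le> K 0 * (4 * exp M)"
        using K_mono[of 0 s] K_pos[of 0] by (intro mult_mono) simp_all
      then show ?thesis by (simp add: f_def)
    qed
    define mr where "mr = (LINT x|lborel. indicator {x. r / 2 \<le> \<bar>x\<bar>} x * f x)"
    have "mr \<le> (LINT x|lborel. indicator {x. R0 \<le> \<bar>x\<bar>} x * f x)"
      unfolding mr_def using r(2) f_pos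
      by (intro integral_mono f_set_int) (auto simp: indicator_def less_imp_le)
    then have mr: "mr \<le> 1" "mr \<le> \<delta>" using R0(2) by simp_all
    have mr0: "0 \<le> mr" unfolding mr_def using f_pos by (intro integral_nonneg_AE AE_I2) (simp add: less_imp_le)
    let ?b = "\<lambda>t. ln 7 * f t + ln (4 * r / \<rho>) * (indicator {t. r / 2 \<le> \<bar>t\<bar>} t * f t) +
        (2 * sqrt \<rho> * (4 * K 0 * exp M)) * (indicator {- \<rho>..\<rho>} (t - t1) / sqrt \<bar>t - t1\<bar>)"
    have isq: "integrable lborel (\<lambda>t. indicator {- \<rho>..\<rho>} (t - t1) / sqrt \<bar>t - t1\<bar>)"
      "(LINT t|lborel. indicator {- \<rho>..\<rho>} (t - t1) / sqrt \<bar>t - t1\<bar>) = 4 * sqrt \<rho>"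
      using lborel_integrable_real_affine[OF integrable_inverse_sqrt[of \<rho>], of 1 "- t1"]
        lborel_integral_real_affine[of 1 "\<lambda>t. indicator {- \<rho>..\<rho>} t / sqrt \<bar>t\<bar>" "- t1"] LINT_inverse_sqrt[of \<rho>] \<rho>
      by simp_all
    have hb: "has_bochner_integral lborel ?b (ln 7 * m + ln (4 * r / \<rho>) * mr + (2 * sqrt \<rho> * (4 * K 0 * exp M)) * (4 * sqrt \<rho>))"
      using f_int f_set_int[of "{x. r / 2 \<le> \<bar>x\<bar>}"] isq
      by (intro has_bochner_integral_add has_bochner_integral_mult_right) (simp_all add: has_bochner_integral_iff m_def mr_def)
    have "pi * (M - W 0) \<le> ln 7 * m + ln (4 * r / \<rho>) * mr + (2 * sqrt \<rho> * (4 * K 0 * exp M)) * (4 * sqrt \<rho>)"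
    proof -
      have "(LINT t|lborel. f t * (ln \<bar>t - 0\<bar> - ln \<bar>t - t1\<bar>)) \<le> (LINT t|lborel. ?b t)"
      proof (rule integral_mono_AE)
        show "integrable lborel (\<lambda>t. f t * (ln \<bar>t - 0\<bar> - ln \<bar>t - t1\<bar>))" using integrable_repr unfolding f_def .
        show "integrable lborel ?b" using hb by (simp add: has_bochner_integral_iff)
        show "AE t in lborel. f t * (ln \<bar>t - 0\<bar> - ln \<bar>t - t1\<bar>) \<le> ?b t"
          using AE_lborel_singleton[of 0] AE_lborel_singleton[of t1]
        proof eventually_elim
          case (elim t)
          let ?S = "indicator {- \<rho>..\<rho>} (t - t1) / sqrt \<bar>t - t1\<bar>"
          have "f t * (ln \<bar>t - 0\<bar> - ln \<bar>t - t1\<bar>) \<le> f t * (ln 7 + ln (4 * r / \<rho>) * indicator {t. r / 2 \<le> \<bar>t\<bar>} t + 2 * sqrt \<rho> * ?S)"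
            using elim log_ratio_le[OF r(3) \<rho>(1,4) t1r, of t] f_pos[of t] by (intro mult_left_mono) simp_all
          also have "\<dots> = ln 7 * f t + ln (4 * r / \<rho>) * (indicator {t. r / 2 \<le> \<bar>t\<bar>} t * f t) + 2 * sqrt \<rho> * (f t * ?S)"
            by (simp only: distrib_left mult_ac)
          also have "2 * sqrt \<rho> * (f t * ?S) \<le> 2 * sqrt \<rho> * ((4 * K 0 * exp M) * ?S)"
          proof (cases "\<bar>t - t1\<bar> \<le> \<rho>")
            case True
            then show ?thesis using fs[of t] \<rho>(1) by (intro mult_left_mono mult_right_mono) simp_all
          next
            case False
            then have "t - t1 \<notin> {- \<rho>..\<rho>}" by auto
            then show ?thesis by simp
          qed
          finally show ?case by (simp only: mult.assoc add_le_cancel_left)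
        qed
      qed
      also have "\<dots> = ln 7 * m + ln (4 * r / \<rho>) * mr + (2 * sqrt \<rho> * (4 * K 0 * exp M)) * (4 * sqrt \<rho>)"
        using hb by (simp only: has_bochner_integral_iff)
      finally show ?thesis using repr[of t1 0] unfolding f_def M_def by simp
    qed
    moreover have "(2 * sqrt \<rho> * (4 * K 0 * exp M)) * (4 * sqrt \<rho>) = 32 * K 0 * (exp M * \<rho>)"
      using \<rho>(1) by (simp add: mult_ac)
    moreover have "32 * K 0 * (exp M * \<rho>) \<le> 32 * K 0 * 1"
    proof (rule mult_left_mono)
      have "exp M * \<rho> \<le> exp M * exp (- M)" using \<rho>(3) by (rule mult_left_mono) simp
      then show "exp M * \<rho> \<le> 1" by (simp add: exp_minus)
    qed (use K_pos[of 0] in simp)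
    moreover have "pi * W 0 \<le> pi * \<bar>W 0\<bar>" by simp
    ultimately have main: "pi * M \<le> c0 + ln (4 * r / \<rho>) * mr"
      unfolding c0_def right_diff_distrib by linarith
    have ln2: "0 \<le> ln (2::real)" by simp
    have lx: "ln \<bar>x0\<bar> = ln 2 + ln r" using r by (simp add: ln_mult)
    have lr: "0 \<le> ln r" using r by simp
    have dl: "ln (d / r) \<le> 0" using d dr r by (simp add: ln_div)
    have nn: "0 \<le> \<delta> * ln 2" "0 \<le> \<delta> * ln \<bar>x0\<bar>" using \<delta> lx lr ln2 by simp_all
    \<comment> \<open>If \<open>d / 2\<close> is the smaller radius, then
      \<open>M + ln d \<le> ln 2\<close> and the doubling inequality alone bounds
      \<open>W x0\<close>. Otherwise \<open>ln (4 * r / \<rho>) = ln (4 * r) + M\<close>, and for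
      positive \<open>M\<close> this last term is absorbed on the left.\<close>
    show ?thesis
    proof (cases "\<rho> = d / 2")
      case True
      then have "d / 2 \<le> exp (- M)" using \<rho>(3) by simp
      then have "ln (d / 2) \<le> ln (exp (- M))" using d by (subst ln_le_cancel_iff) simp_all
      then have "ln (d / 2) \<le> - M" by simp
      then have "M + ln d \<le> ln 2" using d by (simp add: ln_div)
      moreover have "ln d \<le> ln r" using d dr by simp
      moreover have "W x0 \<le> M + 2 * (ln d - ln r)" using Wx0 d r by (simp only: ln_divide_pos)
      ultimately have "W x0 \<le> ln 2" using lr by argo
      then show ?thesis using c0 nn by linarith
    next
      case False
      then have \<rho>M: "\<rho> = exp (- M)" by (simp add: \<rho>_def min_def split: if_splits)
      show ?thesis
      proof (cases "M \<le> 0")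
        case True
        then show ?thesis using Wx0 dl c0 nn ln2 by linarith
      next
        case M: False
        have "ln (4 * r / \<rho>) = ln (4 * r) + M" using r by (simp add: \<rho>M ln_div)
        then have "pi * M \<le> c0 + ln (4 * r) * mr + M * mr" using main by (simp add: distrib_right)
        moreover have "M * mr \<le> M * 1" using M mr by (intro mult_left_mono) simp_all
        moreover have "2 * M \<le> pi * M" using M pi_gt3 by (intro mult_right_mono) simp_all
        moreover have "ln (4 * r) * mr \<le> ln (4 * r) * \<delta>" using r mr by (intro mult_left_mono) simp_all
        moreover have "ln (4 * r) * \<delta> = \<delta> * ln 2 + \<delta> * ln \<bar>x0\<bar>"
        proof -
          have "ln (4 * r) = ln 2 + ln \<bar>x0\<bar>" using r ln_mult_pos[of 2 "2 * r"] by simp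
          then show ?thesis by (simp add: distrib_left mult.commute)
        qed
        ultimately have "M \<le> c0 + (\<delta> * ln 2 + \<delta> * ln \<bar>x0\<bar>)" by linarith
        then show ?thesis using Wx0 dl ln2 by linarith
      qed
    qed
  qed
  then show thesis
  proof (rule that[rotated])
    show "0 < 4 * R0 + 2" using R0(1) by simp
  qed
qed

text \<open>The growth \<open>|x| powr \<delta>\<close> allowed for \<open>exp W\<close> uses up
  exactly the surplus in \<open>K x \<le> C * |x| powr (- 1 - \<delta>)\<close> and leaves the
  scale-invariant rate \<open>1 / |x|\<close>.\<close>

lemma f_decay:
  obtains c where "c \<ge> 0" "\<And>x. \<bar>x\<bar> * f x \<le> c"
proof -
  obtain c R where R: "R > 0" "\<And>x. R \<le> \<bar>x\<bar> \<Longrightarrow> W x \<le> c + \<delta> * ln \<bar>x\<bar>"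
    by (rule W_upper_bound, rule that) assumption+
  have "continuous_on UNIV (\<lambda>x. \<bar>x\<bar> * f x)"
    by (rule continuous_on_mult[OF continuous_on_rabs[OF continuous_on_id] f_cont])
  then have "compact ((\<lambda>x. \<bar>x\<bar> * f x) ` {- R..R})"
    by (rule compact_continuous_image[OF continuous_on_subset[OF _ subset_UNIV] compact_Icc])
  from this[THEN compact_imp_bounded, unfolded bounded_iff]
  obtain B where B: "\<forall>y \<in> (\<lambda>x. \<bar>x\<bar> * f x) ` {- R..R}. norm y \<le> B" by (elim exE) (rule that)
  have far: "\<bar>x\<bar> * f x \<le> \<bar>C\<bar> * exp c" if x: "R \<le> \<bar>x\<bar>" for x
  proof -
    have x0: "\<bar>x\<bar> > 0" using x R(1) by linarith
    have "exp (W x) \<le> exp (c + \<delta> * ln \<bar>x\<bar>)" using R(2)[OF x] by simp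
    also have "\<dots> = exp c * \<bar>x\<bar> powr \<delta>" using x0 by (simp add: exp_add powr_def)
    finally have "K x * exp (W x) \<le> (\<bar>C\<bar> * \<bar>x\<bar> powr (- 1 - \<delta>)) * (exp c * \<bar>x\<bar> powr \<delta>)"
    proof (rule mult_mono[rotated])
      have a: "C * \<bar>x\<bar> powr (- 1 - \<delta>) \<le> \<bar>C\<bar> * \<bar>x\<bar> powr (- 1 - \<delta>)" by (intro mult_right_mono) simp_all
      show "K x \<le> \<bar>C\<bar> * \<bar>x\<bar> powr (- 1 - \<delta>)" using x0 by (intro order_trans[OF K_decay a]) simp
    qed simp_all
    also have "\<dots> = \<bar>C\<bar> * exp c * (\<bar>x\<bar> powr (- 1 - \<delta>) * \<bar>x\<bar> powr \<delta>)" by simp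
    also have "\<bar>x\<bar> powr (- 1 - \<delta>) * \<bar>x\<bar> powr \<delta> = inverse \<bar>x\<bar>"
      using x0 powr_minus[of "\<bar>x\<bar>" 1] by (simp add: powr_add[symmetric])
    finally have "\<bar>x\<bar> * (K x * exp (W x)) \<le> \<bar>x\<bar> * (\<bar>C\<bar> * exp c * inverse \<bar>x\<bar>)" by (rule mult_left_mono) simp
    also have "\<dots> = \<bar>C\<bar> * exp c" using x0 by simp
    finally show ?thesis unfolding f_def .
  qed
  have "\<bar>x\<bar> * f x \<le> \<bar>C\<bar> * exp c + \<bar>B\<bar>" for x
  proof (cases "R \<le> \<bar>x\<bar>")
    case True
    then show ?thesis using far[OF True] by simp
  next
    case False
    then have "x \<in> {- R..R}" by auto
    then have "norm (\<bar>x\<bar> * f x) \<le> B" using B by blast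
    moreover have "0 \<le> \<bar>C\<bar> * exp c" by simp
    ultimately show ?thesis unfolding real_norm_def by linarith
  qed
  then show thesis using that[of "\<bar>C\<bar> * exp c + \<bar>B\<bar>"] by simp
qed

end

section \<open>Moving planes\<close>

lemma integral_split_at:
  fixes g :: "real \<Rightarrow> real"
  assumes g: "integrable lborel g"
  shows "(LINT x|lborel. g x) = (LINT x|lborel. indicator {c..} x * (g x + g (2 * c - x)))"
proof -
  have [measurable]: "g \<in> borel_measurable borel" using g by auto
  have i: "integrable lborel (\<lambda>x. g (c + x))" using lborel_integrable_real_affine[OF g, of 1 c] by simp
  have "(LINT x|lborel. g x) = (LINT x|lborel. g (c + x))"
    using lborel_integral_real_affine[of 1 g c] by simp
  also have "\<dots> = (LINT x|lborel. indicator {0..} x *\<^sub>R (g (c + x) + g (c + - x)))"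
    by (rule integral_split_at_zero[OF i])
  also have "\<dots> = (LINT x|lborel. indicator {c..} (c + 1 * x) * (g (c + 1 * x) + g (2 * c - (c + 1 * x))))"
    by (rule Bochner_Integration.integral_cong[OF refl]) (simp add: indicator_def)
  also have "\<dots> = (LINT x|lborel. indicator {c..} x * (g x + g (2 * c - x)))"
    using lborel_integral_real_affine[of 1 "\<lambda>x. indicator {c..} x * (g x + g (2 * c - x))" c] by simp
  finally show ?thesis .
qed

text \<open>Logarithmic kernel of the half-line \<open>t > l\<close>: a pole at \<open>x\<close>
  balanced by its mirror image at \<open>2 * l - x\<close>, hence positive inside and zero for
  \<open>x = l\<close>.\<close>

definition green :: "real \<Rightarrow> real \<Rightarrow> real \<Rightarrow> real"
  where "green l x t = ln \<bar>t + x - 2 * l\<bar> - ln \<bar>t - x\<bar>"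

lemma green_measurable [measurable]: "green l x \<in> borel_measurable borel"
  unfolding green_def by measurable

lemma green_pos:
  assumes "l < x" "l < t" "t \<noteq> x"
  shows "0 < green l x t"
proof -
  have "\<bar>t - x\<bar> < \<bar>t + x - 2 * l\<bar>" using assms by (auto simp: abs_if)
  then show ?thesis unfolding green_def using assms(3) by simp
qed

lemma green_nonneg: "l \<le> x \<Longrightarrow> l \<le> t \<Longrightarrow> t \<noteq> x \<Longrightarrow> 0 \<le> green l x t"
proof -
  assume a: "l \<le> x" "l \<le> t" "t \<noteq> x"
  then have "\<bar>t - x\<bar> \<le> \<bar>t + x - 2 * l\<bar>" by (auto simp: abs_if)
  then show ?thesis unfolding green_def using a(3) by simp
qed

text \<open>Moving the plane back to 0 only increases the kernel, so one bound for
  \<open>green 0\<close> serves every \<open>l \<ge> 0\<close>.\<close>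

lemma green_mono:
  assumes "0 \<le> l" "l \<le> x" "l < t" "t \<noteq> x"
  shows "green l x t \<le> green 0 x t"
proof -
  have "0 < t + x - 2 * l" "t + x - 2 * l \<le> t + x" using assms by simp_all
  then have "ln (t + x - 2 * l) \<le> ln (t + x)" by simp
  then show ?thesis unfolding green_def using \<open>0 < t + x - 2 * l\<close> assms by simp
qed

context liouville_solution begin

text \<open>Uniformity in \<open>x\<close> is a scaling effect: \<open>green 0 x t\<close> depends
  only on \<open>t / x\<close>, and \<open>t * f t \<le> c\<close> compares \<open>f\<close> with
  the scale-invariant density \<open>c / t\<close>. The square appears because Young's inequality
  separates the kernel from the mass of \<open>f\<close> in
  \<open>moving_plane_step\<close>.\<close>

lemma green_square_bound:
  obtains B where "B > 0" "\<And>x. 0 < x \<Longrightarrow> integrable lborel (\<lambda>t. indicator {0<..} t * (f t * (green 0 x t)\<^sup>2))"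
    "\<And>x. 0 < x \<Longrightarrow> (LINT t|lborel. indicator {0<..} t * (f t * (green 0 x t)\<^sup>2)) \<le> B"
proof -
  obtain c where c: "c \<ge> 0" "\<And>x. \<bar>x\<bar> * f x \<le> c" by (rule f_decay, rule that) assumption+
  define m where "m = (LINT x|lborel. f x)"
  have m0: "0 \<le> m" unfolding m_def using f_pos by (intro integral_nonneg_AE AE_I2) (simp add: less_imp_le)
  \<comment> \<open>\<open>4 * m\<close> comes from the region where the kernel is at most 2, and
    \<open>256 * c\<close> from \<open>128 * c * sqrt 3\<close> near the pole.\<close>
  define B where "B = 4 * m + 256 * c + 1"
  have "integrable lborel (\<lambda>t. indicator {0<..} t * (f t * (green 0 x t)\<^sup>2)) \<and>
      (LINT t|lborel. indicator {0<..} t * (f t * (green 0 x t)\<^sup>2)) \<le> B" if x: "0 < x" for x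
  proof -
    let ?S = "\<lambda>t. indicator {- x..x} (t - x) / sqrt \<bar>t - x\<bar>"
    let ?b = "\<lambda>t. 4 * f t + (2 * c / x * (16 * sqrt (3 * x))) * ?S t"
    have isq: "integrable lborel ?S" "(LINT t|lborel. ?S t) = 4 * sqrt x"
      using lborel_integrable_real_affine[OF integrable_inverse_sqrt[of x], of 1 "- x"]
        lborel_integral_real_affine[of 1 "\<lambda>t. indicator {- x..x} t / sqrt \<bar>t\<bar>" "- x"] LINT_inverse_sqrt[of x] x
      by simp_all
    have hb: "has_bochner_integral lborel ?b (4 * m + (2 * c / x * (16 * sqrt (3 * x))) * (4 * sqrt x))"
      using f_int isq by (intro has_bochner_integral_add has_bochner_integral_mult_right) (simp_all add: has_bochner_integral_iff m_def)
    have S0: "0 \<le> (2 * c / x * (16 * sqrt (3 * x))) * ?S t" for t using c x by simp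
    have le: "indicator {0<..} t * (f t * (green 0 x t)\<^sup>2) \<le> ?b t" if tx: "t \<noteq> x" for t
    proof (cases "0 < t")
      case True
      have g0: "0 \<le> green 0 x t" using True x tx by (intro green_nonneg) simp_all
      have geq: "green 0 x t = ln (t + x) - ln \<bar>t - x\<bar>" using True x by (simp add: green_def)
      have p: "0 < \<bar>t - x\<bar>" using tx by simp
      have "f t * (green 0 x t)\<^sup>2 \<le> ?b t"
      proof (cases "t + x \<le> 3 * \<bar>t - x\<bar>")
        case far: True
        have "ln (t + x) \<le> ln (3 * \<bar>t - x\<bar>)" using far p True x by simp
        also have "\<dots> = ln 3 + ln \<bar>t - x\<bar>" using p by (simp add: ln_mult)
        finally have "green 0 x t \<le> ln 3" unfolding geq by simp
        also have "\<dots> \<le> 2" using ln_add_one_self_le_self[of "2::real"] by simp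
        finally have "(green 0 x t)\<^sup>2 \<le> 2\<^sup>2" using g0 by (intro power_mono) simp_all
        then have "f t * (green 0 x t)\<^sup>2 \<le> f t * 4" using f_pos[of t] by (intro mult_left_mono) simp_all
        then show ?thesis using S0[of t] by linarith
      next
        case near: False
        \<comment> \<open>Failure of \<open>t + x \<le> 3 * |t - x|\<close> means that
          \<open>t\<close> lies between \<open>x / 2\<close> and \<open>2 * x\<close>, and there the
          decay of \<open>f\<close> gives \<open>f t \<le> 2 * c / x\<close>.\<close>
        have tb: "x / 2 \<le> t" "t \<le> 2 * x" using near True x by (auto simp: abs_if split: if_splits)
        have St: "?S t = 1 / sqrt \<bar>t - x\<bar>" using tb x by (simp add: indicator_def)
        have q: "0 < (t + x) / \<bar>t - x\<bar>" using p True x by simp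
        have "green 0 x t = ln ((t + x) / \<bar>t - x\<bar>)" unfolding geq using p True x by (simp add: ln_div)
        also have "\<dots> \<le> 4 * sqrt (sqrt ((t + x) / \<bar>t - x\<bar>))" by (rule ln_le_sqrt_sqrt[OF q])
        finally have "(green 0 x t)\<^sup>2 \<le> (4 * sqrt (sqrt ((t + x) / \<bar>t - x\<bar>)))\<^sup>2" using g0 by (intro power_mono)
        also have "\<dots> = 16 * sqrt ((t + x) / \<bar>t - x\<bar>)"
        proof -
          have "0 \<le> sqrt ((t + x) / \<bar>t - x\<bar>)" by (rule real_sqrt_ge_zero[OF less_imp_le[OF q]])
          then show ?thesis by (simp only: power_mult_distrib real_sqrt_pow2) simp
        qed
        also have "\<dots> = 16 * (sqrt (t + x) * (1 / sqrt \<bar>t - x\<bar>))" by (simp add: real_sqrt_divide)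
        also have "\<dots> \<le> 16 * (sqrt (3 * x) * (1 / sqrt \<bar>t - x\<bar>))"
          using tb by (intro mult_left_mono mult_right_mono) simp_all
        finally have 1: "(green 0 x t)\<^sup>2 \<le> 16 * (sqrt (3 * x) * (1 / sqrt \<bar>t - x\<bar>))" .
        have "(x / 2) * f t \<le> t * f t" using tb f_pos[of t] by (intro mult_right_mono) simp_all
        also have "\<dots> \<le> c" using c(2)[of t] True by simp
        finally have 2: "f t \<le> 2 * c / x" using x by (simp add: pos_le_divide_eq mult.commute)
        have "f t * (green 0 x t)\<^sup>2 \<le> (2 * c / x) * (16 * (sqrt (3 * x) * (1 / sqrt \<bar>t - x\<bar>)))"
          using 1 2 f_pos[of t] x c by (intro mult_mono) simp_all
        also have "\<dots> = (2 * c / x * (16 * sqrt (3 * x))) * ?S t" unfolding St by (simp only: mult.assoc)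
        finally show ?thesis using f_pos[of t] by linarith
      qed
      then show ?thesis using True by simp
    next
      case False
      then show ?thesis using S0[of t] f_pos[of t] by simp
    qed
    have AEle: "AE t in lborel. indicator {0<..} t * (f t * (green 0 x t)\<^sup>2) \<le> ?b t"
      using AE_lborel_singleton[of x] by eventually_elim (rule le)
    have i: "integrable lborel (\<lambda>t. indicator {0<..} t * (f t * (green 0 x t)\<^sup>2))"
    proof (rule Bochner_Integration.integrable_bound)
      show "integrable lborel ?b" using hb by (simp only: has_bochner_integral_iff)
      show "AE t in lborel. norm (indicator {0<..} t * (f t * (green 0 x t)\<^sup>2)) \<le> norm (?b t)"
        using AEle
      proof eventually_elim
        case (elim t)
        have "0 \<le> indicator {0<..} t * (f t * (green 0 x t)\<^sup>2)" using f_pos[of t] by (simp add: less_imp_le)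
        then show ?case using elim unfolding real_norm_def by linarith
      qed
    qed measurable
    have "(LINT t|lborel. indicator {0<..} t * (f t * (green 0 x t)\<^sup>2)) \<le> (LINT t|lborel. ?b t)"
      by (rule integral_mono_AE[OF i _ AEle]) (use hb in \<open>simp only: has_bochner_integral_iff\<close>)
    also have "\<dots> = 4 * m + (2 * c / x * (16 * sqrt (3 * x))) * (4 * sqrt x)" using hb by (simp only: has_bochner_integral_iff)
    also have "(2 * c / x * (16 * sqrt (3 * x))) * (4 * sqrt x) = 128 * c * sqrt 3 * (sqrt x * sqrt x / x)"
      by (simp add: real_sqrt_mult)
    also have "sqrt x * sqrt x / x = 1" using x by simp
    also have "4 * m + 128 * c * sqrt 3 * 1 \<le> 4 * m + 128 * c * 2 * 1"
      using c(1) real_le_lsqrt[of 2 3] by (intro add_left_mono mult_right_mono mult_left_mono) simp_all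
    also have "\<dots> \<le> B" unfolding B_def by simp
    finally show ?thesis using i by blast
  qed
  moreover have "B > 0" unfolding B_def using m0 c(1) by simp
  ultimately show thesis using that[of B] by blast
qed

definition refl_diff :: "real \<Rightarrow> real \<Rightarrow> real" where "refl_diff l x = W (2 * l - x) - W x"

definition dens_diff :: "real \<Rightarrow> real \<Rightarrow> real" where "dens_diff l t = f (2 * l - t) - f t"

text \<open>The two-point formula for \<open>x\<close> and its mirror image has a kernel that is odd
  under reflection in \<open>l\<close>; folding at \<open>l\<close> therefore turns \<open>f\<close>
  into its reflected difference.\<close>

lemma refl_diff_repr:
  shows refl_diff_integrable: "integrable lborel (\<lambda>t. indicator {l..} t * (dens_diff l t * green l x t))"
    and refl_diff_formula: "pi * refl_diff l x = (LINT t|lborel. indicator {l..} t * (dens_diff l t * green l x t))"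
proof -
  define g where "g t = f t * (ln \<bar>t - x\<bar> - ln \<bar>t - (2 * l - x)\<bar>)" for t
  have gi: "integrable lborel g" unfolding g_def f_def by (rule integrable_repr)
  have gr: "pi * refl_diff l x = (LINT t|lborel. g t)" unfolding g_def f_def refl_diff_def by (rule repr)
  have "integrable lborel (\<lambda>t. g (2 * l - t))" using lborel_integrable_real_affine[OF gi, of "-1" "2 * l"] by simp
  from integrable_mult_indicator[OF _ Bochner_Integration.integrable_add[OF gi this], of "{l..}"]
  have i: "integrable lborel (\<lambda>t. indicator {l..} t * (g t + g (2 * l - t)))" by simp
  have e: "g t + g (2 * l - t) = dens_diff l t * green l x t" for t
  proof -
    have 1: "\<bar>t - (2 * l - x)\<bar> = \<bar>t + x - 2 * l\<bar>" by (simp add: algebra_simps)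
    have 2: "\<bar>2 * l - t - x\<bar> = \<bar>t + x - 2 * l\<bar>" using abs_minus_commute[of "2 * l" "t + x"] by (simp add: algebra_simps)
    have 3: "\<bar>2 * l - t - (2 * l - x)\<bar> = \<bar>t - x\<bar>" using abs_minus_commute[of x t] by simp
    show ?thesis unfolding g_def 1 2 3 dens_diff_def green_def by (simp add: algebra_simps)
  qed
  show "integrable lborel (\<lambda>t. indicator {l..} t * (dens_diff l t * green l x t))" using i unfolding e .
  show "pi * refl_diff l x = (LINT t|lborel. indicator {l..} t * (dens_diff l t * green l x t))"
    unfolding gr integral_split_at[OF gi, of l] e ..
qed

lemma refl_diff_meas [measurable]: "refl_diff l \<in> borel_measurable borel"
  unfolding refl_diff_def by measurable

text \<open>For \<open>t\<close> to the right of a plane with \<open>l \<ge> 0\<close> the mirror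
  image is closer to the origin, so the weight there is at least \<open>K t\<close>. Here the
  monotonicity of \<open>K\<close> enters.\<close>

lemma dens_diff_ge:
  assumes "0 \<le> l" "l \<le> t"
  shows "K t * (exp (W (2 * l - t)) - exp (W t)) \<le> dens_diff l t"
proof -
  have "\<bar>2 * l - t\<bar> \<le> \<bar>t\<bar>" using assms by (auto simp: abs_if)
  then have "K t * exp (W (2 * l - t)) \<le> K (2 * l - t) * exp (W (2 * l - t))"
    using K_mono by (intro mult_right_mono) simp_all
  then show ?thesis unfolding dens_diff_def f_def by (simp add: right_diff_distrib)
qed

lemma dens_diff_nonneg:
  assumes "0 \<le> l" "l \<le> t" "0 \<le> refl_diff l t"
  shows "0 \<le> dens_diff l t"
proof -
  have "0 \<le> K t * (exp (W (2 * l - t)) - exp (W t))" using assms(3) K_pos[of t] by (simp add: refl_diff_def)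
  then show ?thesis using dens_diff_ge[OF assms(1,2)] by linarith
qed

lemma dens_diff_ge_neg_part:
  assumes "0 \<le> l" "l \<le> t"
  shows "f t * refl_diff l t \<le> dens_diff l t"
proof -
  have "1 + refl_diff l t \<le> exp (refl_diff l t)" by (rule exp_ge_add_one_self)
  then have "refl_diff l t \<le> exp (refl_diff l t) - 1" by linarith
  then have "exp (W t) * refl_diff l t \<le> exp (W t) * (exp (refl_diff l t) - 1)" by (rule mult_left_mono) simp
  also have "\<dots> = exp (W (2 * l - t)) - exp (W t)" by (simp add: refl_diff_def right_diff_distrib exp_add[symmetric])
  finally have "K t * (exp (W t) * refl_diff l t) \<le> K t * (exp (W (2 * l - t)) - exp (W t))"
    using K_pos[of t] by (intro mult_left_mono) simp_all
  then show ?thesis using dens_diff_ge[OF assms] unfolding f_def by simp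
qed

lemma refl_diff_cont: "continuous_on UNIV (refl_diff l)" "continuous_on UNIV (\<lambda>l. refl_diff l x)"
  unfolding refl_diff_def
  by (auto intro!: continuous_intros continuous_on_compose2[OF W_cont])

lemma dens_diff_cont: "continuous_on UNIV (dens_diff l)"
  unfolding dens_diff_def by (auto intro!: continuous_intros continuous_on_compose2[OF f_cont])

text \<open>A lower bound \<open>- s\<close> for \<open>refl_diff\<close> beyond the plane
  reproduces itself as \<open>- s / 2\<close> when \<open>f\<close> has small mass on the set where
  \<open>refl_diff\<close> is negative; iteration gives nonnegativity. This replaces a minimum
  principle, for which a minimum would have to be attained.\<close>

lemma moving_plane_step:
  obtains \<eta> where "\<eta> > 0"
    "\<And>l x. 0 \<le> l \<Longrightarrow> (LINT t|lborel. indicator {t. l \<le> t \<and> refl_diff l t < 0} t * f t) \<le> \<eta> \<Longrightarrow> l \<le> x \<Longrightarrow> 0 \<le> refl_diff l x"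
proof -
  obtain B where B: "B > 0" "\<And>x. 0 < x \<Longrightarrow> integrable lborel (\<lambda>t. indicator {0<..} t * (f t * (green 0 x t)\<^sup>2))"
    "\<And>x. 0 < x \<Longrightarrow> (LINT t|lborel. indicator {0<..} t * (f t * (green 0 x t)\<^sup>2)) \<le> B"
    by (rule green_square_bound, rule that) assumption+
  \<comment> \<open>Chosen so that \<open>\<epsilon> * B\<close> and
    \<open>1 / (4 * \<epsilon>) * (1 / B)\<close> are both one half; the mass threshold of the lemma
    is \<open>1 / B\<close>.\<close>
  define \<epsilon> where "\<epsilon> = 1 / (2 * B)"
  have \<epsilon>: "\<epsilon> > 0" using B(1) by (simp add: \<epsilon>_def)
  have "0 \<le> refl_diff l x"
    if l: "0 \<le> l" and small: "(LINT t|lborel. indicator {t. l \<le> t \<and> refl_diff l t < 0} t * f t) \<le> 1 / B" and x: "l \<le> x" for l x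
  proof -
    let ?A = "{t. l \<le> t \<and> refl_diff l t < 0}"
    have mA [measurable]: "?A \<in> sets borel" by measurable
    \<comment> \<open>The density difference is at least \<open>- s * f t\<close> on
      \<open>?A\<close> and nonnegative elsewhere. Young's inequality splits the product of
      \<open>f\<close> and the kernel on \<open>?A\<close> into the squared-kernel integral and the
      mass of \<open>?A\<close>.\<close>
    have claim: "- s \<le> pi * refl_diff l x"
      if s: "0 \<le> s" and ge: "\<And>t. l \<le> t \<Longrightarrow> - (s * (indicator ?A t * f t)) \<le> dens_diff l t" and x: "l < x" for s x
    proof -
      have x0: "0 < x" using x l by simp
      let ?b = "\<lambda>t. - s * (\<epsilon> * (indicator {0<..} t * (f t * (green 0 x t)\<^sup>2)) + 1 / (4 * \<epsilon>) * (indicator ?A t * f t))"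
      have hb: "has_bochner_integral lborel ?b (- s * (\<epsilon> * (LINT t|lborel. indicator {0<..} t * (f t * (green 0 x t)\<^sup>2)) +
          1 / (4 * \<epsilon>) * (LINT t|lborel. indicator ?A t * f t)))"
        using B(2)[OF x0] f_set_int[OF mA]
        by (intro has_bochner_integral_add has_bochner_integral_mult_right) (simp_all only: has_bochner_integral_iff)
      have "(LINT t|lborel. ?b t) \<le> (LINT t|lborel. indicator {l..} t * (dens_diff l t * green l x t))"
      proof (rule integral_mono_AE)
        show "integrable lborel ?b" using hb by (simp only: has_bochner_integral_iff)
        show "integrable lborel (\<lambda>t. indicator {l..} t * (dens_diff l t * green l x t))" by (rule refl_diff_integrable)
        show "AE t in lborel. ?b t \<le> indicator {l..} t * (dens_diff l t * green l x t)"
          using AE_lborel_singleton[of x] AE_lborel_singleton[of l]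
        proof eventually_elim
          case (elim t)
          have bn: "0 \<le> \<epsilon> * (indicator {0<..} t * (f t * (green 0 x t)\<^sup>2)) + 1 / (4 * \<epsilon>) * (indicator ?A t * f t)"
            using \<epsilon> f_pos[of t] by (intro add_nonneg_nonneg mult_nonneg_nonneg) simp_all
          show ?case
          proof (cases "l < t")
            case True
            then have t0: "0 < t" using l by simp
            have g: "0 \<le> green l x t" using True x elim by (intro green_nonneg) simp_all
            have gm: "green l x t \<le> green 0 x t" using True x l elim by (intro green_mono) simp_all
            have am: "green 0 x t \<le> \<epsilon> * (green 0 x t)\<^sup>2 + 1 / (4 * \<epsilon>)"
            proof -
              have "0 \<le> (2 * \<epsilon> * green 0 x t - 1)\<^sup>2 / (4 * \<epsilon>)" using \<epsilon> by simp
              also have "\<dots> = \<epsilon> * (green 0 x t)\<^sup>2 - green 0 x t + 1 / (4 * \<epsilon>)"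
                using \<epsilon> by (simp add: power2_eq_square field_simps)
              finally show ?thesis by simp
            qed
            have "indicator ?A t * f t * green l x t \<le> indicator ?A t * f t * (\<epsilon> * (green 0 x t)\<^sup>2 + 1 / (4 * \<epsilon>))"
              using gm am f_pos[of t] by (intro mult_left_mono) simp_all
            also have "\<dots> \<le> \<epsilon> * (f t * (green 0 x t)\<^sup>2) + 1 / (4 * \<epsilon>) * (indicator ?A t * f t)"
            proof -
              have "indicator ?A t * (\<epsilon> * (f t * (green 0 x t)\<^sup>2)) \<le> 1 * (\<epsilon> * (f t * (green 0 x t)\<^sup>2))"
                using \<epsilon> f_pos[of t] by (intro mult_right_mono) simp_all
              moreover have "indicator ?A t * f t * (\<epsilon> * (green 0 x t)\<^sup>2 + 1 / (4 * \<epsilon>)) =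
                  indicator ?A t * (\<epsilon> * (f t * (green 0 x t)\<^sup>2)) + 1 / (4 * \<epsilon>) * (indicator ?A t * f t)"
                by (simp only: distrib_left mult_ac)
              ultimately show ?thesis by linarith
            qed
            finally have "s * (indicator ?A t * f t * green l x t) \<le> s * (\<epsilon> * (f t * (green 0 x t)\<^sup>2) + 1 / (4 * \<epsilon>) * (indicator ?A t * f t))"
              using s by (rule mult_left_mono)
            moreover have "- (s * (indicator ?A t * f t)) * green l x t \<le> dens_diff l t * green l x t"
              using ge[of t] True g by (intro mult_right_mono) simp_all
            ultimately show ?thesis using True t0 by simp
          next
            case False
            then have "t \<notin> {l..}" using elim by simp
            moreover have "- s * (\<epsilon> * (indicator {0<..} t * (f t * (green 0 x t)\<^sup>2)) + 1 / (4 * \<epsilon>) * (indicator ?A t * f t)) \<le> 0"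
              using s bn by (intro mult_nonpos_nonneg) simp_all
            ultimately show ?thesis by simp
          qed
        qed
      qed
      also have "\<dots> = pi * refl_diff l x" by (rule refl_diff_formula[symmetric])
      finally have le: "(LINT t|lborel. ?b t) \<le> pi * refl_diff l x" .
      have "\<epsilon> * (LINT t|lborel. indicator {0<..} t * (f t * (green 0 x t)\<^sup>2)) + 1 / (4 * \<epsilon>) * (LINT t|lborel. indicator ?A t * f t)
          \<le> \<epsilon> * B + 1 / (4 * \<epsilon>) * (1 / B)"
        using B(3)[OF x0] small \<epsilon> by (intro add_mono mult_left_mono) simp_all
      also have "\<dots> = 1" using B(1) by (simp add: \<epsilon>_def)
      finally have "s * (\<epsilon> * (LINT t|lborel. indicator {0<..} t * (f t * (green 0 x t)\<^sup>2)) + 1 / (4 * \<epsilon>) * (LINT t|lborel. indicator ?A t * f t)) \<le> s * 1"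
        using s by (rule mult_left_mono)
      moreover have "(LINT t|lborel. ?b t) = - s * (\<epsilon> * (LINT t|lborel. indicator {0<..} t * (f t * (green 0 x t)\<^sup>2)) +
          1 / (4 * \<epsilon>) * (LINT t|lborel. indicator ?A t * f t))"
        using hb by (simp only: has_bochner_integral_iff)
      ultimately show ?thesis using le by linarith
    qed
    \<comment> \<open>The gain of a factor one half is nothing but \<open>pi > 2\<close>.\<close>
    have half: "- (s / 2) \<le> refl_diff l x" if s: "0 \<le> s" and c: "- s \<le> pi * refl_diff l x" for s x
    proof (cases "refl_diff l x < 0")
      case True
      then have "pi * refl_diff l x \<le> 2 * refl_diff l x" using pi_gt3 by (intro mult_right_mono_neg) simp_all
      then show ?thesis using c by linarith
    qed (use s in linarith)
    have l0: "refl_diff l l = 0" by (simp add: refl_diff_def)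
    have iter: "- ((1 / 2) ^ k) \<le> refl_diff l x" if "l \<le> x" for k x
      using that
    proof (induction k arbitrary: x)
      case 0
      have "- 1 \<le> pi * refl_diff l y" if "l < y" for y
      proof (rule claim[OF _ _ that])
        fix t assume t: "l \<le> t"
        show "- (1 * (indicator ?A t * f t)) \<le> dens_diff l t"
        proof (cases "refl_diff l t < 0")
          case True
          \<comment> \<open>The first round has \<open>s = 1\<close> and rests on the positivity of
            \<open>f\<close> at the mirror image alone; no bound on \<open>refl_diff\<close> is
            known yet.\<close>
          have "0 < f (2 * l - t)" by (rule f_pos)
          then show ?thesis using True t by (simp add: dens_diff_def)
        next
          case False
          then show ?thesis using dens_diff_nonneg[OF l t] by simp
        qed
      qed simp
      then have h: "- (1 / 2) \<le> refl_diff l y" if "l < y" for y using half[of 1 y] that by simp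
      show ?case
      proof (cases "x = l")
        case False
        then have "- (1 / 2) \<le> refl_diff l x" using h[of x] 0 by simp
        then show ?thesis by simp
      qed (simp add: l0)
    next
      case (Suc k)
      have "- ((1 / 2) ^ k) \<le> pi * refl_diff l y" if "l < y" for y
      proof (rule claim[OF _ _ that])
        fix t assume t: "l \<le> t"
        show "- ((1 / 2) ^ k * (indicator ?A t * f t)) \<le> dens_diff l t"
        proof (cases "refl_diff l t < 0")
          case True
          have "f t * - ((1 / 2) ^ k) \<le> f t * refl_diff l t"
            using Suc.IH[OF t] f_pos[of t] by (intro mult_left_mono) simp_all
          then show ?thesis using True t dens_diff_ge_neg_part[OF l t] by (simp add: mult.commute)
        next
          case False
          then show ?thesis using dens_diff_nonneg[OF l t] by simp
        qed
      qed simp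
      then have h: "- ((1 / 2) ^ k / 2) \<le> refl_diff l y" if "l < y" for y using half[of "(1 / 2) ^ k" y] that by simp
      show ?case
      proof (cases "x = l")
        case True
        then show ?thesis using l0 by simp
      next
        case False
        then show ?thesis using h[of x] Suc.prems by simp
      qed
    qed
    have "(\<lambda>k. - ((1 / 2 :: real) ^ k)) \<longlonglongrightarrow> - 0" by (intro tendsto_minus LIMSEQ_realpow_zero) simp_all
    then show ?thesis using iter[OF x] by (intro LIMSEQ_le_const2[of "\<lambda>k. - ((1 / 2 :: real) ^ k)" 0]) auto
  qed
  then show thesis using that[of "1 / B"] B(1) by simp
qed

text \<open>A zero at one \<open>x\<close> forces the density difference to vanish on the whole
  half-line, since \<open>green\<close> is positive there. Then \<open>K\<close> is symmetric about
  \<open>l\<close> as well as about 0, so it returns to the value \<open>K 0\<close> at all points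
  \<open>2 * l * n\<close>, against its decay.\<close>

lemma refl_diff_strict:
  assumes l: "0 < l" and nn: "\<And>x. l \<le> x \<Longrightarrow> 0 \<le> refl_diff l x" and x: "l < x"
  shows "0 < refl_diff l x"
proof (rule ccontr)
  assume "\<not> 0 < refl_diff l x"
  then have z: "refl_diff l x = 0" using nn[of x] x by simp
  have ae0: "AE t in lborel. 0 \<le> indicator {l..} t * (dens_diff l t * green l x t)"
    using AE_lborel_singleton[of x]
  proof eventually_elim
    case (elim t)
    then show ?case using green_nonneg[of l x t] dens_diff_nonneg[of l t] nn[of t] l x by (cases "l \<le> t") simp_all
  qed
  have "AE t in lborel. indicator {l..} t * (dens_diff l t * green l x t) = 0"
    using integral_nonneg_eq_0_iff_AE[OF refl_diff_integrable ae0] refl_diff_formula[of l x] z by simp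
  then have "AE t in lborel. t \<in> {l<..} \<longrightarrow> t \<in> {t. dens_diff l t = 0}"
    using AE_lborel_singleton[of x]
  proof eventually_elim
    case (elim t)
    then show ?case using green_pos[of l x t] x by auto
  qed
  then have ae: "AE t in lebesgue. t \<in> {l<..} \<longrightarrow> t \<in> {t. dens_diff l t = 0}" by (rule AE_completion)
  have cl: "closed {t. dens_diff l t = 0}"
    by (intro closed_Collect_eq dens_diff_cont continuous_on_const)
  have d0: "dens_diff l t = 0" if "l < t" for t
    using mem_closed_if_AE_lebesgue_open[OF _ cl ae, of t] that by simp
  \<comment> \<open>Both factors of \<open>f\<close> are at least as large at the mirror image as at
    \<open>t\<close>, so equality of the positive products forces equality of the factors.\<close>
  have Keq: "K (2 * l - t) = K t" if t: "l < t" for t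
  proof -
    have le: "K t \<le> K (2 * l - t)" using t l by (intro K_mono) (auto simp: abs_if)
    have "exp (W t) \<le> exp (W (2 * l - t))" using nn[of t] t by (simp add: refl_diff_def)
    then have "K (2 * l - t) * exp (W t) \<le> K (2 * l - t) * exp (W (2 * l - t))"
      using K_pos[of "2 * l - t"] by (intro mult_left_mono) simp_all
    also have "\<dots> = K t * exp (W t)" using d0[OF t] by (simp add: dens_diff_def f_def)
    finally show ?thesis using le by simp
  qed
  have K0: "K (2 * l * real n) = K 0" for n
  proof (induction n)
    case (Suc n)
    have n0: "0 \<le> l * real n" using l by simp
    have "K (2 * l - 2 * l * real (Suc n)) = K (2 * l * real (Suc n))"
      using l n0 by (intro Keq) (simp add: distrib_left add_pos_nonneg)
    moreover have "2 * l - 2 * l * real (Suc n) = - (2 * l * real n)" by (simp add: distrib_left)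
    ultimately show ?case using Suc K_even by simp
  qed simp
  have "(\<lambda>n. C * (2 * l * real (Suc n)) powr (- 1 - \<delta>)) \<longlonglongrightarrow> C * 0"
    using l \<delta> by (intro tendsto_mult tendsto_const) real_asymp
  moreover have "K 0 \<le> C * (2 * l * real (Suc n)) powr (- 1 - \<delta>)" for n
  proof -
    define y where "y = 2 * l * real (Suc n)"
    have y: "y > 0" using l by (simp add: y_def)
    have "K y = K 0" unfolding y_def by (rule K0)
    then show ?thesis using K_decay[of y] y unfolding y_def[symmetric] by simp
  qed
  ultimately have "K 0 \<le> C * 0" by (intro LIMSEQ_le_const) auto
  then show False using K_pos[of 0] by simp
qed

text \<open>The plane comes in from infinity. Small tail mass starts it, continuity in
  \<open>l\<close> carries it to limits from above, and strictness at a good position makes the bad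
  sets just below it small in \<open>f\<close>-mass, so it cannot stop at a positive
  position.\<close>

lemma refl_diff_nonneg:
  assumes l: "0 < l" "l \<le> x"
  shows "0 \<le> refl_diff l x"
proof -
  define good where "good l \<longleftrightarrow> (\<forall>x\<ge>l. 0 \<le> refl_diff l x)" for l
  obtain \<eta> where \<eta>: "\<eta> > 0"
    "\<And>l x. 0 \<le> l \<Longrightarrow> (LINT t|lborel. indicator {t. l \<le> t \<and> refl_diff l t < 0} t * f t) \<le> \<eta> \<Longrightarrow> l \<le> x \<Longrightarrow> 0 \<le> refl_diff l x"
    by (rule moving_plane_step, rule that) assumption+
  obtain R where R: "R > 0" "(LINT x|lborel. indicator {x. R \<le> \<bar>x\<bar>} x * f x) \<le> \<eta>" by (rule f_tail[OF \<eta>(1)])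
  have mA [measurable]: "{t. l \<le> t \<and> refl_diff l t < 0} \<in> sets borel" for l by measurable
  have far: "good l" if "R \<le> l" for l
  proof -
    have "(LINT t|lborel. indicator {t. l \<le> t \<and> refl_diff l t < 0} t * f t) \<le> (LINT x|lborel. indicator {x. R \<le> \<bar>x\<bar>} x * f x)"
      using that f_pos by (intro integral_mono f_set_int mA) (auto simp: indicator_def less_imp_le)
    then show ?thesis unfolding good_def using \<eta>(2)[of l] R that by simp
  qed
  have limit: "good s" if "\<And>\<mu>. s < \<mu> \<Longrightarrow> good \<mu>" for s
    unfolding good_def
  proof (intro allI impI)
    fix x assume "s \<le> x"
    show "0 \<le> refl_diff s x"
    proof (cases "x = s")
      case False
      then have sx: "s < x" using \<open>s \<le> x\<close> by simp
      have "isCont (\<lambda>l. refl_diff l x) s" using refl_diff_cont(2) continuous_on_eq_continuous_at[OF open_UNIV] by blast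
      then have "((\<lambda>l. refl_diff l x) \<longlongrightarrow> refl_diff s x) (at_right s)"
        unfolding isCont_def by (rule filterlim_mono) (simp_all add: at_le)
      moreover have "\<forall>\<^sub>F l in at_right s. 0 \<le> refl_diff l x"
        using eventually_at_right_real[OF sx] by eventually_elim (use that in \<open>auto simp: good_def\<close>)
      ultimately show ?thesis by (rule tendsto_lowerbound) simp
    qed (simp add: refl_diff_def)
  qed
  have step: "\<exists>d>0. \<forall>\<mu>. s - d < \<mu> \<and> \<mu> < s \<longrightarrow> good \<mu>" if s: "0 < s" and g: "good s" for s
  proof (rule ccontr)
    assume no: "\<not> (\<exists>d>0. \<forall>\<mu>. s - d < \<mu> \<and> \<mu> < s \<longrightarrow> good \<mu>)"
    have "\<exists>\<mu>. s - s * inverse (real (Suc n)) < \<mu> \<and> \<mu> < s \<and> \<not> good \<mu>" for n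
    proof -
      have "s * inverse (real (Suc n)) > 0" using s by simp
      then show ?thesis using no by blast
    qed
    then obtain \<mu> where \<mu>: "\<And>n. s - s * inverse (real (Suc n)) < \<mu> n" "\<And>n. \<mu> n < s" "\<And>n. \<not> good (\<mu> n)" by metis
    have \<mu>0: "0 \<le> \<mu> n" for n
    proof -
      have "s * inverse (real (Suc n)) \<le> s * 1" using s by (intro mult_left_mono) (simp_all add: inverse_le_1_iff)
      then show ?thesis using \<mu>(1)[of n] by linarith
    qed
    have \<mu>s: "\<mu> \<longlonglongrightarrow> s"
    proof (rule tendsto_sandwich)
      have "(\<lambda>n. s - s * inverse (real (Suc n))) \<longlonglongrightarrow> s - s * 0"
        by (intro tendsto_intros LIMSEQ_inverse_real_of_nat)
      then show "(\<lambda>n. s - s * inverse (real (Suc n))) \<longlonglongrightarrow> s" by simp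
    qed (use \<mu> in \<open>auto intro!: always_eventually less_imp_le\<close>)
    \<comment> \<open>Every \<open>t > s\<close> has \<open>refl_diff s t > 0\<close> and so leaves
      the bad sets eventually; every \<open>t < s\<close> eventually lies to the left of the
      planes.\<close>
    have "(\<lambda>n. LINT t|lborel. indicator {t. \<mu> n \<le> t \<and> refl_diff (\<mu> n) t < 0} t * f t) \<longlonglongrightarrow> (LINT t|(lborel::real measure). 0)"
    proof (rule integral_dominated_convergence[OF _ _ f_int])
      show "AE t in lborel. norm (indicator {t. \<mu> n \<le> t \<and> refl_diff (\<mu> n) t < 0} t * f t) \<le> f t" for n
        using f_pos by (intro AE_I2) (auto simp: indicator_def less_imp_le)
      show "AE t in lborel. (\<lambda>n. indicator {t. \<mu> n \<le> t \<and> refl_diff (\<mu> n) t < 0} t * f t) \<longlonglongrightarrow> 0"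
        using AE_lborel_singleton[of s]
      proof eventually_elim
        case (elim t)
        have "\<forall>\<^sub>F n in sequentially. 0 = indicator {t. \<mu> n \<le> t \<and> refl_diff (\<mu> n) t < 0} t * f t"
        proof (cases "t < s")
          case True
          then have "\<forall>\<^sub>F n in sequentially. t < \<mu> n" using \<mu>s order_tendstoD(1) by blast
          then show ?thesis by eventually_elim auto
        next
          case False
          then have st: "s < t" using elim by simp
          have "0 < refl_diff s t" using g s st unfolding good_def by (intro refl_diff_strict) auto
          moreover have "(\<lambda>n. refl_diff (\<mu> n) t) \<longlonglongrightarrow> refl_diff s t"
          proof -
            have "isCont (\<lambda>l. refl_diff l t) s" using refl_diff_cont(2) continuous_on_eq_continuous_at[OF open_UNIV] by blast
            then show ?thesis using \<mu>s by (rule isCont_tendsto_compose)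
          qed
          ultimately have "\<forall>\<^sub>F n in sequentially. 0 < refl_diff (\<mu> n) t" using order_tendstoD(1) by blast
          then show ?thesis by eventually_elim auto
        qed
        then show ?case by (rule Lim_transform_eventually[OF tendsto_const])
      qed
    qed simp_all
    then have "(\<lambda>n. LINT t|lborel. indicator {t. \<mu> n \<le> t \<and> refl_diff (\<mu> n) t < 0} t * f t) \<longlonglongrightarrow> 0" by simp
    from LIMSEQ_D[OF this \<eta>(1)]
    obtain n where "norm ((LINT t|lborel. indicator {t. \<mu> n \<le> t \<and> refl_diff (\<mu> n) t < 0} t * f t) - 0) < \<eta>" by blast
    then have "(LINT t|lborel. indicator {t. \<mu> n \<le> t \<and> refl_diff (\<mu> n) t < 0} t * f t) \<le> \<eta>" by simp
    then have "good (\<mu> n)" unfolding good_def using \<eta>(2)[OF \<mu>0[of n]] by blast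
    then show False using \<mu>(3) by blast
  qed
  have "good l"
  proof (rule ccontr)
    assume bad: "\<not> good l"
    define S where "S = {\<mu>. 0 < \<mu> \<and> \<not> good \<mu>}"
    have lS: "l \<in> S" using bad l by (simp add: S_def)
    have bdd: "bdd_above S"
    proof (rule bdd_aboveI)
      fix \<mu> assume "\<mu> \<in> S"
      then show "\<mu> \<le> R" using far[of \<mu>] by (cases "\<mu> \<le> R") (auto simp: S_def)
    qed
    define s where "s = Sup S"
    have ls: "l \<le> s" unfolding s_def by (rule cSup_upper[OF lS bdd])
    then have s0: "0 < s" using l by simp
    have above: "good \<mu>" if "s < \<mu>" for \<mu>
    proof (rule ccontr)
      assume "\<not> good \<mu>"
      then have "\<mu> \<in> S" using that s0 by (simp add: S_def)
      then have "\<mu> \<le> s" unfolding s_def by (rule cSup_upper[OF _ bdd])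
      then show False using that by simp
    qed
    have gs: "good s" by (rule limit[OF above])
    obtain d where d: "d > 0" "\<And>\<mu>. s - d < \<mu> \<Longrightarrow> \<mu> < s \<Longrightarrow> good \<mu>" using step[OF s0 gs] by blast
    obtain \<mu> where \<mu>: "\<mu> \<in> S" "s - d < \<mu>" using less_cSup_iff[of S "s - d"] lS bdd d(1) unfolding s_def by auto
    then have "good \<mu>" using d(2)[of \<mu>] above[of \<mu>] gs by (cases \<mu> s rule: linorder_cases) auto
    then show False using \<mu>(1) by (simp add: S_def)
  qed
  then show ?thesis using l(2) by (simp add: good_def)
qed

section \<open>Evenness and strict decrease of solutions\<close>

lemma W_less:
  assumes "a < b" "0 < a + b"
  shows "W b < W a"
proof -
  have l: "0 < (a + b) / 2" "(a + b) / 2 < b" using assms by simp_all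
  have "0 < refl_diff ((a + b) / 2) b"
    by (rule refl_diff_strict[OF l(1) refl_diff_nonneg[OF l(1)] l(2)])
  moreover have "2 * ((a + b) / 2) - b = a" by argo
  ultimately show ?thesis unfolding refl_diff_def by simp
qed

text \<open>The plane comes arbitrarily close to the origin without reaching it; \<open>b\<close> is
  compared with \<open>- b\<close> through the planes at \<open>(a + b) / 2\<close> with
  \<open>a\<close> decreasing to \<open>- b\<close>.\<close>

lemma W_le_reflect:
  assumes "0 < b"
  shows "W b \<le> W (- b)"
proof -
  have "isCont W (- b)" using W_cont continuous_on_eq_continuous_at[OF open_UNIV] by blast
  then have "(W \<longlongrightarrow> W (- b)) (at_right (- b))"
    unfolding isCont_def by (rule filterlim_mono) (simp_all add: at_le)
  moreover have "\<forall>\<^sub>F a in at_right (- b). W b \<le> W a"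
  proof -
    have "- b < b" using assms by simp
    from eventually_at_right_real[OF this] show ?thesis
      by eventually_elim (auto intro!: less_imp_le W_less)
  qed
  ultimately show ?thesis by (rule tendsto_lowerbound) simp
qed

lemma liouville_solution_reflect: "liouville_solution K (\<lambda>x. W (- x)) C \<delta>"
proof
  show "continuous_on UNIV (\<lambda>x. W (- x))" by (auto intro!: continuous_on_compose2[OF W_cont] continuous_intros)
  show "integrable lborel (\<lambda>x. K x * exp (W (- x)))"
    using lborel_integrable_real_affine[OF integrable_dens, of "-1" 0] by (simp add: K_even)
  fix y z :: real
  show "integrable lborel (\<lambda>x. K x * exp (W (- x)) * (ln \<bar>x - y\<bar> - ln \<bar>x - z\<bar>))"
    using lborel_integrable_real_affine[OF integrable_repr[of "- y" "- z"], of "-1" 0] by (simp add: K_even abs_minus_commute[of y] abs_minus_commute[of z])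
  show "pi * (W (- z) - W (- y)) = (LINT x|lborel. K x * exp (W (- x)) * (ln \<bar>x - y\<bar> - ln \<bar>x - z\<bar>))"
    using repr[of "- z" "- y"] lborel_integral_real_affine[of "-1" "\<lambda>x. K x * exp (W x) * (ln \<bar>x - - y\<bar> - ln \<bar>x - - z\<bar>)" 0]
    by (simp add: K_even abs_minus_commute[of y] abs_minus_commute[of z])
qed (use K_pos K_even K_mono K_cont \<delta> K_decay in auto)

text \<open>The reflected function solves the same integral equation because \<open>K\<close> is
  even, so \<open>W_le_reflect\<close> applies in both directions.\<close>

lemma W_even: "W (- x) = W x"
proof -
  interpret R: liouville_solution K "\<lambda>x. W (- x)" C \<delta> by (rule liouville_solution_reflect)
  have pos: "W (- b) = W b" if "0 < b" for b
    using W_le_reflect[OF that] R.W_le_reflect[OF that] by simp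
  show ?thesis using pos[of x] pos[of "- x"] by (cases x "0::real" rule: linorder_cases) simp_all
qed

lemma W_strict_decreasing: "0 \<le> a \<Longrightarrow> a < b \<Longrightarrow> W b < W a"
  by (rule W_less) simp_all

end

section \<open>The quadratic form of the logarithmic kernel\<close>

text \<open>Regularisation at scale \<open>y\<close> of \<open>ln |t - x| - ln |t|\<close>,
  normalised to vanish at \<open>x = 0\<close>; being smooth in \<open>x\<close>, it can be
  integrated by parts.\<close>

definition reg_log :: "real \<Rightarrow> real \<Rightarrow> real \<Rightarrow> real"
  where "reg_log y x t = (ln (y\<^sup>2 + (t - x)\<^sup>2) - ln (y\<^sup>2 + t\<^sup>2)) / 2"

text \<open>The conjugate Poisson kernel without its factor \<open>1 / pi\<close>: an odd, bounded
  approximation of \<open>1 / s\<close>, which at \<open>s = x - t\<close> is the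
  \<open>x\<close>-derivative of \<open>reg_log\<close>.\<close>

definition conj_kernel :: "real \<Rightarrow> real \<Rightarrow> real"
  where "conj_kernel y s = s / (y\<^sup>2 + s\<^sup>2)"

lemma conj_kernel_minus: "conj_kernel y (- s) = - conj_kernel y s"
  by (simp add: conj_kernel_def)

lemma conj_kernel_bound:
  assumes "y > 0"
  shows "\<bar>conj_kernel y s\<bar> \<le> 1 / y" "\<bar>s * conj_kernel y s\<bar> \<le> 1"
proof -
  have p: "0 < y\<^sup>2 + s\<^sup>2" using assms by (simp add: add_pos_nonneg)
  have "(y - \<bar>s\<bar>)\<^sup>2 = y\<^sup>2 + s\<^sup>2 - 2 * (y * \<bar>s\<bar>)" by (simp add: power2_diff)
  moreover have "0 \<le> (y - \<bar>s\<bar>)\<^sup>2" "0 \<le> y * \<bar>s\<bar>" using assms by simp_all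
  ultimately have "y * \<bar>s\<bar> \<le> y\<^sup>2 + s\<^sup>2" by linarith
  then have "\<bar>s\<bar> / (y\<^sup>2 + s\<^sup>2) \<le> 1 / y" using p assms by (simp add: field_simps)
  then show "\<bar>conj_kernel y s\<bar> \<le> 1 / y" using p by (simp add: conj_kernel_def)
  have "s\<^sup>2 / (y\<^sup>2 + s\<^sup>2) \<le> 1" using p by (simp only: pos_divide_le_eq) simp
  then show "\<bar>s * conj_kernel y s\<bar> \<le> 1" using p by (simp add: conj_kernel_def power2_eq_square abs_mult)
qed

lemma reg_log_DERIV:
  assumes "y > 0"
  shows "((\<lambda>x. reg_log y x t) has_real_derivative conj_kernel y (x - t)) (at x)"
proof -
  have p: "0 < y\<^sup>2 + s\<^sup>2" for s using assms by (simp add: add_pos_nonneg)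
  have "((\<lambda>x. ln (y\<^sup>2 + (t - x)\<^sup>2)) has_real_derivative - (2 * (t - x)) / (y\<^sup>2 + (t - x)\<^sup>2)) (at x)"
    by (rule derivative_eq_intros refl p)+ simp
  from DERIV_cdivide[OF DERIV_diff[OF this DERIV_const[of "ln (y\<^sup>2 + t\<^sup>2)"]], of 2]
  have D: "((\<lambda>x. reg_log y x t) has_real_derivative (- (2 * (t - x)) / (y\<^sup>2 + (t - x)\<^sup>2) - 0) / 2) (at x)"
    unfolding reg_log_def .
  have "(2 * z / c - 0) / 2 = z / c" for z c :: real by simp
  moreover have "- (2 * (t - x)) = 2 * (x - t)" by simp
  ultimately show ?thesis using D unfolding conj_kernel_def power2_commute[of x t] by (simp only:)
qed

text \<open>The \<open>x\<close>-derivative is at most \<open>1 / y\<close>. This serves Fubini at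
  fixed \<open>y\<close>; it degenerates as \<open>y\<close> tends to 0, where
  \<open>reg_log_bound_uniform\<close> takes over.\<close>

lemma reg_log_bound:
  assumes y: "y > 0" and x: "\<bar>x\<bar> \<le> n"
  shows "\<bar>reg_log y x t\<bar> \<le> n / y"
proof (cases "x = 0")
  case False
  have n: "0 \<le> n" using x by simp
  have "\<exists>z. reg_log y x t - reg_log y 0 t = x * conj_kernel y (z - t)"
  proof (cases "0 < x")
    case True
    from MVT2[OF this, of "\<lambda>x. reg_log y x t" "\<lambda>z. conj_kernel y (z - t)"] reg_log_DERIV[OF y]
    show ?thesis by auto
  next
    case neg: False
    then have "x < 0" using False by simp
    from MVT2[OF this, of "\<lambda>x. reg_log y x t" "\<lambda>z. conj_kernel y (z - t)"] reg_log_DERIV[OF y]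
    obtain z where "reg_log y 0 t - reg_log y x t = (0 - x) * conj_kernel y (z - t)" by blast
    then have "reg_log y x t - reg_log y 0 t = x * conj_kernel y (z - t)" by simp
    then show ?thesis by blast
  qed
  then obtain z where z: "reg_log y x t - reg_log y 0 t = x * conj_kernel y (z - t)" by blast
  moreover have "reg_log y 0 t = 0" by (simp add: reg_log_def)
  ultimately have "\<bar>reg_log y x t\<bar> = \<bar>x\<bar> * \<bar>conj_kernel y (z - t)\<bar>" by (simp add: abs_mult)
  also have "\<dots> \<le> n * (1 / y)" using x conj_kernel_bound(1)[OF y] n by (intro mult_mono) simp_all
  finally show ?thesis by simp
qed (use assms in \<open>simp add: reg_log_def\<close>)

lemma reg_log_bound_uniform:
  assumes y: "0 < y" "y \<le> 1" and t: "t \<noteq> 0" "t \<noteq> x"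
  shows "\<bar>reg_log y x t\<bar> \<le> ln (2 * (1 + x\<^sup>2)) + log_kernel 1 (t - x) + log_kernel 1 t"
proof -
  have a: "0 \<le> ln (1 + s\<^sup>2) - ln (y\<^sup>2 + s\<^sup>2) \<and> ln (1 + s\<^sup>2) - ln (y\<^sup>2 + s\<^sup>2) \<le> log_kernel 1 s" if s: "s \<noteq> 0" for s
  proof -
    have "y\<^sup>2 \<le> 1" using y by (simp add: power_le_one)
    then have "ln (y\<^sup>2 + s\<^sup>2) \<le> ln (1 + s\<^sup>2)" using s by (subst ln_le_cancel_iff) (simp_all add: add_nonneg_pos)
    moreover have "ln (s\<^sup>2) \<le> ln (y\<^sup>2 + s\<^sup>2)" using s by (subst ln_le_cancel_iff) (simp_all add: add_nonneg_pos)
    moreover have "ln (s\<^sup>2) = 2 * ln \<bar>s\<bar>" using ln_realpow[of "\<bar>s\<bar>" 2] s by simp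
    moreover have "log_kernel 1 s = ln (1\<^sup>2 + s\<^sup>2) - 2 * ln \<bar>s\<bar>" by (rule log_kernel_eq[OF s])
    ultimately show ?thesis by simp
  qed
  have l0: "0 \<le> ln (2 * (1 + x\<^sup>2))" by (rule ln_ge_zero) simp
  have r1: "ln (1 + (t - x)\<^sup>2) \<le> ln (1 + t\<^sup>2) + ln (2 * (1 + x\<^sup>2))" using ln_ratio_bound[of 1 t x 0] by simp
  have r2: "ln (1 + t\<^sup>2) \<le> ln (1 + (t - x)\<^sup>2) + ln (2 * (1 + x\<^sup>2))" using ln_ratio_bound[of 1 t 0 x] by simp
  have "t - x \<noteq> 0" using t by simp
  from a[OF this] a[OF t(1)] r1 r2 l0 show ?thesis unfolding reg_log_def abs_le_iff by argo
qed

lemma reg_log_tendsto: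
  assumes e: "e \<longlonglongrightarrow> (0::real)" and t: "t \<noteq> 0" "t \<noteq> x"
  shows "(\<lambda>k. reg_log (e k) x t) \<longlonglongrightarrow> ln \<bar>t - x\<bar> - ln \<bar>t\<bar>"
proof -
  have "(\<lambda>k. reg_log (e k) x t) \<longlonglongrightarrow> (ln (0\<^sup>2 + (t - x)\<^sup>2) - ln (0\<^sup>2 + t\<^sup>2)) / 2"
    unfolding reg_log_def by (intro tendsto_intros e) (use t in simp_all)
  moreover have "ln (s\<^sup>2) = 2 * ln \<bar>s\<bar>" if "s \<noteq> 0" for s :: real using ln_realpow[of "\<bar>s\<bar>" 2] that by simp
  ultimately show ?thesis using t by (simp add: diff_divide_distrib)
qed

text \<open>Stands for the difference of the densities of two solutions, which has no sign.
  \<open>h_zero\<close> records the agreement of the solutions at the origin.\<close>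

locale even_density =
  fixes h :: "real \<Rightarrow> real"
  assumes h_cont: "continuous_on UNIV h" and h_int: "integrable lborel h"
    and h_even: "\<And>x. h (- x) = h x" and h_zero: "h 0 = 0"
begin

lemma h_meas [measurable]: "h \<in> borel_measurable borel"
  by (rule borel_measurable_continuous_onI[OF h_cont])

definition b :: "real \<Rightarrow> real" where "b x = indicator {0..} x * h x"

lemma b_meas [measurable]: "b \<in> borel_measurable borel"
  unfolding b_def by measurable

lemma b_int: "integrable lborel b"
  using integrable_mult_indicator[OF _ h_int, of "{0..}"] by (simp add: b_def[abs_def])

lemma b_sqrt_int: "integrable lborel (\<lambda>x. \<bar>b x\<bar> / sqrt \<bar>x\<bar>)"
proof (rule Bochner_Integration.integrable_bound)
  show "integrable lborel (\<lambda>x. h x * (1 + indicator {- 1..1} (x - 0) / sqrt \<bar>x - 0\<bar>))"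
    by (rule integrable_log_singular[OF h_cont h_int])
  have "norm (\<bar>b x\<bar> / sqrt \<bar>x\<bar>) \<le> norm (h x * (1 + indicator {- 1..1} (x - 0) / sqrt \<bar>x - 0\<bar>))" for x
  proof -
    have "1 / sqrt \<bar>x\<bar> \<le> 1 + indicator {- 1..1} x / sqrt \<bar>x\<bar>"
    proof (cases "\<bar>x\<bar> \<le> 1")
      case True
      then show ?thesis by (simp add: abs_le_iff)
    next
      case False
      then have "1 / sqrt \<bar>x\<bar> \<le> 1" by (simp add: divide_le_eq)
      moreover have "0 \<le> indicator {- 1..1} x / sqrt \<bar>x\<bar>" by simp
      ultimately show ?thesis by linarith
    qed
    moreover have "\<bar>b x\<bar> \<le> \<bar>h x\<bar>" by (simp add: b_def indicator_def)
    ultimately have "\<bar>b x\<bar> * (1 / sqrt \<bar>x\<bar>) \<le> \<bar>h x\<bar> * (1 + indicator {- 1..1} x / sqrt \<bar>x\<bar>)"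
      by (intro mult_mono) simp_all
    then show ?thesis by (simp add: abs_mult)
  qed
  then show "AE x in lborel. norm (\<bar>b x\<bar> / sqrt \<bar>x\<bar>) \<le> norm (h x * (1 + indicator {- 1..1} (x - 0) / sqrt \<bar>x - 0\<bar>))"
    by (rule AE_I2)
qed measurable

text \<open>\<open>sqrt x * sqrt t \<le> x + t\<close> separates the kernel into a product of
  integrable singularities. Hence the symmetric kernel, unlike \<open>1 / (x - t)\<close>, can be
  used without regularisation.\<close>

lemma b_pair_bound: "\<bar>b x * b t / (x + t)\<bar> \<le> (\<bar>b x\<bar> / sqrt \<bar>x\<bar>) * (\<bar>b t\<bar> / sqrt \<bar>t\<bar>)"
proof (cases "0 < x \<and> 0 < t")
  case True
  have "sqrt x * sqrt t \<le> x + t"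
  proof -
    have "0 \<le> (sqrt x - sqrt t)\<^sup>2" by simp
    also have "\<dots> = x + t - 2 * (sqrt x * sqrt t)" using True by (simp add: power2_diff)
    moreover have "0 \<le> sqrt x * sqrt t" using True by simp
    ultimately show ?thesis by linarith
  qed
  then have "\<bar>b x * b t\<bar> / (x + t) \<le> \<bar>b x * b t\<bar> / (sqrt x * sqrt t)"
    using True by (intro divide_left_mono) simp_all
  then show ?thesis using True by (simp add: abs_mult)
next
  case False
  then have "b x = 0 \<or> b t = 0" using h_zero by (auto simp: b_def indicator_def less_le)
  then show ?thesis by auto
qed

lemma b_pair_integrable:
  assumes [measurable]: "w \<in> borel_measurable (lborel \<Otimes>\<^sub>M lborel)" and w: "\<And>p. \<bar>w p\<bar> \<le> 1"
  shows "integrable (lborel \<Otimes>\<^sub>M lborel) (\<lambda>p. w p * (b (fst p) * b (snd p) / (fst p + snd p)))"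
proof (rule integrable_pair_bound[OF _ b_sqrt_int b_sqrt_int])
  fix x t
  have "\<bar>w (x, t)\<bar> * \<bar>b x * b t / (x + t)\<bar> \<le> 1 * ((\<bar>b x\<bar> / sqrt \<bar>x\<bar>) * (\<bar>b t\<bar> / sqrt \<bar>t\<bar>))"
    using w b_pair_bound by (intro mult_mono) simp_all
  then show "norm (w (x, t) * (b (fst (x, t)) * b (snd (x, t)) / (fst (x, t) + snd (x, t)))) \<le> (\<bar>b x\<bar> / sqrt \<bar>x\<bar>) * (\<bar>b t\<bar> / sqrt \<bar>t\<bar>)"
    by (simp add: abs_mult)
qed measurable

text \<open>Two demands meet here: it vanishes at \<open>n\<close>, which removes the boundary term
  there, and its slope \<open>1 / n\<close> makes the contribution of the antisymmetric kernel
  disappear in the limit.\<close>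

definition tent :: "real \<Rightarrow> real \<Rightarrow> real" where "tent n x = max 0 (1 - \<bar>x\<bar> / n)"

lemma tent_meas [measurable]: "tent n \<in> borel_measurable borel"
  unfolding tent_def by measurable

lemma tent_bound: "n > 0 \<Longrightarrow> 0 \<le> tent n x" "n > 0 \<Longrightarrow> tent n x \<le> 1"
  by (simp_all add: tent_def)

lemma tent_lipschitz:
  assumes "n > 0"
  shows "\<bar>tent n x - tent n t\<bar> \<le> \<bar>x - t\<bar> / n"
proof -
  have "\<bar>tent n x - tent n t\<bar> \<le> \<bar>\<bar>x\<bar> / n - \<bar>t\<bar> / n\<bar>" unfolding tent_def by (auto simp: max_def abs_if split: if_splits)
  also have "\<dots> = \<bar>\<bar>x\<bar> - \<bar>t\<bar>\<bar> / n" using assms by (simp add: diff_divide_distrib[symmetric])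
  also have "\<dots> \<le> \<bar>x - t\<bar> / n" using assms by (intro divide_right_mono abs_triangle_ineq3) simp
  finally show ?thesis .
qed

lemma b_pair_kernel_integrable:
  assumes [measurable]: "w \<in> borel_measurable (lborel \<Otimes>\<^sub>M lborel)" and w: "\<And>p. \<bar>w p\<bar> \<le> M"
  shows "integrable (lborel \<Otimes>\<^sub>M lborel) (\<lambda>p. b (fst p) * b (snd p) * w p)"
proof (rule integrable_pair_bound[where a = "\<lambda>x. M * \<bar>b x\<bar>"])
  show "integrable lborel (\<lambda>x. M * \<bar>b x\<bar>)" "integrable lborel (\<lambda>x. \<bar>b x\<bar>)" using b_int by simp_all
  fix x t
  have "\<bar>b x * b t\<bar> * \<bar>w (x, t)\<bar> \<le> \<bar>b x * b t\<bar> * M" using w by (intro mult_left_mono) simp_all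
  then show "norm (b (fst (x, t)) * b (snd (x, t)) * w (x, t)) \<le> M * \<bar>b x\<bar> * \<bar>b t\<bar>"
    by (simp add: abs_mult mult_ac)
qed measurable

text \<open>Antisymmetry of the conjugate Poisson kernel leaves only the difference quotient of the
  cutoff, which is at most \<open>1/n\<close>.\<close>

lemma antisymmetric_part_bound:
  assumes n: "n > 0" and y: "y > 0"
  shows "\<bar>LINT p|(lborel \<Otimes>\<^sub>M lborel). b (fst p) * b (snd p) * (tent n (fst p) * conj_kernel y (fst p - snd p))\<bar>
    \<le> (LINT x|lborel. \<bar>b x\<bar>)\<^sup>2 / n"
proof -
  let ?P = "lborel \<Otimes>\<^sub>M lborel :: (real \<times> real) measure"
  define F where "F p = b (fst p) * b (snd p) * (tent n (fst p) * conj_kernel y (fst p - snd p))" for p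
  have [measurable]: "conj_kernel y \<in> borel_measurable borel" unfolding conj_kernel_def by measurable
  have kb: "\<bar>tent n x * conj_kernel y s\<bar> \<le> 1 / y" for x s
  proof -
    have "\<bar>tent n x\<bar> * \<bar>conj_kernel y s\<bar> \<le> 1 * (1 / y)"
      using tent_bound[OF n] conj_kernel_bound(1)[OF y] by (intro mult_mono) simp_all
    then show ?thesis by (simp add: abs_mult)
  qed
  have iF: "integrable ?P F" unfolding F_def by (rule b_pair_kernel_integrable[OF _ kb]) measurable
  have iF': "integrable ?P (\<lambda>p. F (snd p, fst p))"
    using lborel_pair.integrable_product_swap[OF iF] by (simp add: case_prod_unfold)
  have eq: "integral\<^sup>L ?P F = (LINT p|?P. F (snd p, fst p))"
    using lborel_pair.integral_product_swap[of F] iF by (simp add: case_prod_unfold)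
  have iab: "integrable ?P (\<lambda>p. \<bar>b (fst p)\<bar> * \<bar>b (snd p)\<bar> * (1 / n))"
    by (rule integrable_pair_bound[where a = "\<lambda>x. 1 / n * \<bar>b x\<bar>" and b = "\<lambda>x. \<bar>b x\<bar>"])
      (use b_int n in \<open>simp_all add: abs_mult\<close>)
  have "2 * integral\<^sup>L ?P F = (LINT p|?P. F p + F (snd p, fst p))"
    using eq by (simp add: Bochner_Integration.integral_add[OF iF iF'])
  then have "\<bar>2 * integral\<^sup>L ?P F\<bar> \<le> (LINT p|?P. \<bar>F p + F (snd p, fst p)\<bar>)"
    using integral_norm_bound[of ?P "\<lambda>p. F p + F (snd p, fst p)"] by simp
  also have "\<dots> \<le> (LINT p|?P. \<bar>b (fst p)\<bar> * \<bar>b (snd p)\<bar> * (1 / n))"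
  proof (rule integral_mono[OF integrable_abs[OF Bochner_Integration.integrable_add[OF iF iF']] iab])
    fix p :: "real \<times> real"
    obtain x t where p: "p = (x, t)" by (cases p)
    have "F p + F (snd p, fst p) = b x * b t * ((tent n x - tent n t) * conj_kernel y (x - t))"
      using conj_kernel_minus[of y "x - t"] by (simp add: F_def p algebra_simps)
    moreover have "\<bar>(tent n x - tent n t) * conj_kernel y (x - t)\<bar> \<le> 1 / n"
    proof -
      have "\<bar>tent n x - tent n t\<bar> * \<bar>conj_kernel y (x - t)\<bar> \<le> \<bar>x - t\<bar> / n * \<bar>conj_kernel y (x - t)\<bar>"
        by (intro mult_right_mono tent_lipschitz n) simp
      also have "\<dots> = \<bar>(x - t) * conj_kernel y (x - t)\<bar> / n" by (simp add: abs_mult)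
      also have "\<dots> \<le> 1 / n" using conj_kernel_bound(2)[OF y] n by (intro divide_right_mono) simp_all
      finally show ?thesis by (simp add: abs_mult)
    qed
    then have "\<bar>b x * b t\<bar> * \<bar>(tent n x - tent n t) * conj_kernel y (x - t)\<bar> \<le> \<bar>b x * b t\<bar> * (1 / n)"
      by (rule mult_left_mono) simp
    ultimately show "\<bar>F p + F (snd p, fst p)\<bar> \<le> \<bar>b (fst p)\<bar> * \<bar>b (snd p)\<bar> * (1 / n)"
      by (simp add: p abs_mult)
  qed
  also have "\<dots> = (LINT x|lborel. LINT t|lborel. \<bar>b x\<bar> * \<bar>b t\<bar> * (1 / n))"
    using lborel_pair.integral_fst'[OF iab, symmetric] by (simp only: fst_conv snd_conv)
  also have "\<dots> = (LINT x|lborel. \<bar>b x\<bar>)\<^sup>2 / n"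
    by (simp add: power2_eq_square)
  finally show ?thesis unfolding F_def by simp
qed

text \<open>The derivative is moved from the tent times \<open>h\<close> onto
  \<open>reg_log\<close>, where it becomes \<open>conj_kernel\<close>. Folding the variable
  \<open>t\<close> by evenness of \<open>h\<close> produces the arguments \<open>x - t\<close> and
  \<open>x + t\<close>: the first part is of order \<open>1 / n\<close>, the second is kept.\<close>

lemma quadratic_form_regularised:
  assumes n: "n > 0" and y: "y > 0"
    and dg: "\<And>x. 0 \<le> x \<Longrightarrow> x \<le> n \<Longrightarrow> ((\<lambda>x. (1 - x / n) * h x) has_real_derivative dg x) (at x)"
    and dgc: "continuous_on {0..n} dg"
  shows "(LINT x|lborel. indicator {0..n} x * (dg x * (LINT t|lborel. h t * reg_log y x t))) \<le>
    (LINT x|lborel. \<bar>b x\<bar>)\<^sup>2 / n -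
    (LINT p|(lborel \<Otimes>\<^sub>M lborel). b (fst p) * b (snd p) * (tent n (fst p) * conj_kernel y (fst p + snd p)))"
proof -
  let ?P = "lborel \<Otimes>\<^sub>M lborel :: (real \<times> real) measure"
  have [measurable]: "conj_kernel y \<in> borel_measurable borel" unfolding conj_kernel_def by measurable
  define D where "D x = indicator {0..n} x * dg x" for x
  have iD: "integrable lborel D"
    using borel_integrable_atLeastAtMost'[OF dgc] by (simp add: D_def[abs_def] set_integrable_def)
  then have mD [measurable]: "D \<in> borel_measurable borel" by auto
  define G where "G x t = D x * (h t * reg_log y x t)" for x t
  have mG: "case_prod G \<in> borel_measurable ?P" unfolding G_def reg_log_def by measurable
  have iG: "integrable ?P (case_prod G)"
  proof (rule integrable_pair_bound[OF mG])
    show "integrable lborel (\<lambda>x. \<bar>D x\<bar> * (n / y))" "integrable lborel (\<lambda>t. \<bar>h t\<bar>)" using iD h_int by simp_all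
    fix x t
    show "norm (case_prod G (x, t)) \<le> \<bar>D x\<bar> * (n / y) * \<bar>h t\<bar>"
    proof (cases "x \<in> {0..n}")
      case True
      then have "\<bar>D x\<bar> * \<bar>h t\<bar> * \<bar>reg_log y x t\<bar> \<le> \<bar>D x\<bar> * \<bar>h t\<bar> * (n / y)"
        by (intro mult_left_mono reg_log_bound[OF y]) simp_all
      then show ?thesis by (simp add: G_def abs_mult mult_ac)
    qed (simp add: G_def D_def)
  qed
  define g where "g x = tent n x * b x" for x
  have g_eq: "indicator {0..n} x * ((1 - x / n) * h x) = g x" for x
    using n by (auto simp: g_def b_def tent_def indicator_def max_def divide_le_eq)
  have [measurable]: "g \<in> borel_measurable borel" unfolding g_def by measurable
  \<comment> \<open>The boundary terms vanish: at \<open>n\<close> by the factor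
    \<open>1 - x / n\<close>, at 0 by \<open>h 0 = 0\<close>.\<close>
  have ibp: "(LINT x|lborel. D x * reg_log y x t) = - (LINT x|lborel. g x * conj_kernel y (x - t))" for t
  proof -
    have nz: "y\<^sup>2 + s\<^sup>2 \<noteq> 0" for s using y by (simp add: add_pos_nonneg less_imp_neq[symmetric])
    have cr: "continuous_on {0..n} (\<lambda>x. reg_log y x t)"
      using reg_log_DERIV[OF y, of t] by (auto intro!: continuous_at_imp_continuous_on dest: DERIV_isCont)
    have cc: "continuous_on {0..n} (\<lambda>x. conj_kernel y (x - t))"
      unfolding conj_kernel_def by (intro continuous_intros ballI nz)
    have ch: "continuous_on {0..n} (\<lambda>x. (1 - x / n) * h x)"
      by (intro continuous_intros continuous_on_subset[OF h_cont subset_UNIV]) (use n in simp_all)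
    have i1: "integrable lborel (\<lambda>x. D x * reg_log y x t)"
      using borel_integrable_atLeastAtMost'[OF continuous_on_mult[OF dgc cr]] by (simp add: D_def set_integrable_def mult.assoc)
    have i2: "integrable lborel (\<lambda>x. g x * conj_kernel y (x - t))"
      using borel_integrable_atLeastAtMost'[OF continuous_on_mult[OF ch cc]]
      by (simp add: g_eq[symmetric] set_integrable_def mult.assoc)
    have "(LINT x|lborel. indicator {0..n} x *\<^sub>R (dg x * reg_log y x t + (1 - x / n) * h x * conj_kernel y (x - t))) =
        (1 - n / n) * h n * reg_log y n t - (1 - 0 / n) * h 0 * reg_log y 0 t"
    proof (rule integral_FTC_atLeastAtMost)
      show "continuous_on {0..n} (\<lambda>x. dg x * reg_log y x t + (1 - x / n) * h x * conj_kernel y (x - t))"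
        by (intro continuous_on_add continuous_on_mult[OF dgc cr] continuous_on_mult[OF ch cc])
      fix x assume x: "0 \<le> x" "x \<le> n"
      have "((\<lambda>x. (1 - x / n) * h x * reg_log y x t) has_real_derivative dg x * reg_log y x t + conj_kernel y (x - t) * ((1 - x / n) * h x)) (at x)"
        by (rule DERIV_mult[OF dg[OF x] reg_log_DERIV[OF y]])
      then show "((\<lambda>x. (1 - x / n) * h x * reg_log y x t) has_vector_derivative dg x * reg_log y x t + (1 - x / n) * h x * conj_kernel y (x - t)) (at x within {0..n})"
        unfolding has_real_derivative_iff_has_vector_derivative mult.commute[of "conj_kernel y (x - t)"]
        by (rule has_vector_derivative_at_within)
    qed (use n in simp)
    moreover have "(LINT x|lborel. indicator {0..n} x *\<^sub>R (dg x * reg_log y x t + (1 - x / n) * h x * conj_kernel y (x - t))) =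
        (LINT x|lborel. D x * reg_log y x t + g x * conj_kernel y (x - t))"
      by (rule Bochner_Integration.integral_cong[OF refl]) (simp add: D_def g_eq[symmetric] distrib_left mult.assoc)
    ultimately show ?thesis using Bochner_Integration.integral_add[OF i1 i2] n h_zero by simp
  qed
  define F where "F t = h t * (LINT x|lborel. g x * conj_kernel y (x - t))" for t
  have lhs: "(LINT x|lborel. indicator {0..n} x * (dg x * (LINT t|lborel. h t * reg_log y x t))) = - (LINT t|lborel. F t)"
  proof -
    have "(LINT x|lborel. indicator {0..n} x * (dg x * (LINT t|lborel. h t * reg_log y x t))) = (LINT x|lborel. LINT t|lborel. G x t)"
      by (rule Bochner_Integration.integral_cong[OF refl]) (simp add: G_def D_def mult.assoc)
    also have "\<dots> = (LINT t|lborel. LINT x|lborel. G x t)" by (rule lborel_pair.Fubini_integral[OF iG, symmetric])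
    also have "\<dots> = (LINT t|lborel. - F t)"
    proof (rule Bochner_Integration.integral_cong[OF refl])
      fix t
      have "(LINT x|lborel. G x t) = (LINT x|lborel. h t * (D x * reg_log y x t))" unfolding G_def by (simp add: mult_ac)
      also have "\<dots> = h t * (LINT x|lborel. D x * reg_log y x t)" by (rule integral_mult_right_zero)
      finally show "(LINT x|lborel. G x t) = - F t" unfolding ibp F_def by simp
    qed
    finally show ?thesis by simp
  qed
  have gk: "\<bar>tent n x * conj_kernel y s\<bar> \<le> 1 / y" for x s
  proof -
    have "\<bar>tent n x\<bar> * \<bar>conj_kernel y s\<bar> \<le> 1 * (1 / y)"
      using tent_bound[OF n] conj_kernel_bound(1)[OF y] by (intro mult_mono) simp_all
    then show ?thesis by (simp add: abs_mult)
  qed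
  have iF: "integrable lborel F"
  proof -
    have "integrable ?P (\<lambda>(x, t). h t * (g x * conj_kernel y (x - t)))"
    proof (rule integrable_pair_bound)
      show "integrable lborel (\<lambda>x. (1 / y) * \<bar>b x\<bar>)" "integrable lborel (\<lambda>t. \<bar>h t\<bar>)" using b_int h_int by simp_all
      fix x t
      have "\<bar>b x\<bar> * \<bar>h t\<bar> * \<bar>tent n x * conj_kernel y (x - t)\<bar> \<le> \<bar>b x\<bar> * \<bar>h t\<bar> * (1 / y)"
        using gk by (intro mult_left_mono) simp_all
      then show "norm (case (x, t) of (x, t) \<Rightarrow> h t * (g x * conj_kernel y (x - t))) \<le> (1 / y) * \<bar>b x\<bar> * \<bar>h t\<bar>"
        by (simp add: g_def abs_mult mult_ac)
    qed measurable
    from lborel_pair.integrable_snd[OF this] show ?thesis by (simp add: F_def[abs_def])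
  qed
  have ig: "integrable lborel (\<lambda>x. g x * conj_kernel y (x - s))" for s
  proof (rule Bochner_Integration.integrable_bound)
    show "integrable lborel (\<lambda>x. (1 / y) * \<bar>b x\<bar>)" using b_int by simp
    have "norm (g x * conj_kernel y (x - s)) \<le> norm ((1 / y) * \<bar>b x\<bar>)" for x
    proof -
      have "\<bar>b x\<bar> * \<bar>tent n x * conj_kernel y (x - s)\<bar> \<le> \<bar>b x\<bar> * (1 / y)"
        using gk by (intro mult_left_mono) simp_all
      then show ?thesis using y by (simp add: g_def abs_mult mult_ac)
    qed
    then show "AE x in lborel. norm (g x * conj_kernel y (x - s)) \<le> norm ((1 / y) * \<bar>b x\<bar>)" by (rule AE_I2)
  qed measurable
  define A where "A p = b (fst p) * b (snd p) * (tent n (fst p) * conj_kernel y (fst p - snd p))" for p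
  define Q where "Q p = b (fst p) * b (snd p) * (tent n (fst p) * conj_kernel y (fst p + snd p))" for p
  have iA: "integrable ?P A" and iQ: "integrable ?P Q"
    unfolding A_def Q_def by (rule b_pair_kernel_integrable[OF _ gk]; measurable)+
  have "(LINT t|lborel. F t) = (LINT t|lborel. indicator {0..} t *\<^sub>R (F t + F (- t)))"
    by (rule integral_split_at_zero[OF iF])
  also have "\<dots> = (LINT t|lborel. LINT x|lborel. (case_prod (\<lambda>x t. A (x, t) + Q (x, t))) (x, t))"
  proof (rule Bochner_Integration.integral_cong[OF refl])
    fix t
    have "indicator {0..} t *\<^sub>R (F t + F (- t)) = b t * ((LINT x|lborel. g x * conj_kernel y (x - t)) + (LINT x|lborel. g x * conj_kernel y (x - - t)))"
      unfolding F_def b_def h_even by (simp add: distrib_left mult.assoc)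
    also have "\<dots> = b t * (LINT x|lborel. g x * conj_kernel y (x - t) + g x * conj_kernel y (x - - t))"
      by (simp only: Bochner_Integration.integral_add[OF ig ig])
    also have "\<dots> = (LINT x|lborel. b t * (g x * conj_kernel y (x - t) + g x * conj_kernel y (x - - t)))"
      by (rule integral_mult_right_zero[symmetric])
    also have "\<dots> = (LINT x|lborel. (case_prod (\<lambda>x t. A (x, t) + Q (x, t))) (x, t))"
      by (rule Bochner_Integration.integral_cong[OF refl]) (simp add: A_def Q_def g_def algebra_simps)
    finally show "indicator {0..} t *\<^sub>R (F t + F (- t)) = (LINT x|lborel. (case_prod (\<lambda>x t. A (x, t) + Q (x, t))) (x, t))" .
  qed
  also have "\<dots> = integral\<^sup>L ?P (\<lambda>p. A p + Q p)"
  proof -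
    have "integrable ?P (case_prod (\<lambda>x t. A (x, t) + Q (x, t)))"
      using Bochner_Integration.integrable_add[OF iA iQ] by (simp add: case_prod_unfold)
    from lborel_pair.integral_snd[OF this] show ?thesis by (simp add: case_prod_unfold)
  qed
  also have "\<dots> = integral\<^sup>L ?P A + integral\<^sup>L ?P Q" by (rule Bochner_Integration.integral_add[OF iA iQ])
  finally have "(LINT t|lborel. F t) = integral\<^sup>L ?P A + integral\<^sup>L ?P Q" .
  moreover have "\<bar>integral\<^sup>L ?P A\<bar> \<le> (LINT x|lborel. \<bar>b x\<bar>)\<^sup>2 / n"
    unfolding A_def by (rule antisymmetric_part_bound[OF n y])
  ultimately show ?thesis unfolding lhs Q_def[symmetric] by linarith
qed

text \<open>Uniformity holds because \<open>h\<close> is bounded on the unit neighbourhood of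
  \<open>[-n, n]\<close>. The constant 9 in the proof is \<open>b^2 + 4 * (1 + b^2)\<close> at
  \<open>b = 1\<close>.\<close>

lemma log_kernel_uniform_bound:
  obtains B where "\<And>x. \<bar>x\<bar> \<le> n \<Longrightarrow> (LINT t|lborel. \<bar>h t\<bar> * log_kernel 1 (t - x)) \<le> B"
proof -
  have "compact (h ` {- n - 1..n + 1})" by (rule compact_continuous_image[OF continuous_on_subset[OF h_cont subset_UNIV] compact_Icc])
  from this[THEN compact_imp_bounded, unfolded bounded_iff]
  obtain M where M: "\<forall>y \<in> h ` {- n - 1..n + 1}. norm y \<le> M" by (elim exE) (rule that)
  have "(LINT t|lborel. \<bar>h t\<bar> * log_kernel 1 (t - x)) \<le> 9 * (LINT t|lborel. \<bar>h t\<bar>) + 9 * \<bar>M\<bar> * 4" if x: "\<bar>x\<bar> \<le> n" for x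
  proof -
    let ?S = "\<lambda>t. indicator {- 1..1} (t - x) / sqrt \<bar>t - x\<bar>"
    have isq: "integrable lborel ?S" "(LINT t|lborel. ?S t) = 4"
      using lborel_integrable_real_affine[OF integrable_inverse_sqrt[of 1], of 1 "- x"]
        lborel_integral_real_affine[of 1 "\<lambda>t. indicator {- 1..1} t / sqrt \<bar>t\<bar>" "- x"] LINT_inverse_sqrt[of 1]
      by simp_all
    have hb: "has_bochner_integral lborel (\<lambda>t. 9 * \<bar>h t\<bar> + 9 * \<bar>M\<bar> * ?S t) (9 * (LINT t|lborel. \<bar>h t\<bar>) + 9 * \<bar>M\<bar> * 4)"
      using h_int isq by (intro has_bochner_integral_add has_bochner_integral_mult_right) (simp_all add: has_bochner_integral_iff)
    have "(LINT t|lborel. \<bar>h t\<bar> * log_kernel 1 (t - x)) \<le> (LINT t|lborel. 9 * \<bar>h t\<bar> + 9 * \<bar>M\<bar> * ?S t)"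
    proof (rule integral_mono)
      show "integrable lborel (\<lambda>t. \<bar>h t\<bar> * log_kernel 1 (t - x))"
        using h_int by (intro integrable_log_kernel continuous_intros h_cont) simp
      show "integrable lborel (\<lambda>t. 9 * \<bar>h t\<bar> + 9 * \<bar>M\<bar> * ?S t)" using hb by (simp only: has_bochner_integral_iff)
      fix t
      have "\<bar>h t\<bar> * ?S t \<le> \<bar>M\<bar> * ?S t"
      proof (cases "t - x \<in> {- 1..1}")
        case True
        then have "t \<in> {- n - 1..n + 1}" using x by (auto simp: abs_le_iff)
        then have "norm (h t) \<le> M" using M by blast
        then have "\<bar>h t\<bar> \<le> \<bar>M\<bar>" by simp
        then show ?thesis by (intro mult_right_mono) simp_all
      qed simp
      moreover have "\<bar>h t\<bar> * log_kernel 1 (t - x) \<le> \<bar>h t\<bar> * (9 * (1 + ?S t))"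
        using log_kernel_le[of 1 "t - x"] by (intro mult_left_mono) simp_all
      moreover have "\<bar>h t\<bar> * (9 * (1 + ?S t)) = 9 * \<bar>h t\<bar> + 9 * (\<bar>h t\<bar> * ?S t)" by (simp only: distrib_left mult_ac mult_1_right)
      ultimately show "\<bar>h t\<bar> * log_kernel 1 (t - x) \<le> 9 * \<bar>h t\<bar> + 9 * \<bar>M\<bar> * ?S t" by linarith
    qed
    then show ?thesis using hb by (simp only: has_bochner_integral_iff)
  qed
  then show thesis by (rule that)
qed

text \<open>The limit of \<open>quadratic_form_regularised\<close> as \<open>y\<close> tends to 0.
  On the left dominated convergence is used twice, in \<open>t\<close> for each \<open>x\<close> and
  then in \<open>x\<close>; on the right the limit kernel \<open>1 / (x + t)\<close> itself is the
  majorant.\<close>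

lemma quadratic_form_inequality:
  assumes n: "n > 0"
    and dg: "\<And>x. 0 \<le> x \<Longrightarrow> x \<le> n \<Longrightarrow> ((\<lambda>x. (1 - x / n) * h x) has_real_derivative dg x) (at x)"
    and dgc: "continuous_on {0..n} dg"
  shows "(LINT x|lborel. indicator {0..n} x * (dg x * (LINT t|lborel. h t * (ln \<bar>t - x\<bar> - ln \<bar>t\<bar>)))) \<le>
    (LINT x|lborel. \<bar>b x\<bar>)\<^sup>2 / n -
    (LINT p|(lborel \<Otimes>\<^sub>M lborel). tent n (fst p) * (b (fst p) * b (snd p) / (fst p + snd p)))"
proof -
  let ?P = "lborel \<Otimes>\<^sub>M lborel :: (real \<times> real) measure"
  define e :: "nat \<Rightarrow> real" where "e k = inverse (real (Suc k))" for k
  have e: "e k > 0" "e k \<le> 1" "e \<longlonglongrightarrow> 0" for k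
    using LIMSEQ_inverse_real_of_nat by (simp_all add: e_def[abs_def] inverse_le_1_iff)
  obtain B where B: "\<And>x. \<bar>x\<bar> \<le> n \<Longrightarrow> (LINT t|lborel. \<bar>h t\<bar> * log_kernel 1 (t - x)) \<le> B"
    by (rule log_kernel_uniform_bound, rule that) assumption+
  define D where "D x = indicator {0..n} x * dg x" for x
  have iD: "integrable lborel D"
    using borel_integrable_atLeastAtMost'[OF dgc] by (simp add: D_def[abs_def] set_integrable_def)
  then have mD [measurable]: "D \<in> borel_measurable borel" by auto
  define \<Phi> where "\<Phi> k x = (LINT t|lborel. h t * reg_log (e k) x t)" for k x
  define \<Phi>0 where "\<Phi>0 x = (LINT t|lborel. h t * (ln \<bar>t - x\<bar> - ln \<bar>t\<bar>))" for x
  have [measurable]: "\<Phi> k \<in> borel_measurable borel" "\<Phi>0 \<in> borel_measurable borel" for k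
    unfolding \<Phi>_def \<Phi>0_def reg_log_def by measurable
  have ilk: "integrable lborel (\<lambda>t. \<bar>h t\<bar> * log_kernel 1 (t - x))" for x
    using h_int by (intro integrable_log_kernel continuous_intros h_cont) simp
  define w where "w x t = \<bar>h t\<bar> * ln (2 * (1 + x\<^sup>2)) + \<bar>h t\<bar> * log_kernel 1 (t - x) + \<bar>h t\<bar> * log_kernel 1 (t - 0)" for x t
  have iw: "integrable lborel (w x)" for x
    unfolding w_def using h_int by (intro Bochner_Integration.integrable_add ilk) simp
  have rw: "AE t in lborel. norm (h t * reg_log (e k) x t) \<le> w x t" for k x
    using AE_lborel_singleton[of 0] AE_lborel_singleton[of x]
  proof eventually_elim
    case (elim t)
    then have "\<bar>h t\<bar> * \<bar>reg_log (e k) x t\<bar> \<le> \<bar>h t\<bar> * (ln (2 * (1 + x\<^sup>2)) + log_kernel 1 (t - x) + log_kernel 1 t)"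
      using e by (intro mult_left_mono reg_log_bound_uniform) simp_all
    then show ?case by (simp add: w_def abs_mult distrib_left)
  qed
  have lim\<Phi>: "(\<lambda>k. \<Phi> k x) \<longlonglongrightarrow> \<Phi>0 x" for x
    unfolding \<Phi>_def \<Phi>0_def
  proof (rule integral_dominated_convergence[OF _ _ iw[of x] _ rw])
    show "AE t in lborel. (\<lambda>k. h t * reg_log (e k) x t) \<longlonglongrightarrow> h t * (ln \<bar>t - x\<bar> - ln \<bar>t\<bar>)"
      using AE_lborel_singleton[of 0] AE_lborel_singleton[of x]
      by eventually_elim (intro tendsto_intros reg_log_tendsto e; simp)
  qed (simp_all add: reg_log_def)
  define M where "M = (LINT t|lborel. \<bar>h t\<bar>) * ln (2 * (1 + n\<^sup>2)) + B + B"
  have b\<Phi>: "\<bar>\<Phi> k x\<bar> \<le> M" if x: "\<bar>x\<bar> \<le> n" for k x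
  proof -
    have "\<bar>\<Phi> k x\<bar> \<le> (LINT t|lborel. \<bar>h t * reg_log (e k) x t\<bar>)"
      unfolding \<Phi>_def using integral_norm_bound[of lborel "\<lambda>t. h t * reg_log (e k) x t"] by simp
    also have "\<dots> \<le> (LINT t|lborel. w x t)"
      using rw[of k x] by (intro integral_mono_AE' iw) (auto elim!: eventually_mono intro: order_trans[OF abs_ge_zero])
    also have "\<dots> = (LINT t|lborel. \<bar>h t\<bar>) * ln (2 * (1 + x\<^sup>2)) + (LINT t|lborel. \<bar>h t\<bar> * log_kernel 1 (t - x)) + (LINT t|lborel. \<bar>h t\<bar> * log_kernel 1 (t - 0))"
    proof -
      have i0: "integrable lborel (\<lambda>t. \<bar>h t\<bar> * ln (2 * (1 + x\<^sup>2)))" using h_int by simp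
      show ?thesis unfolding w_def
        Bochner_Integration.integral_add[OF Bochner_Integration.integrable_add[OF i0 ilk[of x]] ilk[of 0]]
        Bochner_Integration.integral_add[OF i0 ilk[of x]] by simp
    qed
    also have "\<dots> \<le> M" unfolding M_def
    proof (intro add_mono mult_left_mono)
      have "x\<^sup>2 \<le> n\<^sup>2" using x n by (simp add: abs_le_square_iff[symmetric])
      then show "ln (2 * (1 + x\<^sup>2)) \<le> ln (2 * (1 + n\<^sup>2))" by (subst ln_le_cancel_iff) (simp_all add: add_pos_nonneg)
    qed (use B[OF x] B[of 0] n in \<open>simp_all add: integral_nonneg_AE\<close>)
    finally show ?thesis .
  qed
  have l1: "(\<lambda>k. LINT x|lborel. D x * \<Phi> k x) \<longlonglongrightarrow> (LINT x|lborel. D x * \<Phi>0 x)"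
  proof (rule integral_dominated_convergence)
    show "integrable lborel (\<lambda>x. \<bar>D x\<bar> * M)" using iD by simp
    show "AE x in lborel. (\<lambda>k. D x * \<Phi> k x) \<longlonglongrightarrow> D x * \<Phi>0 x"
      by (intro AE_I2 tendsto_intros lim\<Phi>)
    have "norm (D x * \<Phi> k x) \<le> \<bar>D x\<bar> * M" for k x
    proof (cases "x \<in> {0..n}")
      case True
      then have "\<bar>D x\<bar> * \<bar>\<Phi> k x\<bar> \<le> \<bar>D x\<bar> * M" by (intro mult_left_mono b\<Phi>) simp_all
      then show ?thesis by (simp add: abs_mult)
    qed (simp add: D_def)
    then show "AE x in lborel. norm (D x * \<Phi> k x) \<le> \<bar>D x\<bar> * M" for k by (intro AE_I2)
  qed measurable
  define Q where "Q k p = b (fst p) * b (snd p) * (tent n (fst p) * conj_kernel (e k) (fst p + snd p))" for k p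
  define Q0 where "Q0 p = tent n (fst p) * (b (fst p) * b (snd p) / (fst p + snd p))" for p
  have mck [measurable]: "conj_kernel y \<in> borel_measurable borel" for y unfolding conj_kernel_def by measurable
  have tb: "\<bar>tent n x\<bar> \<le> 1" for x using tent_bound[OF n] by simp
  have Q0i: "integrable ?P Q0" unfolding Q0_def by (rule b_pair_integrable[OF _ tb]) measurable
  have l2: "(\<lambda>k. integral\<^sup>L ?P (Q k)) \<longlonglongrightarrow> integral\<^sup>L ?P Q0"
  proof (rule integral_dominated_convergence)
    show "integrable ?P (\<lambda>p. \<bar>Q0 p\<bar>)" by (rule integrable_abs[OF Q0i])
    have pt: "(\<lambda>k. Q k p) \<longlonglongrightarrow> Q0 p" "\<bar>Q k p\<bar> \<le> \<bar>Q0 p\<bar>" for p k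
    proof -
      obtain x t where p: "p = (x, t)" by (cases p)
      have "(\<lambda>k. Q k p) \<longlonglongrightarrow> Q0 p \<and> \<bar>Q k p\<bar> \<le> \<bar>Q0 p\<bar>"
      proof (cases "b x * b t = 0")
        case True
        then show ?thesis by (auto simp: Q_def Q0_def p)
      next
        case False
        then have "x > 0" "t > 0" using h_zero by (auto simp: b_def indicator_def less_le split: if_splits)
        then have s: "x + t > 0" by simp
        have "(\<lambda>k. b x * b t * (tent n x * ((x + t) / ((e k)\<^sup>2 + (x + t)\<^sup>2)))) \<longlonglongrightarrow> b x * b t * (tent n x * ((x + t) / (0\<^sup>2 + (x + t)\<^sup>2)))"
          by (intro tendsto_intros e) (use s in simp)
        moreover have "b x * b t * (tent n x * ((x + t) / (0\<^sup>2 + (x + t)\<^sup>2))) = Q0 p"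
          using s by (simp add: Q0_def p power2_eq_square)
        moreover have "\<bar>Q k p\<bar> \<le> \<bar>Q0 p\<bar>"
        proof -
          have "(x + t) / ((e k)\<^sup>2 + (x + t)\<^sup>2) \<le> (x + t) / (x + t)\<^sup>2"
            using s by (intro divide_left_mono mult_pos_pos add_nonneg_pos) simp_all
          also have "\<dots> = 1 / (x + t)" using s by (simp add: power2_eq_square)
          finally have "\<bar>conj_kernel (e k) (x + t)\<bar> \<le> 1 / (x + t)" using s by (simp add: conj_kernel_def)
          then have "\<bar>b x * b t * tent n x\<bar> * \<bar>conj_kernel (e k) (x + t)\<bar> \<le> \<bar>b x * b t * tent n x\<bar> * (1 / (x + t))"
            by (rule mult_left_mono) simp
          then show ?thesis using s by (simp add: Q_def Q0_def p abs_mult mult_ac)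
        qed
        ultimately show ?thesis unfolding Q_def p conj_kernel_def by simp
      qed
      then show "(\<lambda>k. Q k p) \<longlonglongrightarrow> Q0 p" "\<bar>Q k p\<bar> \<le> \<bar>Q0 p\<bar>" by blast+
    qed
    show "AE p in ?P. (\<lambda>k. Q k p) \<longlonglongrightarrow> Q0 p" "AE p in ?P. norm (Q k p) \<le> \<bar>Q0 p\<bar>" for k
      using pt by simp_all
  qed (unfold Q_def Q0_def, measurable)
  have "(LINT x|lborel. D x * \<Phi> k x) \<le> (LINT x|lborel. \<bar>b x\<bar>)\<^sup>2 / n - integral\<^sup>L ?P (Q k)" for k
    using quadratic_form_regularised[OF n e(1)[of k] dg dgc] unfolding D_def \<Phi>_def Q_def by (simp add: mult.assoc)
  moreover have "(\<lambda>k. (LINT x|lborel. \<bar>b x\<bar>)\<^sup>2 / n - integral\<^sup>L ?P (Q k)) \<longlonglongrightarrow> (LINT x|lborel. \<bar>b x\<bar>)\<^sup>2 / n - integral\<^sup>L ?P Q0"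
    by (intro tendsto_intros l2)
  ultimately have "(LINT x|lborel. D x * \<Phi>0 x) \<le> (LINT x|lborel. \<bar>b x\<bar>)\<^sup>2 / n - integral\<^sup>L ?P Q0"
    using l1 by (intro LIMSEQ_le) auto
  then show ?thesis unfolding D_def \<Phi>0_def Q0_def by (simp add: mult.assoc)
qed

end

section \<open>Positivity of the kernel \<open>1 / (x + t)\<close>\<close>

lemma laplace_exp:
  fixes s :: real
  assumes s: "s > 0"
  shows "integrable lborel (\<lambda>l. indicator {0..} l * exp (- (l * s)))"
    and "(LINT l|lborel. indicator {0..} l * exp (- (l * s))) = 1 / s"
proof -
  have D: "((\<lambda>l. - exp (- (l * s)) / s) has_real_derivative exp (- (l * s))) (at l)" for l
    using s by (auto intro!: derivative_eq_intros)
  have lim: "((\<lambda>l. - exp (- (l * s)) / s) \<longlongrightarrow> 0) at_top" using s by real_asymp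
  show i: "integrable lborel (\<lambda>l. indicator {0..} l * exp (- (l * s)))"
    by (rule integrable_FTC_atLeast_nonneg[OF D _ _ lim]) simp_all
  have "(LINT l|lborel. indicator {0..} l *\<^sub>R exp (- (l * s))) = 0 - (- exp (- (0 * s)) / s)"
  proof (rule integral_FTC_atLeast[OF _ _ _ lim])
    show "integrable lborel (\<lambda>l. indicator {0..} l *\<^sub>R exp (- (l * s)))" using i by simp
    show "((\<lambda>l. - exp (- (l * s)) / s) has_vector_derivative exp (- (l * s))) (at l)" for l
      using D by (simp only: has_real_derivative_iff_has_vector_derivative)
    show "continuous_on {0..} (\<lambda>l. exp (- (l * s)))" by (intro continuous_intros)
  qed
  then show "(LINT l|lborel. indicator {0..} l * exp (- (l * s))) = 1 / s" by simp
qed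

context even_density begin

text \<open>The kernel \<open>1/(x+t)\<close> is a superposition of the rank-one kernels
  \<open>exp (-l x) exp (-l t)\<close>.\<close>

lemma cauchy_kernel_nonneg:
  "0 \<le> (LINT p|(lborel \<Otimes>\<^sub>M lborel). b (fst p) * b (snd p) / (fst p + snd p))"
proof -
  let ?P = "lborel \<Otimes>\<^sub>M lborel :: (real \<times> real) measure"
  interpret PP: pair_sigma_finite ?P "lborel :: real measure" by standard
  define F where "F p l = indicator {0..} l * ((b (fst p) * exp (- (l * fst p))) * (b (snd p) * exp (- (l * snd p))))"
    for p :: "real \<times> real" and l :: real
  have Feq: "F p l = b (fst p) * b (snd p) * (indicator {0..} l * exp (- (l * (fst p + snd p))))" for p l
    by (simp add: F_def distrib_left exp_add[symmetric])
  \<comment> \<open>The Laplace formula needs a strictly positive argument; where the product is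
    nonzero both variables are positive, because \<open>b\<close> vanishes at 0.\<close>
  have nz: "fst p + snd p > 0" if "b (fst p) * b (snd p) \<noteq> 0" for p
  proof -
    have "fst p > 0" "snd p > 0" using that h_zero by (auto simp: b_def indicator_def less_le split: if_splits)
    then show ?thesis by simp
  qed
  have il: "integrable lborel (F p)" "(LINT l|lborel. F p l) = b (fst p) * b (snd p) / (fst p + snd p)"
    "(LINT l|lborel. norm (F p l)) = \<bar>b (fst p) * b (snd p) / (fst p + snd p)\<bar>" for p
  proof -
    have "integrable lborel (F p) \<and> (LINT l|lborel. F p l) = b (fst p) * b (snd p) / (fst p + snd p) \<and>
      (LINT l|lborel. norm (F p l)) = \<bar>b (fst p) * b (snd p) / (fst p + snd p)\<bar>"
    proof (cases "b (fst p) * b (snd p) = 0")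
      case True
      then show ?thesis unfolding Feq by auto
    next
      case False
      from laplace_exp[OF nz[OF this]] nz[OF this] show ?thesis unfolding Feq by (simp add: abs_mult)
    qed
    then show "integrable lborel (F p)" "(LINT l|lborel. F p l) = b (fst p) * b (snd p) / (fst p + snd p)"
      "(LINT l|lborel. norm (F p l)) = \<bar>b (fst p) * b (snd p) / (fst p + snd p)\<bar>" by blast+
  qed
  have mF: "case_prod F \<in> borel_measurable (?P \<Otimes>\<^sub>M lborel)" unfolding F_def by measurable
  have iQ: "integrable ?P (\<lambda>p. b (fst p) * b (snd p) / (fst p + snd p))"
    using b_pair_integrable[of "\<lambda>_. 1"] by simp
  have iF: "integrable (?P \<Otimes>\<^sub>M lborel) (case_prod F)"
  proof (rule PP.Fubini_integrable[OF mF])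
    show "integrable ?P (\<lambda>p. LINT l|lborel. norm (case_prod F (p, l)))"
      using integrable_abs[OF iQ] by (simp only: prod.case il(3))
  qed (simp add: il(1))
  have "(LINT p|?P. b (fst p) * b (snd p) / (fst p + snd p)) = (LINT p|?P. LINT l|lborel. F p l)"
    unfolding il(2) ..
  also have "\<dots> = (LINT l|lborel. LINT p|?P. F p l)" by (rule PP.Fubini_integral[OF iF, symmetric])
  also have "0 \<le> \<dots>"
  proof (rule Bochner_Integration.integral_nonneg)
    fix l
    show "0 \<le> (LINT p|?P. F p l)"
    proof (cases "0 \<le> l")
      case True
      define a where "a x = b x * exp (- (l * x))" for x
      have ab: "\<bar>a x\<bar> \<le> \<bar>b x\<bar>" for x
      proof (cases "0 \<le> x")
        case x: True
        have "\<bar>b x\<bar> * exp (- (l * x)) \<le> \<bar>b x\<bar> * 1" using x True by (intro mult_left_mono) simp_all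
        then show ?thesis by (simp add: a_def abs_mult)
      qed (simp add: a_def b_def)
      have i: "integrable ?P (\<lambda>p. a (fst p) * a (snd p))"
      proof (rule integrable_pair_bound)
        show "integrable lborel (\<lambda>x. \<bar>b x\<bar>)" "integrable lborel (\<lambda>x. \<bar>b x\<bar>)" using b_int by simp_all
        show "(\<lambda>p. a (fst p) * a (snd p)) \<in> borel_measurable ?P" unfolding a_def by measurable
        show "norm (a (fst (x, t)) * a (snd (x, t))) \<le> \<bar>b x\<bar> * \<bar>b t\<bar>" for x t
          using ab[of x] ab[of t] by (simp add: abs_mult mult_mono)
      qed
      have "(LINT p|?P. F p l) = (LINT p|?P. a (fst p) * a (snd p))"
        using True by (simp add: F_def a_def)
      also have "\<dots> = (LINT x|lborel. LINT t|lborel. a x * a t)"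
        using lborel_pair.integral_fst'[OF i, symmetric] by (simp only: fst_conv snd_conv)
      also have "\<dots> = (LINT x|lborel. a x) * (LINT t|lborel. a t)" by simp
      finally show ?thesis by simp
    qed (simp add: F_def)
  qed
  finally show ?thesis .
qed

lemma tent_pairing_tendsto:
  "(\<lambda>k. LINT p|(lborel \<Otimes>\<^sub>M lborel). tent (real (Suc k)) (fst p) * (b (fst p) * b (snd p) / (fst p + snd p)))
    \<longlonglongrightarrow> (LINT p|(lborel \<Otimes>\<^sub>M lborel). b (fst p) * b (snd p) / (fst p + snd p))"
proof (rule integral_dominated_convergence)
  let ?P = "lborel \<Otimes>\<^sub>M lborel :: (real \<times> real) measure"
  have iQ: "integrable ?P (\<lambda>p. b (fst p) * b (snd p) / (fst p + snd p))"
    using b_pair_integrable[of "\<lambda>_. 1"] by simp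
  show "integrable ?P (\<lambda>p. \<bar>b (fst p) * b (snd p) / (fst p + snd p)\<bar>)" by (rule integrable_abs[OF iQ])
  have l: "(\<lambda>k. tent (real (Suc k)) x) \<longlonglongrightarrow> 1" for x
  proof -
    have "(\<lambda>k. max 0 (1 - \<bar>x\<bar> * inverse (real (Suc k)))) \<longlonglongrightarrow> max 0 (1 - \<bar>x\<bar> * 0)"
      by (intro tendsto_intros LIMSEQ_inverse_real_of_nat)
    then show ?thesis by (simp add: tent_def divide_inverse)
  qed
  have "(\<lambda>k. tent (real (Suc k)) (fst p) * (b (fst p) * b (snd p) / (fst p + snd p))) \<longlonglongrightarrow> 1 * (b (fst p) * b (snd p) / (fst p + snd p))" for p
    by (intro tendsto_mult l tendsto_const)
  then show "AE p in ?P. (\<lambda>k. tent (real (Suc k)) (fst p) * (b (fst p) * b (snd p) / (fst p + snd p))) \<longlonglongrightarrow> b (fst p) * b (snd p) / (fst p + snd p)"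
    by simp
  have "\<bar>tent (real (Suc k)) x\<bar> * \<bar>c\<bar> \<le> 1 * \<bar>c\<bar>" for k x c
    using tent_bound[of "real (Suc k)" x] by (intro mult_right_mono) simp_all
  then show "AE p in ?P. norm (tent (real (Suc k)) (fst p) * (b (fst p) * b (snd p) / (fst p + snd p))) \<le> \<bar>b (fst p) * b (snd p) / (fst p + snd p)\<bar>" for k
    by (intro AE_I2) (simp only: real_norm_def abs_mult[of "tent _ _"] mult_1_left)
qed measurable

end

section \<open>Uniqueness\<close>

lemma DERIV_nonpos_of_decreasing:
  fixes c :: "real \<Rightarrow> real"
  assumes D: "(c has_real_derivative d) (at x)" and dec: "\<And>y. x < y \<Longrightarrow> c y \<le> c x"
  shows "d \<le> 0"
proof (rule ccontr)
  assume "\<not> d \<le> 0"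
  then obtain e where e: "e > 0" "\<And>y. 0 < y \<Longrightarrow> y < e \<Longrightarrow> c x < c (x + y)"
    using DERIV_pos_inc_right[OF D] by auto
  show False using e(2)[of "e / 2"] e(1) dec[of "x + e / 2"] by simp
qed

text \<open>If the solutions differ somewhere, the two evaluations give a positive lower bound
  independent of \<open>n\<close> and an upper bound whose limit is minus a nonnegative quadratic
  form.\<close>

lemma liouville_unique:
  assumes S: "liouville_solution K W C \<delta>" and S': "liouville_solution K W' C \<delta>" and eq0: "W' 0 = W 0"
    and DW: "\<And>x. (W has_real_derivative dW x) (at x)" and cW: "continuous_on UNIV dW"
    and DW': "\<And>x. (W' has_real_derivative dW' x) (at x)" and cW': "continuous_on UNIV dW'"
    and DK: "\<And>x. (K has_real_derivative dK x) (at x)" and cK: "continuous_on UNIV dK"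
  shows "W' x1 = W x1"
proof (rule ccontr)
  assume ne: "W' x1 \<noteq> W x1"
  interpret S: liouville_solution K W C \<delta> by (rule S)
  interpret S': liouville_solution K W' C \<delta> by (rule S')
  note cts = S.W_cont S'.W_cont S.K_cont cW cW' cK
  define \<alpha> where "\<alpha> = \<bar>x1\<bar>"
  have ne\<alpha>: "W' \<alpha> \<noteq> W \<alpha>" using ne S.W_even[of x1] S'.W_even[of x1] by (auto simp: \<alpha>_def abs_if)
  then have \<alpha>: "\<alpha> > 0" using eq0 by (auto simp: \<alpha>_def)
  define \<phi> where "\<phi> x = W' x - W x" for x
  define h where "h x = K x * (exp (W' x) - exp (W x))" for x
  define c0 where "c0 x = K x * exp ((W x + W' x) / 2)" for x
  define \<Psi> where "\<Psi> x = 4 * (cosh (\<phi> x / 2) - 1)" for x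
  define dh where "dh x = dK x * (exp (W' x) - exp (W x)) + (exp (W' x) * dW' x - exp (W x) * dW x) * K x" for x
  define dc0 where "dc0 x = dK x * exp ((W x + W' x) / 2) + exp ((W x + W' x) / 2) * ((dW x + dW' x) / 2) * K x" for x
  define d\<Psi> where "d\<Psi> x = 2 * sinh (\<phi> x / 2) * (dW' x - dW x)" for x
  have D\<phi>: "(\<phi> has_real_derivative dW' x - dW x) (at x)" for x
    unfolding \<phi>_def by (intro DERIV_diff DW DW')
  have Dh: "(h has_real_derivative dh x) (at x)" for x
    unfolding h_def[abs_def] dh_def by (intro DERIV_mult DK DERIV_diff DERIV_fun_exp DW DW')
  have Dc0: "(c0 has_real_derivative dc0 x) (at x)" for x
    unfolding c0_def[abs_def] dc0_def by (intro DERIV_mult DK DERIV_fun_exp DERIV_cdivide DERIV_add DW DW')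
  have D\<Psi>: "(\<Psi> has_real_derivative d\<Psi> x) (at x)" for x
    unfolding \<Psi>_def[abs_def] d\<Psi>_def by (auto intro!: derivative_eq_intros D\<phi>)
  have ch: "continuous_on UNIV h" and cc0: "continuous_on UNIV c0" and c\<phi>: "continuous_on UNIV \<phi>" and c\<Psi>: "continuous_on UNIV \<Psi>"
    using DERIV_isCont[OF Dh] DERIV_isCont[OF Dc0] DERIV_isCont[OF D\<phi>] DERIV_isCont[OF D\<Psi>]
    by (blast intro: continuous_at_imp_continuous_on)+
  have cdh: "continuous_on UNIV dh" and cdc0: "continuous_on UNIV dc0"
    unfolding dh_def dc0_def by (intro continuous_intros cts; simp)+
  \<comment> \<open>Factoring out the geometric mean \<open>exp ((W x + W' x) / 2)\<close> leaves
    \<open>2 * sinh (\<phi> x / 2)\<close>, whose product with the derivative of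
    \<open>\<phi>\<close> is the derivative of \<open>4 * cosh (\<phi> x / 2)\<close>.\<close>
  have key: "h x * (dW' x - dW x) = c0 x * d\<Psi> x" for x
  proof -
    have e1: "exp ((W x + W' x) / 2) * exp (\<phi> x / 2) = exp (W' x)"
      unfolding exp_add[symmetric] \<phi>_def by (simp add: diff_divide_distrib add_divide_distrib)
    have e2: "exp ((W x + W' x) / 2) * exp (- (\<phi> x / 2)) = exp (W x)"
      unfolding exp_add[symmetric] \<phi>_def by (simp add: diff_divide_distrib add_divide_distrib)
    have "2 * sinh (\<phi> x / 2) = exp (\<phi> x / 2) - exp (- (\<phi> x / 2))" by (simp add: sinh_field_def)
    then have "exp ((W x + W' x) / 2) * (2 * sinh (\<phi> x / 2)) = exp (W' x) - exp (W x)"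
      by (simp only: right_diff_distrib e1 e2)
    then have "h x = K x * (exp ((W x + W' x) / 2) * (2 * sinh (\<phi> x / 2)))" by (simp add: h_def)
    then show ?thesis by (simp add: c0_def d\<Psi>_def)
  qed
  have h_eq: "h x = S'.f x - S.f x" for x by (simp add: h_def S.f_def S'.f_def right_diff_distrib)
  interpret E: even_density h
  proof
    show "integrable lborel h" unfolding h_eq[abs_def] by (intro Bochner_Integration.integrable_diff S.f_int S'.f_int)
    show "h (- x) = h x" for x by (simp add: h_def S.K_even S.W_even S'.W_even)
    show "continuous_on UNIV h" by (rule ch)
    show "h 0 = 0" by (simp add: h_def eq0)
  qed
  \<comment> \<open>The two-point formula with base point 0 for both solutions; their values at 0
    cancel.\<close>
  have rep: "(LINT t|lborel. h t * (ln \<bar>t - x\<bar> - ln \<bar>t\<bar>)) = - pi * \<phi> x" for x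
  proof -
    have i: "integrable lborel (\<lambda>t. S.f t * (ln \<bar>t - 0\<bar> - ln \<bar>t - x\<bar>))" "integrable lborel (\<lambda>t. S'.f t * (ln \<bar>t - 0\<bar> - ln \<bar>t - x\<bar>))"
      unfolding S.f_def S'.f_def by (rule S.integrable_repr S'.integrable_repr)+
    have "pi * \<phi> x = pi * (W' x - W' 0) - pi * (W x - W 0)" by (simp add: \<phi>_def eq0 right_diff_distrib)
    also have "\<dots> = (LINT t|lborel. S'.f t * (ln \<bar>t - 0\<bar> - ln \<bar>t - x\<bar>)) - (LINT t|lborel. S.f t * (ln \<bar>t - 0\<bar> - ln \<bar>t - x\<bar>))"
      unfolding S.f_def S'.f_def S.repr S'.repr ..
    also have "\<dots> = (LINT t|lborel. S'.f t * (ln \<bar>t - 0\<bar> - ln \<bar>t - x\<bar>) - S.f t * (ln \<bar>t - 0\<bar> - ln \<bar>t - x\<bar>))"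
      by (rule Bochner_Integration.integral_diff[OF i(2) i(1), symmetric])
    also have "\<dots> = (LINT t|lborel. - (h t * (ln \<bar>t - x\<bar> - ln \<bar>t\<bar>)))"
      by (rule Bochner_Integration.integral_cong[OF refl]) (simp add: h_eq algebra_simps)
    finally show ?thesis by simp
  qed
  have c0_pos: "c0 x > 0" for x by (simp add: c0_def S.K_pos)
  \<comment> \<open>Strictness comes from \<open>W\<close> and \<open>W'\<close>, as
    \<open>K\<close> is only non-increasing.\<close>
  have c0_dec: "c0 y < c0 x" if "0 \<le> x" "x < y" for x y
  proof -
    have "W y < W x" "W' y < W' x" using S.W_strict_decreasing[OF that] S'.W_strict_decreasing[OF that] .
    then have "exp ((W y + W' y) / 2) < exp ((W x + W' x) / 2)" by simp
    then have "K y * exp ((W y + W' y) / 2) < K y * exp ((W x + W' x) / 2)" using S.K_pos[of y] by (rule mult_strict_left_mono)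
    also have "\<dots> \<le> K x * exp ((W x + W' x) / 2)" using that by (intro mult_right_mono S.K_mono) simp_all
    finally show ?thesis unfolding c0_def .
  qed
  have dc0: "dc0 x \<le> 0" if "0 \<le> x" for x
    using DERIV_nonpos_of_decreasing[OF Dc0] c0_dec that by (meson less_imp_le)
  have \<Psi>0: "\<Psi> x \<ge> 0" for x using cosh_real_ge_1[of "\<phi> x / 2"] by (simp add: \<Psi>_def)
  have "cosh (\<phi> \<alpha> / 2) \<noteq> 1" using ne\<alpha> by (simp add: \<phi>_def)
  then have \<Psi>\<alpha>: "\<Psi> \<alpha> > 0" using cosh_real_ge_1[of "\<phi> \<alpha> / 2"] by (simp add: \<Psi>_def less_le)
  have "isCont \<Psi> \<alpha>" using c\<Psi> continuous_on_eq_continuous_at[OF open_UNIV] by blast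
  then obtain d where d: "d > 0" "\<And>x. \<bar>x - \<alpha>\<bar> < d \<Longrightarrow> \<bar>\<Psi> x - \<Psi> \<alpha>\<bar> < \<Psi> \<alpha> / 2"
    unfolding continuous_at_eps_delta dist_real_def using \<Psi>\<alpha> by (metis half_gt_zero)
  define \<beta> where "\<beta> = \<alpha> + d / 2"
  have \<beta>: "\<alpha> < \<beta>" "0 < \<beta>" using d(1) \<alpha> by (simp_all add: \<beta>_def)
  have \<Psi>ge: "\<Psi> \<alpha> / 2 \<le> \<Psi> x" if "x \<in> {\<alpha>..\<beta>}" for x
  proof -
    have "\<bar>x - \<alpha>\<bar> < d" using that d(1) by (auto simp: \<beta>_def)
    then have "\<bar>\<Psi> x - \<Psi> \<alpha>\<bar> < \<Psi> \<alpha> / 2" by (rule d(2))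
    then show ?thesis by arith
  qed
  \<comment> \<open>A lower bound independent of \<open>n\<close>: \<open>\<Psi>\<close> is at least
    \<open>\<Psi> \<alpha> / 2\<close> on \<open>[\<alpha>, \<beta>]\<close>, and the factor 1/2
    before the drop of \<open>c0\<close> accounts for the tent, since
    \<open>1 - \<beta> / n \<ge> 1/2\<close> once \<open>n \<ge> 2 * \<beta>\<close>.\<close>
  define \<kappa> where "\<kappa> = \<Psi> \<alpha> / 2 * (1 / 2 * (c0 \<alpha> - c0 \<beta>))"
  have \<kappa>: "\<kappa> > 0" using \<Psi>\<alpha> c0_dec[of \<alpha> \<beta>] \<alpha> \<beta> by (simp add: \<kappa>_def)
  have main: "pi * \<kappa> \<le> (LINT x|lborel. \<bar>E.b x\<bar>)\<^sup>2 / n -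
      (LINT p|(lborel \<Otimes>\<^sub>M lborel). E.tent n (fst p) * (E.b (fst p) * E.b (snd p) / (fst p + snd p)))"
    if n: "2 * \<beta> \<le> n" for n
  proof -
    have n0: "n > 0" using n \<beta> by linarith
    define dg where "dg x = (- 1 / n) * h x + dh x * (1 - x / n)" for x
    define dc where "dc x = (- 1 / n) * c0 x + dc0 x * (1 - x / n)" for x
    have Dl: "((\<lambda>x. 1 - x / n) has_real_derivative - 1 / n) (at x)" for x
      using n0 by (auto intro!: derivative_eq_intros)
    have Dg: "((\<lambda>x. (1 - x / n) * h x) has_real_derivative dg x) (at x)" for x
      unfolding dg_def by (rule DERIV_mult[OF Dl Dh])
    have Dc: "((\<lambda>x. (1 - x / n) * c0 x) has_real_derivative dc x) (at x)" for x
      unfolding dc_def by (rule DERIV_mult[OF Dl Dc0])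
    have cdg: "continuous_on UNIV dg" and cdc: "continuous_on UNIV dc"
      unfolding dg_def dc_def by (intro continuous_intros ch cdh cc0 cdc0; use n0 in simp)+
    have i1: "integrable lborel (\<lambda>x. indicator {0..n} x * (dg x * \<phi> x))"
      using borel_integrable_atLeastAtMost'[OF continuous_on_subset[OF continuous_on_mult[OF cdg c\<phi>] subset_UNIV]] by (simp add: set_integrable_def)
    have i2: "integrable lborel (\<lambda>x. indicator {0..n} x * (dc x * \<Psi> x))"
      using borel_integrable_atLeastAtMost'[OF continuous_on_subset[OF continuous_on_mult[OF cdc c\<Psi>] subset_UNIV]] by (simp add: set_integrable_def)
    have i3: "integrable lborel (\<lambda>x. indicator {\<alpha>..\<beta>} x * dc x)"
      using borel_integrable_atLeastAtMost'[OF continuous_on_subset[OF cdc subset_UNIV]] by (simp add: set_integrable_def)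
    \<comment> \<open>By \<open>key\<close> the terms with the derivative of \<open>\<phi>\<close>
      cancel, so the integrand is a total derivative. The boundary terms vanish at \<open>n\<close>
      through the tent and at 0 because \<open>\<phi>\<close> and \<open>\<Psi>\<close> vanish
      there.\<close>
    have "(LINT x|lborel. indicator {0..n} x *\<^sub>R (dg x * \<phi> x - dc x * \<Psi> x)) =
        ((1 - n / n) * h n * \<phi> n - (1 - n / n) * c0 n * \<Psi> n) - ((1 - 0 / n) * h 0 * \<phi> 0 - (1 - 0 / n) * c0 0 * \<Psi> 0)"
    proof (rule integral_FTC_atLeastAtMost)
      show "continuous_on {0..n} (\<lambda>x. dg x * \<phi> x - dc x * \<Psi> x)"
        by (rule continuous_on_subset[OF _ subset_UNIV]) (intro continuous_intros cdg cdc c\<phi> c\<Psi>)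
      fix x
      have "((\<lambda>x. (1 - x / n) * h x * \<phi> x - (1 - x / n) * c0 x * \<Psi> x) has_real_derivative
          (dg x * \<phi> x + (dW' x - dW x) * ((1 - x / n) * h x)) - (dc x * \<Psi> x + d\<Psi> x * ((1 - x / n) * c0 x))) (at x)"
        by (intro DERIV_diff DERIV_mult[OF Dg D\<phi>] DERIV_mult[OF Dc D\<Psi>])
      moreover have "(dW' x - dW x) * ((1 - x / n) * h x) = d\<Psi> x * ((1 - x / n) * c0 x)"
        using arg_cong[OF key[of x], of "\<lambda>t. (1 - x / n) * t"] by (simp only: mult_ac)
      ultimately have "((\<lambda>x. (1 - x / n) * h x * \<phi> x - (1 - x / n) * c0 x * \<Psi> x) has_real_derivative dg x * \<phi> x - dc x * \<Psi> x) (at x)"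
        by simp
      then show "((\<lambda>x. (1 - x / n) * h x * \<phi> x - (1 - x / n) * c0 x * \<Psi> x) has_vector_derivative dg x * \<phi> x - dc x * \<Psi> x) (at x within {0..n})"
        unfolding has_real_derivative_iff_has_vector_derivative by (rule has_vector_derivative_at_within)
    qed (use n0 in simp)
    also have "\<dots> = 0" using n0 eq0 by (simp add: \<phi>_def \<Psi>_def)
    finally have "(LINT x|lborel. indicator {0..n} x * (dg x * \<phi> x) - indicator {0..n} x * (dc x * \<Psi> x)) = 0"
      by (simp add: right_diff_distrib)
    then have eq: "(LINT x|lborel. indicator {0..n} x * (dg x * \<phi> x)) = (LINT x|lborel. indicator {0..n} x * (dc x * \<Psi> x))"
      using Bochner_Integration.integral_diff[OF i1 i2] by simp
    have "(LINT x|lborel. indicator {0..n} x * (dg x * (- pi * \<phi> x))) \<le> (LINT x|lborel. \<bar>E.b x\<bar>)\<^sup>2 / n -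
      (LINT p|(lborel \<Otimes>\<^sub>M lborel). E.tent n (fst p) * (E.b (fst p) * E.b (snd p) / (fst p + snd p)))"
      using E.quadratic_form_inequality[OF n0 Dg continuous_on_subset[OF cdg subset_UNIV]] unfolding rep .
    moreover have "(LINT x|lborel. indicator {0..n} x * (dg x * (- pi * \<phi> x))) = - pi * (LINT x|lborel. indicator {0..n} x * (dg x * \<phi> x))"
      unfolding integral_mult_right_zero[symmetric] by (rule Bochner_Integration.integral_cong[OF refl]) simp
    \<comment> \<open>The tent times \<open>c0\<close> decreases, so the integrand with its sign is
      nonnegative and restriction to \<open>[\<alpha>, \<beta>]\<close> only loses; there
      \<open>dc\<close> integrates to the drop of the tent times \<open>c0\<close>.\<close>
    moreover have "\<kappa> \<le> - (LINT x|lborel. indicator {0..n} x * (dc x * \<Psi> x))"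
    proof -
      have dc_le: "dc x \<le> 0" if "x \<in> {0..n}" for x
      proof -
        have "0 \<le> c0 x / n" using c0_pos[of x] n0 by simp
        moreover have "dc0 x * (1 - x / n) \<le> 0" using dc0[of x] that n0 by (intro mult_nonpos_nonneg) simp_all
        ultimately show ?thesis by (simp add: dc_def)
      qed
      have "(LINT x|lborel. indicator {\<alpha>..\<beta>} x *\<^sub>R dc x) = (1 - \<beta> / n) * c0 \<beta> - (1 - \<alpha> / n) * c0 \<alpha>"
      proof (rule integral_FTC_atLeastAtMost)
        show "continuous_on {\<alpha>..\<beta>} dc" by (rule continuous_on_subset[OF cdc subset_UNIV])
        show "((\<lambda>x. (1 - x / n) * c0 x) has_vector_derivative dc x) (at x within {\<alpha>..\<beta>})" for x
          using Dc unfolding has_real_derivative_iff_has_vector_derivative by (rule has_vector_derivative_at_within)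
      qed (use \<beta> in simp)
      moreover have "1 / 2 * (c0 \<alpha> - c0 \<beta>) \<le> (1 - \<alpha> / n) * c0 \<alpha> - (1 - \<beta> / n) * c0 \<beta>"
      proof -
        have "1 / 2 \<le> 1 - \<beta> / n" using n n0 by (simp add: field_simps)
        then have "1 / 2 * (c0 \<alpha> - c0 \<beta>) \<le> (1 - \<beta> / n) * (c0 \<alpha> - c0 \<beta>)"
          using c0_dec[of \<alpha> \<beta>] \<alpha> \<beta> by (intro mult_right_mono) simp_all
        moreover have "(1 - \<beta> / n) * c0 \<alpha> \<le> (1 - \<alpha> / n) * c0 \<alpha>"
          using c0_pos[of \<alpha>] \<beta> n0 by (intro mult_right_mono) (simp_all add: divide_right_mono)
        ultimately show ?thesis by (simp add: right_diff_distrib)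
      qed
      ultimately have "1 / 2 * (c0 \<alpha> - c0 \<beta>) \<le> - (LINT x|lborel. indicator {\<alpha>..\<beta>} x * dc x)" by simp
      then have "\<kappa> \<le> \<Psi> \<alpha> / 2 * - (LINT x|lborel. indicator {\<alpha>..\<beta>} x * dc x)"
        unfolding \<kappa>_def using \<Psi>\<alpha> by (intro mult_left_mono) simp_all
      also have "\<dots> = (LINT x|lborel. - (\<Psi> \<alpha> / 2) * (indicator {\<alpha>..\<beta>} x * dc x))"
        by (subst integral_mult_right_zero) simp
      also have "\<dots> \<le> (LINT x|lborel. - (indicator {0..n} x * (dc x * \<Psi> x)))"
      proof (rule integral_mono)
        show "integrable lborel (\<lambda>x. - (\<Psi> \<alpha> / 2) * (indicator {\<alpha>..\<beta>} x * dc x))" using i3 by (rule integrable_mult_right)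
        show "integrable lborel (\<lambda>x. - (indicator {0..n} x * (dc x * \<Psi> x)))" using i2 by simp
        fix x
        show "- (\<Psi> \<alpha> / 2) * (indicator {\<alpha>..\<beta>} x * dc x) \<le> - (indicator {0..n} x * (dc x * \<Psi> x))"
        proof (cases "x \<in> {\<alpha>..\<beta>}")
          case True
          then have x: "x \<in> {0..n}" using \<alpha> \<beta> n by auto
          have "dc x * \<Psi> x \<le> dc x * (\<Psi> \<alpha> / 2)" using \<Psi>ge[OF True] dc_le[OF x] by (rule mult_left_mono_neg)
          then show ?thesis using True x by (simp add: mult.commute)
        next
          case False
          have "0 \<le> - (indicator {0..n} x * (dc x * \<Psi> x))"
          proof (cases "x \<in> {0..n}")
            case True
            then show ?thesis using mult_nonpos_nonneg[OF dc_le[OF True] \<Psi>0[of x]] by simp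
          qed simp
          then show ?thesis using False by simp
        qed
      qed
      finally show ?thesis by simp
    qed
    then have "pi * \<kappa> \<le> pi * - (LINT x|lborel. indicator {0..n} x * (dc x * \<Psi> x))" by (rule mult_left_mono) simp
    ultimately show ?thesis unfolding eq by simp
  qed
  define Q where "Q = (LINT p|(lborel \<Otimes>\<^sub>M lborel). E.b (fst p) * E.b (snd p) / (fst p + snd p))"
  have "(\<lambda>k. (LINT x|lborel. \<bar>E.b x\<bar>)\<^sup>2 / real (Suc k) -
      (LINT p|(lborel \<Otimes>\<^sub>M lborel). E.tent (real (Suc k)) (fst p) * (E.b (fst p) * E.b (snd p) / (fst p + snd p)))) \<longlonglongrightarrow> 0 - Q"
  proof (intro tendsto_diff)
    show "(\<lambda>k. (LINT x|lborel. \<bar>E.b x\<bar>)\<^sup>2 / real (Suc k)) \<longlonglongrightarrow> 0"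
      using tendsto_mult_left[OF LIMSEQ_inverse_real_of_nat, of "(LINT x|lborel. \<bar>E.b x\<bar>)\<^sup>2"] by (simp add: divide_inverse)
    show "(\<lambda>k. LINT p|(lborel \<Otimes>\<^sub>M lborel). E.tent (real (Suc k)) (fst p) * (E.b (fst p) * E.b (snd p) / (fst p + snd p))) \<longlonglongrightarrow> Q"
      unfolding Q_def by (rule E.tent_pairing_tendsto)
  qed
  moreover have "\<exists>N. \<forall>k\<ge>N. pi * \<kappa> \<le> (LINT x|lborel. \<bar>E.b x\<bar>)\<^sup>2 / real (Suc k) -
      (LINT p|(lborel \<Otimes>\<^sub>M lborel). E.tent (real (Suc k)) (fst p) * (E.b (fst p) * E.b (snd p) / (fst p + snd p)))"
  proof -
    obtain N where "2 * \<beta> < real N" using reals_Archimedean2 by blast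
    then have "2 * \<beta> \<le> real (Suc k)" if "N \<le> k" for k using that by simp
    then show ?thesis using main by blast
  qed
  ultimately have "pi * \<kappa> \<le> 0 - Q" by (rule LIMSEQ_le_const)
  moreover have "0 \<le> Q" unfolding Q_def by (rule E.cauchy_kernel_nonneg)
  moreover have "0 < pi * \<kappa>" using \<kappa> by simp
  ultimately show False by linarith
qed

section \<open>From weak solutions to the integral equation\<close>

lemma L_half_measurable:
  assumes "w \<in> L_half"
  shows "w \<in> borel_measurable lebesgue"
proof (rule borel_measurable_LIMSEQ_real)
  show "(\<lambda>x. indicator {- real n..real n} x *\<^sub>R w x) \<in> borel_measurable lebesgue" for n
    using assms by (intro borel_measurable_integrable) (simp add: L_half_def set_integrable_def)
  fix x
  obtain N where "\<bar>x\<bar> \<le> real N" using real_arch_simple by blast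
  then have "\<forall>\<^sub>F n in sequentially. indicator {- real n..real n} x *\<^sub>R w x = w x"
    unfolding eventually_sequentially by (intro exI[of _ N]) (auto simp: indicator_def)
  then show "(\<lambda>n. indicator {- real n..real n} x *\<^sub>R w x) \<longlonglongrightarrow> w x" by (rule tendsto_eventually)
qed

lemma C1_half_loc_deriv:
  assumes "C1_half_loc W"
  shows "(W has_real_derivative deriv W x) (at x)" and "continuous_on UNIV (deriv W)"
proof -
  show "(W has_real_derivative deriv W x) (at x)"
    using assms by (simp add: C1_half_loc_def DERIV_deriv_iff_real_differentiable)
  have "isCont (deriv W) x" for x
  proof -
    have "compact {x - 1..x + 1}" by simp
    then obtain C where C: "\<And>a b. a \<in> {x - 1..x + 1} \<Longrightarrow> b \<in> {x - 1..x + 1} \<Longrightarrow> \<bar>deriv W a - deriv W b\<bar> \<le> C * \<bar>a - b\<bar> powr (1/2)"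
      using assms[unfolded C1_half_loc_def, THEN conjunct2, rule_format, of "{x - 1..x + 1}"] by blast
    have "((\<lambda>a. C * sqrt \<bar>a - x\<bar>) \<longlongrightarrow> C * sqrt \<bar>x - x\<bar>) (at x)" by (intro tendsto_intros)
    then have l: "((\<lambda>a. C * \<bar>a - x\<bar> powr (1/2)) \<longlongrightarrow> 0) (at x)" by (simp add: powr_half_sqrt)
    have "\<forall>\<^sub>F a in at x. norm (deriv W a - deriv W x) \<le> C * \<bar>a - x\<bar> powr (1/2)"
      unfolding eventually_at real_norm_def dist_real_def
    proof (intro exI[of _ 1] conjI ballI impI)
      fix a assume "a \<noteq> x \<and> \<bar>a - x\<bar> < 1"
      then have "a \<in> {x - 1..x + 1}" "x \<in> {x - 1..x + 1}" by auto
      then show "\<bar>deriv W a - deriv W x\<bar> \<le> C * \<bar>a - x\<bar> powr (1/2)" by (rule C)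
    qed simp
    from Lim_null_comparison[OF this l] show ?thesis
      unfolding isCont_def by (simp only: LIM_zero_iff)
  qed
  then show "continuous_on UNIV (deriv W)" by (simp add: continuous_at_imp_continuous_on)
qed

text \<open>Two passages are made: from \<open>w\<close> to its continuous representative, which
  changes no Lebesgue integral, and from Lebesgue to Borel measure, which is possible once the
  integrands are Borel. Squaring the bound on \<open>sqrt (K x)\<close> doubles
  \<open>\<delta>\<close>.\<close>

lemma liouville_solution_of_weak:
  assumes A: "assumption_A K" and bound: "\<And>x. sqrt (K x) \<le> C * japanese_bracket x powr (- 1/2 - \<delta>)" and \<delta>: "\<delta> > 0"
    and w: "w \<in> L_half" and int: "integrable lebesgue (\<lambda>x. K x * exp (w x))"
    and sol: "solves_liouville K w" and rep: "regular_representative W w"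
  shows "liouville_solution K W (C\<^sup>2) (2 * \<delta>)"
proof -
  have Kpos: "K x > 0" for x using A by (simp add: assumption_A_def)
  have cK: "continuous_on UNIV K"
    using A by (intro C1_differentiable_imp_continuous_on) (simp add: assumption_A_def)
  have "C1_half_loc W" and ae: "AE x in lebesgue. w x = W x"
    using rep by (auto simp: regular_representative_def eq_commute)
  note dW = C1_half_loc_deriv(1)[OF this(1)]
  have cW: "continuous_on UNIV W"
    using DERIV_isCont[OF dW] by (blast intro: continuous_at_imp_continuous_on)
  note [measurable] = borel_measurable_continuous_onI[OF cK] borel_measurable_continuous_onI[OF cW]
  note mL = measurable_completion
  have iW: "integrable lborel (\<lambda>x. W x / (1 + x\<^sup>2))"
  proof -
    have mB: "(\<lambda>x. W x / (1 + x\<^sup>2)) \<in> borel_measurable lborel" by simp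
    have "integrable lebesgue (\<lambda>x. \<bar>w x\<bar> / (1 + x\<^sup>2))" using w by (simp add: L_half_def)
    then have "integrable lebesgue (\<lambda>x. W x / (1 + x\<^sup>2))"
    proof (rule Bochner_Integration.integrable_bound)
      show "(\<lambda>x. W x / (1 + x\<^sup>2)) \<in> borel_measurable lebesgue" by (rule mL[OF mB])
      show "AE x in lebesgue. norm (W x / (1 + x\<^sup>2)) \<le> norm (\<bar>w x\<bar> / (1 + x\<^sup>2))" using ae by eventually_elim simp
    qed
    then show ?thesis using integrable_completion[OF mB] by simp
  qed
  have mf: "(\<lambda>x. K x * exp (W x)) \<in> borel_measurable lborel" by simp
  have aef: "AE x in lebesgue. K x * exp (w x) = K x * exp (W x)" using ae by eventually_elim simp
  have "integrable lebesgue (\<lambda>x. K x * exp (W x))" by (rule integrable_cong_AE_imp[OF int mL[OF mf] aef])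
  then have iF: "integrable lborel (\<lambda>x. K x * exp (W x))" unfolding integrable_completion[OF mf] .
  interpret weak_half_laplace W "\<lambda>x. K x * exp (W x)"
  proof
    fix \<phi> :: "real \<Rightarrow> real" assume tf: "test_function \<phi>"
    note [measurable] = test_function_measurable[OF tf]
    have m1: "(\<lambda>x. W x * frac_lap \<phi> x) \<in> borel_measurable lborel"
      unfolding frac_lap_def[abs_def] second_diff_def by measurable
    have m3: "frac_lap \<phi> \<in> borel_measurable lborel"
      unfolding frac_lap_def[abs_def] second_diff_def by measurable
    have m2: "(\<lambda>x. K x * exp (W x) * \<phi> x) \<in> borel_measurable lborel" by simp
    have "(LINT x|lborel. W x * frac_lap \<phi> x) = (LINT x|lebesgue. W x * frac_lap \<phi> x)"
      by (rule integral_completion[OF m1, symmetric])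
    also have "\<dots> = (LINT x|lebesgue. w x * frac_lap \<phi> x)"
    proof (rule integral_cong_AE)
      show "(\<lambda>x. W x * frac_lap \<phi> x) \<in> borel_measurable lebesgue" by (rule mL[OF m1])
      show "(\<lambda>x. w x * frac_lap \<phi> x) \<in> borel_measurable lebesgue" by (intro borel_measurable_times mL[OF m3] L_half_measurable[OF w])
      show "AE x in lebesgue. W x * frac_lap \<phi> x = w x * frac_lap \<phi> x" using ae by eventually_elim simp
    qed
    also have "\<dots> = (LINT x|lebesgue. K x * exp (w x) * \<phi> x)"
      using sol[unfolded solves_liouville_def, rule_format, OF tf] unfolding half_laplacian_eq_frac_lap[OF tf] .
    also have "\<dots> = (LINT x|lebesgue. K x * exp (W x) * \<phi> x)"
    proof (rule integral_cong_AE)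
      show "(\<lambda>x. K x * exp (W x) * \<phi> x) \<in> borel_measurable lebesgue" by (rule mL[OF m2])
      have "\<phi> \<in> borel_measurable lebesgue" by (rule mL) simp
      then show "(\<lambda>x. K x * exp (w x) * \<phi> x) \<in> borel_measurable lebesgue"
        by (rule borel_measurable_times[OF borel_measurable_integrable[OF int]])
      show "AE x in lebesgue. K x * exp (w x) * \<phi> x = K x * exp (W x) * \<phi> x" using aef by eventually_elim simp
    qed
    also have "\<dots> = (LINT x|lborel. K x * exp (W x) * \<phi> x)" by (rule integral_completion[OF m2])
    finally show "(LINT x|lborel. W x * frac_lap \<phi> x) = (LINT x|lborel. K x * exp (W x) * \<phi> x)" .
  next
    show "continuous_on UNIV (\<lambda>x. K x * exp (W x))" by (intro continuous_intros cK cW)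
  qed (rule cW iW iF)+
  show ?thesis
  proof
    fix x :: real assume x: "x \<noteq> 0"
    have jb: "\<bar>x\<bar> \<le> japanese_bracket x" unfolding japanese_bracket_def by (rule real_le_rsqrt) simp
    have "0 \<le> C * japanese_bracket x powr (- 1/2 - \<delta>)"
      by (rule order_trans[OF _ bound]) (simp add: less_imp_le[OF Kpos])
    then have C: "0 \<le> C" using jb x by (auto simp: zero_le_mult_iff)
    have "japanese_bracket x powr (- 1/2 - \<delta>) \<le> \<bar>x\<bar> powr (- 1/2 - \<delta>)"
      by (rule powr_mono2') (use x jb \<delta> in simp_all)
    then have "sqrt (K x) \<le> C * \<bar>x\<bar> powr (- 1/2 - \<delta>)"
      using bound[of x] C by (meson mult_left_mono order_trans)
    then have "(sqrt (K x))\<^sup>2 \<le> (C * \<bar>x\<bar> powr (- 1/2 - \<delta>))\<^sup>2"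
      by (intro power_mono) (simp_all add: less_imp_le[OF Kpos])
    also have "\<dots> = C\<^sup>2 * \<bar>x\<bar> powr (- 1 - 2 * \<delta>)"
      by (simp add: power_mult_distrib power2_eq_square[of "_ powr _"] powr_add[symmetric])
    finally show "K x \<le> C\<^sup>2 * \<bar>x\<bar> powr (- 1 - 2 * \<delta>)" by (simp add: less_imp_le[OF Kpos])
  next
    show "integrable lborel (\<lambda>x. K x * exp (W x) * (ln \<bar>x - y\<bar> - ln \<bar>x - z\<bar>))" for y z
      by (rule integrable_two_point)
    show "pi * (W z - W y) = (LINT x|lborel. K x * exp (W x) * (ln \<bar>x - y\<bar> - ln \<bar>x - z\<bar>))" for y z
      by (rule two_point_formula)
  qed (use A \<delta> cK cW iF in \<open>auto simp: assumption_A_def\<close>)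
qed

theorem theorem2:
  fixes K w w' W W' :: "real \<Rightarrow> real"
  assumes "assumption_A K"
    and "w \<in> L_half" and "w' \<in> L_half"
    and "integrable lebesgue (\<lambda>x. K x * exp (w x))"
    and "integrable lebesgue (\<lambda>x. K x * exp (w' x))"
    and "solves_liouville K w" and "solves_liouville K w'"
    and "regular_representative W w" and "regular_representative W' w'"
    and "W' 0 = W 0"
  shows "W' = W"
proof
  fix x
  obtain C \<delta> where \<delta>: "\<delta> > 0"
    and b: "\<And>x. sqrt (K x) + \<bar>x * deriv (\<lambda>y. sqrt (K y)) x\<bar> \<le> C * japanese_bracket x powr (- 1/2 - \<delta>)"
    using assms(1) unfolding assumption_A_def by blast
  have b': "sqrt (K x) \<le> C * japanese_bracket x powr (- 1/2 - \<delta>)" for x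
    using b[of x] by (meson abs_ge_zero le_add_same_cancel1 order_trans)
  have "K C1_differentiable_on UNIV" using assms(1) by (simp add: assumption_A_def)
  then obtain dK where dK: "\<And>x. (K has_real_derivative dK x) (at x)" "continuous_on UNIV dK"
    unfolding C1_differentiable_on_def has_real_derivative_iff_has_vector_derivative by auto
  have rep: "C1_half_loc W" "C1_half_loc W'" using assms(8,9) by (simp_all add: regular_representative_def)
  have S: "liouville_solution K W (C\<^sup>2) (2 * \<delta>)"
    using assms(1) b' \<delta> assms(2,4,6,8) by (rule liouville_solution_of_weak)
  have S': "liouville_solution K W' (C\<^sup>2) (2 * \<delta>)"
    using assms(1) b' \<delta> assms(3,5,7,9) by (rule liouville_solution_of_weak)
  show "W' x = W x"
    by (rule liouville_unique[OF S S' assms(10) C1_half_loc_deriv[OF rep(1)] C1_half_loc_deriv[OF rep(2)] dK])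
qed

end
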